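(* Fix a topological space $X$. Let $$\mathbf{C}(X)=\bigl(C^3(X;\mathbb{R}/\mathbb{Z})/dC^2(X;\mathbb{R}/\mathbb{Z})\bigr)\times Z^2(X;\mathbb{Z}/2)\times Z^1(X;\mathbb{Z}/2)$$ with its natural compact topology. (1) There is a continuous multiplication on $\mathbf{C}(X)$ defined by $$(w,p,a)\cdot(v,q,b)=(u,\,p+q+ab,\,a+b),$$ $$u=w+v+\tfrac12\bigl[p\cup_1 q+(p+q)\cup_1(ab)+a(a\cup_1 b)b\bigr]+\tfrac14AB^2,$$ making $\mathbf{C}(X)$ a (in general non-abelian) compact group. (2) The function $\mathbf{D}\colon\mathbf{C}(X)\to C^4(X;\mathbb{R}/\mathbb{Z})$ defined by $\mathbf{D}(w,p,a)=dw+\tfrac12p^2$ is a continuous homomorphism. (3) Define $\mathbf{C}'(X)=C^1(X;\mathbb{Z}/2)\times C^0(X;\mathbb{Z}/2)$ with multiplication $(t,x)\cdot(s,y)=(t+s+x\,dy,\,x+y)$. This is a compact group, and the map $\mathbf{D}'\colon\mathbf{C}'(X)\to\mathbf{C}(X)$ given by $\mathbf{D}'(t,x)=(\tfrac12\,t\,dt,\,dt,\,dx)$ is a continuous homomorphism whose image is a normal subgroup of $\mathbf{C}(X)$ containing the commutator subgroup. (4) Furthermore, $\mathbf{D}\circ\mathbf{D}'=0$. Define $G(X)=\mathrm{Ker}(\mathbf{D})/\mathrm{Im}(\mathbf{D}')$. Then $G$ is a (contravariant) functor from the homotopy category of spaces to the category of compact abelian groups.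
   Context: $C^*(X;M)$ and $Z^*(X;M)$ denote singular cochains and singular cocycles of $X$ with coefficients in the abelian group $M$; $d$ is the coboundary. When $M$ is a compact abelian group (such as $\mathbb{Z}/2$ or $\mathbb{R}/\mathbb{Z}$), $C^k(X;M)$ is a product of copies of $M$ indexed by singular $k$-simplices and carries the product topology; $Z^k$, $B^k=dC^{k-1}$ and quotients get the induced compact topologies. Juxtaposition and powers denote the Alexander–Whitney cup product at cochain level: $(xy)(0,\dots,m+n)=x(0,\dots,m)\,y(m,\dots,m+n)$. The Steenrod $\cup_1$ products of $\mathbb{Z}/2$ cochains used here are given on standard simplices by $(a\cup_1b)(0,1)=a(0,1)b(0,1)$ for $a,b$ of degree 1, and $(p\cup_1q)(0,1,2,3)=p(0,1,3)q(1,2,3)+p(0,2,3)q(0,1,2)$ for $p,q$ of degree 2. For $a\in Z^1(X;\mathbb{Z}/2)$, the capital letter $A\in C^1(X;\mathbb{Z})$ denotes the special integral lift of $a$: the unique integral cochain lifting $a$ and taking only values $0$ and $1$ on singular 1-simplices; likewise $B$ for $b$. The symbol $\tfrac12$ applied to $\mathbb{Z}/2$ cochains is the map induced by the inclusion $\mathbb{Z}/2\to\mathbb{R}/\mathbb{Z}$, $1\mapsto\tfrac12$; the symbol $\tfrac14$ applied to integral cochains is induced by $\mathbb{Z}\to\mathbb{R}/\mathbb{Z}$, $1\mapsto\tfrac14$. For a continuous map $f\colon X\to Y$, the map $f^*\colon G(Y)\to G(X)$ is induced by $(w,p,a)\mapsto(f^*w,f^*p,f^*a)$. *)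

theory Defs
  imports "HOL-Homology.Homology" "HOL-Library.Z2" "HOL-Algebra.Generated_Groups"
begin

section \<open>Compact groups\<close>

text \<open>A topology on the carrier is kept separate from the group record.\<close>

definition topological_group :: "('g, 'r) monoid_scheme \<Rightarrow> 'g topology \<Rightarrow> bool" where
  "topological_group G T \<longleftrightarrow> group G \<and> topspace T = carrier G \<and>
     continuous_map (prod_topology T T) T (\<lambda>(x, y). x \<otimes>\<^bsub>G\<^esub> y) \<and>
     continuous_map T T (\<lambda>x. inv\<^bsub>G\<^esub> x)"

definition compact_group :: "('g, 'r) monoid_scheme \<Rightarrow> 'g topology \<Rightarrow> bool" where
  "compact_group G T \<longleftrightarrow> topological_group G T \<and> compact_space T \<and> Hausdorff_space T"

definition continuous_hom ::
    "('g, 'r) monoid_scheme \<Rightarrow> 'g topology \<Rightarrow> ('h, 's) monoid_scheme \<Rightarrow> 'h topology \<Rightarrow> ('g \<Rightarrow> 'h) set" where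
  "continuous_hom G S H T = {f \<in> hom G H. continuous_map S T f}"

definition quotient_topology :: "'x topology \<Rightarrow> ('x \<Rightarrow> 'y) \<Rightarrow> 'y topology" where
  "quotient_topology T f =
     topology (\<lambda>U. U \<subseteq> f ` topspace T \<and> openin T {x \<in> topspace T. f x \<in> U})"

lemma openin_quotient_topology:
  "openin (quotient_topology T f) U \<longleftrightarrow>
     U \<subseteq> f ` topspace T \<and> openin T {x \<in> topspace T. f x \<in> U}"
proof -
  have "istopology (\<lambda>U. U \<subseteq> f ` topspace T \<and> openin T {x \<in> topspace T. f x \<in> U})"
    unfolding istopology_def
  proof (intro conjI allI impI)
    fix S U
    assume S: "S \<subseteq> f ` topspace T \<and> openin T {x \<in> topspace T. f x \<in> S}"
      and U: "U \<subseteq> f ` topspace T \<and> openin T {x \<in> topspace T. f x \<in> U}"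
    have "{x \<in> topspace T. f x \<in> S \<inter> U} =
        {x \<in> topspace T. f x \<in> S} \<inter> {x \<in> topspace T. f x \<in> U}"
      by blast
    with S U show "openin T {x \<in> topspace T. f x \<in> S \<inter> U}"
      by (simp add: openin_Int)
    show "S \<inter> U \<subseteq> f ` topspace T"
      using S by blast
  next
    fix K
    assume K: "\<forall>S\<in>K. S \<subseteq> f ` topspace T \<and> openin T {x \<in> topspace T. f x \<in> S}"
    have "{x \<in> topspace T. f x \<in> \<Union> K} = (\<Union>S\<in>K. {x \<in> topspace T. f x \<in> S})"
      by blast
    moreover have "openin T (\<Union>S\<in>K. {x \<in> topspace T. f x \<in> S})"
      using K by (intro openin_Union) blast
    ultimately show "openin T {x \<in> topspace T. f x \<in> \<Union> K}"
      by (rule ssubst)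
    show "\<Union> K \<subseteq> f ` topspace T"
      by (rule Union_least) (use K in simp)
  qed
  from topology_inverse'[OF this] show ?thesis
    unfolding quotient_topology_def by (rule fun_cong)
qed

lemma topspace_quotient_topology [simp]: "topspace (quotient_topology T f) = f ` topspace T"
proof
  show "topspace (quotient_topology T f) \<subseteq> f ` topspace T"
    using openin_topspace [of "quotient_topology T f"]
    unfolding openin_quotient_topology by (rule conjunct1)
  have "{x \<in> topspace T. f x \<in> f ` topspace T} = topspace T"
    by blast
  then have "openin (quotient_topology T f) (f ` topspace T)"
    unfolding openin_quotient_topology by simp
  then show "f ` topspace T \<subseteq> topspace (quotient_topology T f)"
    by (rule openin_subset)
qed

lemma quotient_map_quotient_topology: "quotient_map T (quotient_topology T f) f"
  unfolding quotient_map_def openin_quotient_topology by simp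

section \<open>The coefficient groups\<close>

text \<open>The group of two elements is the type \<^typ>\<open>bit\<close>, with the discrete topology.\<close>

instantiation bit :: discrete_topology
begin

definition open_bit :: "bit set \<Rightarrow> bool" where
  "open_bit U \<longleftrightarrow> True"

instance by standard (simp_all add: open_bit_def)

end

text \<open>The group of reals modulo integers, with the quotient topology.\<close>

quotient_type real_mod_int = real / "\<lambda>x y. x - y \<in> \<int>"
  morphisms rep_real_mod_int to_circle
proof (rule equivpI)
  show "reflp (\<lambda>x y::real. x - y \<in> \<int>)"
    by (rule reflpI) simp
  show "symp (\<lambda>x y::real. x - y \<in> \<int>)"
  proof (rule sympI)
    fix x y :: real
    assume "x - y \<in> \<int>"
    then have "- (x - y) \<in> \<int>" by (rule Ints_minus)
    then show "y - x \<in> \<int>" by simp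
  qed
  show "transp (\<lambda>x y::real. x - y \<in> \<int>)"
  proof (rule transpI)
    fix x y z :: real
    assume "x - y \<in> \<int>" "y - z \<in> \<int>"
    then have "(x - y) + (y - z) \<in> \<int>" by (rule Ints_add)
    then show "x - z \<in> \<int>" by simp
  qed
qed

instantiation real_mod_int :: ab_group_add
begin

lift_definition zero_real_mod_int :: real_mod_int is "0::real" .

lift_definition plus_real_mod_int :: "real_mod_int \<Rightarrow> real_mod_int \<Rightarrow> real_mod_int" is
  "(+) :: real \<Rightarrow> real \<Rightarrow> real"
proof -
  fix x x' y y' :: real
  assume "x - x' \<in> \<int>" "y - y' \<in> \<int>"
  then have "(x - x') + (y - y') \<in> \<int>" by (rule Ints_add)
  then show "(x + y) - (x' + y') \<in> \<int>" by (simp add: algebra_simps)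
qed

lift_definition uminus_real_mod_int :: "real_mod_int \<Rightarrow> real_mod_int" is
  "uminus :: real \<Rightarrow> real"
proof -
  fix x x' :: real
  assume "x - x' \<in> \<int>"
  then have "- (x - x') \<in> \<int>" by (rule Ints_minus)
  then show "- x - - x' \<in> \<int>" by simp
qed

lift_definition minus_real_mod_int :: "real_mod_int \<Rightarrow> real_mod_int \<Rightarrow> real_mod_int" is
  "(-) :: real \<Rightarrow> real \<Rightarrow> real"
proof -
  fix x x' y y' :: real
  assume "x - x' \<in> \<int>" "y - y' \<in> \<int>"
  then have "(x - x') - (y - y') \<in> \<int>" by (rule Ints_diff)
  then show "(x - y) - (x' - y') \<in> \<int>" by (simp add: algebra_simps)
qed

instance
proof
  fix x y z :: real_mod_int
  show "x + y + z = x + (y + z)" by transfer (simp add: algebra_simps)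
  show "x + y = y + x" by transfer (simp add: algebra_simps)
  show "0 + x = x" by transfer simp
  show "- x + x = 0" by transfer simp
  show "x - y = x + - y" by transfer simp
qed

end

instantiation real_mod_int :: topological_space
begin

definition open_real_mod_int :: "real_mod_int set \<Rightarrow> bool" where
  "open_real_mod_int U \<longleftrightarrow> open (to_circle -` U)"

instance
proof
  show "open (UNIV :: real_mod_int set)"
    by (simp add: open_real_mod_int_def)
  show "open (S \<inter> U)" if "open S" "open U" for S U :: "real_mod_int set"
    using that by (simp add: open_real_mod_int_def open_Int)
  show "open (\<Union> K)" if "\<forall>S\<in>K. open S" for K :: "real_mod_int set set"
    using that by (auto simp: open_real_mod_int_def vimage_Union)
qed

end

definition half :: "bit \<Rightarrow> real_mod_int" where
  "half e = to_circle (if e = 1 then 1 / 2 else 0)"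

definition quarter :: "int \<Rightarrow> real_mod_int" where
  "quarter n = to_circle (of_int n / 4)"

section \<open>Singular cochains\<close>

type_synonym ('a, 'm) cochain = "((nat \<Rightarrow> real) \<Rightarrow> 'a) \<Rightarrow> 'm"

definition coefficient_group :: "'m::ab_group_add monoid" where
  "coefficient_group = \<lparr>carrier = UNIV, monoid.mult = (+), one = 0\<rparr>"

definition cochains :: "nat \<Rightarrow> 'a topology \<Rightarrow> ('a, 'm::ab_group_add) cochain monoid" where
  "cochains k X = product_group (singular_simplex_set k X) (\<lambda>_. coefficient_group)"

definition cochain_topology ::
    "nat \<Rightarrow> 'a topology \<Rightarrow> ('a, 'm::{ab_group_add, topological_space}) cochain topology" where
  "cochain_topology k X = product_topology (\<lambda>_. euclidean) (singular_simplex_set k X)"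

abbreviation cochain_add ::
    "('a, 'm::ab_group_add) cochain \<Rightarrow> nat \<Rightarrow> 'a topology \<Rightarrow> ('a, 'm) cochain \<Rightarrow> ('a, 'm) cochain"
    (\<open>(_ +\<^bsub>_,_\<^esub> _)\<close> [65, 0, 0, 66] 65) where
  "x +\<^bsub>k,X\<^esub> y \<equiv> x \<otimes>\<^bsub>cochains k X\<^esub> y"

definition coboundary :: "nat \<Rightarrow> 'a topology \<Rightarrow> ('a, 'm::ab_group_add) cochain \<Rightarrow> ('a, 'm) cochain" where
  "coboundary k X c = (\<lambda>\<sigma>\<in>singular_simplex_set (Suc k) X.
     \<Sum>i\<le>Suc k. if even i then c (singular_face (Suc k) i \<sigma>) else - c (singular_face (Suc k) i \<sigma>))"

definition cocycles :: "nat \<Rightarrow> 'a topology \<Rightarrow> ('a, 'm::ab_group_add) cochain set" where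
  "cocycles k X = kernel (cochains k X) (cochains (Suc k) X) (coboundary k X)"

definition change_coefficients ::
    "('m \<Rightarrow> 'n) \<Rightarrow> nat \<Rightarrow> 'a topology \<Rightarrow> ('a, 'm) cochain \<Rightarrow> ('a, 'n) cochain" where
  "change_coefficients h k X c = (\<lambda>\<sigma>\<in>singular_simplex_set k X. h (c \<sigma>))"

definition pull_cochain ::
    "nat \<Rightarrow> 'a topology \<Rightarrow> ('a \<Rightarrow> 'b) \<Rightarrow> ('b, 'm) cochain \<Rightarrow> ('a, 'm) cochain" where
  "pull_cochain k X f c = (\<lambda>\<sigma>\<in>singular_simplex_set k X. c (simplex_map k f \<sigma>))"

text \<open>If \<open>vs = [v\<^sub>0, \<dots>, v\<^sub>q]\<close>, then \<open>subsimplex vs \<sigma>\<close> is the singular \<open>q\<close>-simplex obtained by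
  restricting \<open>\<sigma>\<close> to the vertices \<open>v\<^sub>0, \<dots>, v\<^sub>q\<close>; the value of a cochain \<open>c\<close> on it is what is
  commonly written \<open>c(v\<^sub>0, \<dots>, v\<^sub>q)\<close>.\<close>

definition subsimplex :: "nat list \<Rightarrow> ((nat \<Rightarrow> real) \<Rightarrow> 'a) \<Rightarrow> (nat \<Rightarrow> real) \<Rightarrow> 'a" where
  "subsimplex vs \<sigma> = (let q = length vs - 1 in
     simplex_map q \<sigma> (oriented_simplex q (\<lambda>i j. if j = vs ! i then 1 else 0)))"

definition cup ::
    "nat \<Rightarrow> nat \<Rightarrow> 'a topology \<Rightarrow> ('a, 'm::comm_ring_1) cochain \<Rightarrow> ('a, 'm) cochain \<Rightarrow> ('a, 'm) cochain" where
  "cup m n X x y = (\<lambda>\<sigma>\<in>singular_simplex_set (m + n) X.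
     x (subsimplex [0..<m + 1] \<sigma>) * y (subsimplex [m..<m + n + 1] \<sigma>))"

text \<open>The cup-1 products of two 1-cochains and of two 2-cochains.\<close>

definition cup1_deg1 :: "'a topology \<Rightarrow> ('a, bit) cochain \<Rightarrow> ('a, bit) cochain \<Rightarrow> ('a, bit) cochain" where
  "cup1_deg1 X a b = (\<lambda>\<sigma>\<in>singular_simplex_set 1 X.
     a (subsimplex [0, 1] \<sigma>) * b (subsimplex [0, 1] \<sigma>))"

definition cup1_deg2 :: "'a topology \<Rightarrow> ('a, bit) cochain \<Rightarrow> ('a, bit) cochain \<Rightarrow> ('a, bit) cochain" where
  "cup1_deg2 X p q = (\<lambda>\<sigma>\<in>singular_simplex_set 3 X.
     p (subsimplex [0, 1, 3] \<sigma>) * q (subsimplex [1, 2, 3] \<sigma>) +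
     p (subsimplex [0, 2, 3] \<sigma>) * q (subsimplex [0, 1, 2] \<sigma>))"

definition special_lift :: "'a topology \<Rightarrow> ('a, bit) cochain \<Rightarrow> ('a, int) cochain" where
  "special_lift X a = change_coefficients (\<lambda>e. if e = 1 then 1 else 0) 1 X a"

section \<open>The groups \<open>C(X)\<close>, \<open>C'(X)\<close> and \<open>G(X)\<close>\<close>

definition B3 :: "'a topology \<Rightarrow> ('a, real_mod_int) cochain set" where
  "B3 X = coboundary 2 X ` carrier (cochains 2 X)"

definition cls3 :: "'a topology \<Rightarrow> ('a, real_mod_int) cochain \<Rightarrow> ('a, real_mod_int) cochain set" where
  "cls3 X z = B3 X #>\<^bsub>cochains 3 X\<^esub> z"

definition C3_mod_B3 :: "'a topology \<Rightarrow> ('a, real_mod_int) cochain set monoid" where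
  "C3_mod_B3 X = cochains 3 X Mod B3 X"

type_synonym 'a triple =
  "('a, real_mod_int) cochain set \<times> ('a, bit) cochain \<times> ('a, bit) cochain"

definition twist :: "'a topology \<Rightarrow> ('a, bit) cochain \<Rightarrow> ('a, bit) cochain \<Rightarrow>
    ('a, bit) cochain \<Rightarrow> ('a, bit) cochain \<Rightarrow> ('a, real_mod_int) cochain" where
  "twist X p a q b =
     (let ab = cup 1 1 X a b; A = special_lift X a; B = special_lift X b in
        change_coefficients half 3 X
          (cup1_deg2 X p q +\<^bsub>3,X\<^esub> cup1_deg2 X (p +\<^bsub>2,X\<^esub> q) ab
             +\<^bsub>3,X\<^esub> cup 1 2 X a (cup 1 1 X (cup1_deg1 X a b) b))
        +\<^bsub>3,X\<^esub> change_coefficients quarter 3 X (cup 1 2 X A (cup 1 1 X B B)))"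

definition bigC :: "'a topology \<Rightarrow> 'a triple monoid" where
  "bigC X =
     \<lparr>carrier = carrier (C3_mod_B3 X) \<times> cocycles 2 X \<times> cocycles 1 X,
      monoid.mult = (\<lambda>(w, p, a) (v, q, b).
        (w \<otimes>\<^bsub>C3_mod_B3 X\<^esub> v \<otimes>\<^bsub>C3_mod_B3 X\<^esub> cls3 X (twist X p a q b),
         p +\<^bsub>2,X\<^esub> q +\<^bsub>2,X\<^esub> cup 1 1 X a b,
         a +\<^bsub>1,X\<^esub> b)),
      one = (\<one>\<^bsub>C3_mod_B3 X\<^esub>, \<one>\<^bsub>cochains 2 X\<^esub>, \<one>\<^bsub>cochains 1 X\<^esub>)\<rparr>"

definition bigC_topology :: "'a topology \<Rightarrow> 'a triple topology" where
  "bigC_topology X =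
     prod_topology (quotient_topology (cochain_topology 3 X) (cls3 X))
       (prod_topology (subtopology (cochain_topology 2 X) (cocycles 2 X))
                      (subtopology (cochain_topology 1 X) (cocycles 1 X)))"

text \<open>The coboundary is constant on each class in \<^term>\<open>C3_mod_B3 X\<close>, so \<^const>\<open>the_elem\<close>
  picks its only value.\<close>

definition bigD :: "'a topology \<Rightarrow> 'a triple \<Rightarrow> ('a, real_mod_int) cochain" where
  "bigD X = (\<lambda>(w, p, a).
     the_elem (coboundary 3 X ` w) +\<^bsub>4,X\<^esub> change_coefficients half 4 X (cup 2 2 X p p))"

definition bigC' :: "'a topology \<Rightarrow> (('a, bit) cochain \<times> ('a, bit) cochain) monoid" where
  "bigC' X =
     \<lparr>carrier = carrier (cochains 1 X) \<times> carrier (cochains 0 X),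
      monoid.mult = (\<lambda>(t, x) (s, y).
        (t +\<^bsub>1,X\<^esub> s +\<^bsub>1,X\<^esub> cup 0 1 X x (coboundary 0 X y), x +\<^bsub>0,X\<^esub> y)),
      one = (\<one>\<^bsub>cochains 1 X\<^esub>, \<one>\<^bsub>cochains 0 X\<^esub>)\<rparr>"

definition bigC'_topology :: "'a topology \<Rightarrow> (('a, bit) cochain \<times> ('a, bit) cochain) topology" where
  "bigC'_topology X = prod_topology (cochain_topology 1 X) (cochain_topology 0 X)"

definition bigD' :: "'a topology \<Rightarrow> ('a, bit) cochain \<times> ('a, bit) cochain \<Rightarrow> 'a triple" where
  "bigD' X = (\<lambda>(t, x).
     (cls3 X (change_coefficients half 3 X (cup 1 2 X t (coboundary 1 X t))),
      coboundary 1 X t,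
      coboundary 0 X x))"

definition KerD :: "'a topology \<Rightarrow> 'a triple set" where
  "KerD X = kernel (bigC X) (cochains 4 X) (bigD X)"

definition ImD' :: "'a topology \<Rightarrow> 'a triple set" where
  "ImD' X = bigD' X ` carrier (bigC' X)"

definition G :: "'a topology \<Rightarrow> 'a triple set monoid" where
  "G X = (bigC X\<lparr>carrier := KerD X\<rparr>) Mod ImD' X"

definition G_class :: "'a topology \<Rightarrow> 'a triple \<Rightarrow> 'a triple set" where
  "G_class X c = ImD' X #>\<^bsub>bigC X\<^esub> c"

definition G_topology :: "'a topology \<Rightarrow> 'a triple set topology" where
  "G_topology X = quotient_topology (subtopology (bigC_topology X) (KerD X)) (G_class X)"

text \<open>Pullback along a map \<open>f\<close> from \<open>X\<close> to another space. As above, \<^const>\<open>the_elem\<close> picks the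
  value which is independent of the representative.\<close>

definition pull_triple :: "'a topology \<Rightarrow> ('a \<Rightarrow> 'b) \<Rightarrow> 'b triple \<Rightarrow> 'a triple" where
  "pull_triple X f = (\<lambda>(w, p, a).
     (the_elem ((\<lambda>z. cls3 X (pull_cochain 3 X f z)) ` w),
      pull_cochain 2 X f p,
      pull_cochain 1 X f a))"

definition G_map :: "'a topology \<Rightarrow> ('a \<Rightarrow> 'b) \<Rightarrow> 'b triple set \<Rightarrow> 'a triple set" where
  "G_map X f \<xi> = the_elem ((\<lambda>c. G_class X (pull_triple X f c)) ` \<xi>)"

end

theory Submission
  imports Defs
begin

text \<open>The group \<open>C(X)\<close> is an iterated extension: \<open>Z\<^sup>1(X; Z/2)\<close> by \<open>Z\<^sup>2(X; Z/2)\<close> by \<open>C\<^sup>3/dC\<^sup>2\<close>, and its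
  multiplication is given by the twisting cochain \<^const>\<open>twist\<close>. All algebraic claims say that some
  natural expression in cocycles is a coboundary, and they are proved by exhibiting a primitive. A
  cochain identity may be checked on one simplex, where a cocycle is a finite collection of bits
  subject to linear relations. The terms that involve cocycles \<open>p, q\<close> of degree two are governed by
  the Steenrod identities: \<open>p \<union>\<^sub>1 q + q \<union>\<^sub>1 p\<close> is the coboundary of \<open>p \<union>\<^sub>2 q\<close>, whose value on a 2-simplex
  is the product of the two values, and \<open>d(p \<union>\<^sub>1 q) = pq + qp\<close>. What is left over involves only
  cocycles of degree one and coefficients \<open>1/2\<close> and \<open>1/4\<close>; here the primitive is an explicit function
  of the bits on the edges or vertices of a triangle, and verifying it is a finite case distinction. This gives
  associativity (\<open>twist_value_assoc\<close>), the multiplicativity of \<open>D'\<close> (\<open>twist_value_exact\<close>) and of \<open>D\<close>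
  (\<open>twist_value_coboundary\<close>), and the formula \<open>c c' = D'(a \<union>\<^sub>1 b, 0) c' c\<close> (\<open>twist_value_comm\<close>). The
  last one shows that the image of \<open>D'\<close> contains all commutators, hence is normal, and that \<open>G(X)\<close> is
  abelian.

  The topological claims follow from two facts. Every operation on cochains is given, at each simplex,
  by a continuous function of finitely many values; and the subgroups by which one divides are compact,
  being images of compact spaces, so that the quotients are again compact groups
  (\<open>compact_group_quotient\<close>).

  Homotopy invariance is reduced to the cylinder \<open>I \<times> X\<close> with its retraction \<open>r\<close> onto the bottom: it
  suffices that \<open>r\<close> induces the identity of \<open>G(I \<times> X)\<close>. For \<open>c\<close> in the kernel of \<open>D\<close> the element
  \<open>c (r\<^sup>*c)\<^sup>-\<^sup>1\<close> is killed by \<open>r\<^sup>*\<close>, and an element \<open>(w, p, a)\<close> killed by \<open>r\<^sup>*\<close> lies in the image of \<open>D'\<close>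
  (\<open>KerD_trivial_of_retraction\<close>): as every cocycle \<open>z\<close> differs from \<open>r\<^sup>*z\<close> by a coboundary, one removes
  successively \<open>a = dx\<close> and \<open>p = ds\<close> by elements of the image, and then \<open>w\<close> is a cocycle and a
  coboundary. The fact about cocycles is the classical prism construction
  (\<open>homotopic_pullbacks_cohomologous\<close>).\<close>

section \<open>Compact groups\<close>

lemma continuous_map_group_mult:
  assumes "topological_group H T" "continuous_map S T f" "continuous_map S T g"
  shows "continuous_map S T (\<lambda>x. f x \<otimes>\<^bsub>H\<^esub> g x)"
proof -
  have "continuous_map S T ((\<lambda>(x, y). x \<otimes>\<^bsub>H\<^esub> y) \<circ> (\<lambda>x. (f x, g x)))"
    using assms unfolding topological_group_def
    by (intro continuous_map_compose [of _ "prod_topology T T"] continuous_map_pairedI) auto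
  then show ?thesis by (simp add: o_def)
qed

lemma continuous_map_group_inv:
  assumes "topological_group H T" "continuous_map S T f"
  shows "continuous_map S T (\<lambda>x. inv\<^bsub>H\<^esub> f x)"
proof -
  have "continuous_map S T ((\<lambda>x. inv\<^bsub>H\<^esub> x) \<circ> f)"
    using assms unfolding topological_group_def by (intro continuous_map_compose) auto
  then show ?thesis by (simp add: o_def)
qed

lemma continuous_map_through_quotient:
  assumes "continuous_map T S (\<lambda>x. h (f x))"
  shows "continuous_map (quotient_topology T f) S h"
  using continuous_compose_quotient_map [OF quotient_map_quotient_topology, of T S h f] assms
  by (simp add: o_def)

lemma compact_group_closed_subgroup:
  assumes "compact_group H T" "subgroup K H" "closedin T K"
  shows "compact_group (H\<lparr>carrier := K\<rparr>) (subtopology T K)"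
proof -
  interpret group H using assms(1) by (simp add: compact_group_def topological_group_def)
  have T: "topological_group H T" and sub: "K \<subseteq> topspace T"
    using assms by (auto simp: compact_group_def closedin_subset)
  have fst: "continuous_map (prod_topology (subtopology T K) (subtopology T K)) T fst"
    and snd: "continuous_map (prod_topology (subtopology T K) (subtopology T K)) T snd"
    using continuous_map_fst [of "subtopology T K" "subtopology T K"]
      continuous_map_snd [of "subtopology T K" "subtopology T K"]
    by (auto simp: continuous_map_in_subtopology)
  have "continuous_map (prod_topology (subtopology T K) (subtopology T K)) (subtopology T K)
      (\<lambda>z. fst z \<otimes>\<^bsub>H\<^esub> snd z)"
    unfolding continuous_map_in_subtopology
    using continuous_map_group_mult [OF T fst snd] subgroup.m_closed [OF assms(2)] by auto
  moreover have "continuous_map (subtopology T K) (subtopology T K) (\<lambda>x. inv\<^bsub>H\<^esub> x)"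
    unfolding continuous_map_in_subtopology
    using continuous_map_group_inv [OF T continuous_map_from_subtopology [OF continuous_map_id]]
      subgroup.m_inv_closed [OF assms(2)] by auto
  then have "continuous_map (subtopology T K) (subtopology T K) (\<lambda>x. inv\<^bsub>H\<lparr>carrier := K\<rparr>\<^esub> x)"
    by (rule continuous_map_eq) (use m_inv_consistent [OF assms(2)] in auto)
  moreover have "compact_space (subtopology T K)"
    using assms by (simp add: compact_group_def closedin_compact_space compact_space_subtopology)
  ultimately show ?thesis
    using assms sub subgroup_imp_group [OF assms(2)]
    by (auto simp: compact_group_def topological_group_def case_prod_unfold Hausdorff_space_subtopology)
qed

text \<open>The projection to the cosets is open, because the saturation of an open set is a union of
  translates of it; so its square is again a quotient map, through which the multiplication
  factors. Closedness of the subgroup separates two different cosets.\<close>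

lemma compact_group_quotient:
  assumes H: "compact_group H T" and N: "N \<lhd> H" and closed: "closedin T N"
  shows "compact_group (H Mod N) (quotient_topology T (\<lambda>x. N #>\<^bsub>H\<^esub> x))"
proof -
  interpret normal N H by (rule N)
  define q where "q = (\<lambda>x. N #>\<^bsub>H\<^esub> x)"
  define Q where "Q = quotient_topology T q"
  have T: "topological_group H T" and top: "topspace T = carrier H"
    using H by (auto simp: compact_group_def topological_group_def)
  have qm: "quotient_map T Q q"
    unfolding Q_def by (rule quotient_map_quotient_topology)
  then have contq: "continuous_map T Q q"
    by (rule quotient_imp_continuous_map)
  have topQ: "topspace Q = q ` carrier H"
    unfolding Q_def by (simp add: top)
  have q_eq_iff: "q x = q y \<longleftrightarrow> x \<otimes>\<^bsub>H\<^esub> inv\<^bsub>H\<^esub> y \<in> N" if "x \<in> carrier H" "y \<in> carrier H" for x y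
  proof
    assume "q x = q y"
    then have "x \<in> N #>\<^bsub>H\<^esub> y"
      using rcos_self [OF that(1) subgroup_axioms] by (simp add: q_def)
    then show "x \<otimes>\<^bsub>H\<^esub> inv\<^bsub>H\<^esub> y \<in> N"
      using that by (auto simp: r_coset_def m_assoc)
  next
    assume "x \<otimes>\<^bsub>H\<^esub> inv\<^bsub>H\<^esub> y \<in> N"
    then have "(x \<otimes>\<^bsub>H\<^esub> inv\<^bsub>H\<^esub> y) \<otimes>\<^bsub>H\<^esub> y \<in> N #>\<^bsub>H\<^esub> y"
      by (auto simp: r_coset_def)
    then have "x \<in> N #>\<^bsub>H\<^esub> y"
      using that by (simp add: m_assoc)
    then show "q x = q y"
      using repr_independence [OF _ that(2) subgroup_axioms] by (simp add: q_def)
  qed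
  have openq: "open_map T Q q"
    unfolding open_map_def
  proof (intro allI impI)
    fix U assume U: "openin T U"
    have "{x \<in> topspace T. q x \<in> q ` U} = (\<Union>n\<in>N. {x \<in> topspace T. n \<otimes>\<^bsub>H\<^esub> x \<in> U})"
    proof (intro equalityI subsetI)
      fix x assume "x \<in> {x \<in> topspace T. q x \<in> q ` U}"
      then obtain u where x: "x \<in> carrier H" and u: "u \<in> U" "q x = q u"
        by (auto simp: top)
      then have uH: "u \<in> carrier H"
        using U openin_subset top by blast
      then have "u \<otimes>\<^bsub>H\<^esub> inv\<^bsub>H\<^esub> x \<in> N"
        using q_eq_iff [OF uH x] u by simp
      moreover have "u \<otimes>\<^bsub>H\<^esub> inv\<^bsub>H\<^esub> x \<otimes>\<^bsub>H\<^esub> x = u"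
        using x uH by (simp add: m_assoc)
      ultimately show "x \<in> (\<Union>n\<in>N. {x \<in> topspace T. n \<otimes>\<^bsub>H\<^esub> x \<in> U})"
        using u x top by force
    next
      fix x assume "x \<in> (\<Union>n\<in>N. {x \<in> topspace T. n \<otimes>\<^bsub>H\<^esub> x \<in> U})"
      then obtain n where n: "n \<in> N" "x \<in> carrier H" "n \<otimes>\<^bsub>H\<^esub> x \<in> U"
        by (auto simp: top)
      then have nH: "n \<in> carrier H" by simp
      then have "q (n \<otimes>\<^bsub>H\<^esub> x) = q x"
        using n by (subst q_eq_iff) (auto simp: m_assoc)
      then show "x \<in> {x \<in> topspace T. q x \<in> q ` U}"
        using n top by (auto intro!: image_eqI [of _ _ "n \<otimes>\<^bsub>H\<^esub> x"])
    qed
    also have "openin T \<dots>"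
    proof (intro openin_Union ballI, clarify)
      fix n assume n: "n \<in> N"
      then have "continuous_map T T (\<lambda>x. n \<otimes>\<^bsub>H\<^esub> x)"
        by (intro continuous_map_group_mult [OF T]) (auto simp: top)
      then show "openin T {x \<in> topspace T. n \<otimes>\<^bsub>H\<^esub> x \<in> U}"
        using U by (rule openin_continuous_map_preimage)
    qed
    finally show "openin Q (q ` U)"
      unfolding Q_def openin_quotient_topology using openin_subset [OF U] by blast
  qed
  define qq where "qq = (\<lambda>(x, y). (q x, q y))"
  have "quotient_map (prod_topology T T) (prod_topology Q Q) qq"
  proof (rule continuous_open_imp_quotient_map)
    show "continuous_map (prod_topology T T) (prod_topology Q Q) qq"
      unfolding qq_def case_prod_unfold
      by (intro continuous_map_pairedI continuous_map_compose [OF _ contq, unfolded o_def]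
          continuous_map_fst continuous_map_snd)
    show "qq ` topspace (prod_topology T T) = topspace (prod_topology Q Q)"
      by (force simp: qq_def topQ top)
    show "open_map (prod_topology T T) (prod_topology Q Q) qq"
      unfolding open_map_def openin_prod_topology_alt
    proof (clarsimp simp: qq_def)
      fix W x y assume W: "\<forall>x y. (x, y) \<in> W \<longrightarrow> (\<exists>U. openin T U \<and> (\<exists>V. openin T V \<and> x \<in> U \<and> y \<in> V \<and> U \<times> V \<subseteq> W))"
        and xy: "(x, y) \<in> W"
      from W [rule_format, OF xy]
      obtain U V where UV: "openin T U" "openin T V" "x \<in> U" "y \<in> V" "U \<times> V \<subseteq> W"
        by (elim exE conjE)
      then have "openin Q (q ` U)" "openin Q (q ` V)"
        using openq by (auto simp: open_map_def)
      moreover have "q ` U \<times> q ` V \<subseteq> (\<lambda>(x, y). (q x, q y)) ` W"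
        using UV by force
      ultimately show "\<exists>U. openin Q U \<and> (\<exists>V. openin Q V \<and> q x \<in> U \<and> q y \<in> V \<and>
            U \<times> V \<subseteq> (\<lambda>(x, y). (q x, q y)) ` W)"
        using UV by (intro exI [of _ "q ` U"] conjI exI [of _ "q ` V"]) auto
    qed
  qed
  moreover have "continuous_map (prod_topology T T) Q ((\<lambda>(x, y). x \<otimes>\<^bsub>H Mod N\<^esub> y) \<circ> qq)"
  proof (rule continuous_map_eq)
    show "continuous_map (prod_topology T T) Q (\<lambda>z. q (fst z \<otimes>\<^bsub>H\<^esub> snd z))"
      by (intro continuous_map_compose [OF _ contq, unfolded o_def] continuous_map_group_mult [OF T]
          continuous_map_fst continuous_map_snd)
  qed (auto simp: qq_def q_def rcos_sum top)
  ultimately have mult: "continuous_map (prod_topology Q Q) Q (\<lambda>(x, y). x \<otimes>\<^bsub>H Mod N\<^esub> y)"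
    by (rule continuous_compose_quotient_map)
  have "continuous_map T Q (\<lambda>x. inv\<^bsub>H Mod N\<^esub> q x)"
  proof (rule continuous_map_eq)
    show "continuous_map T Q (\<lambda>x. q (inv\<^bsub>H\<^esub> x))"
      by (intro continuous_map_compose [OF _ contq, unfolded o_def] continuous_map_group_inv [OF T]
          continuous_map_id [unfolded id_def])
  qed (auto simp: q_def rcos_inv top inv_FactGroup carrier_FactGroup)
  then have inv: "continuous_map Q Q (\<lambda>x. inv\<^bsub>H Mod N\<^esub> x)"
    unfolding Q_def by (rule continuous_map_through_quotient)
  have "Hausdorff_space Q"
    unfolding Hausdorff_space_def
  proof (intro allI impI)
    fix X Y assume "X \<in> topspace Q \<and> Y \<in> topspace Q \<and> X \<noteq> Y"
    then obtain x y where xy: "x \<in> carrier H" "y \<in> carrier H" "X = q x" "Y = q y" "q x \<noteq> q y"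
      by (auto simp: topQ)
    have "continuous_map (prod_topology T T) T (\<lambda>z. fst z \<otimes>\<^bsub>H\<^esub> inv\<^bsub>H\<^esub> snd z)"
      by (intro continuous_map_group_mult [OF T] continuous_map_group_inv [OF T]
          continuous_map_fst continuous_map_snd)
    define E where "E = {z \<in> topspace (prod_topology T T). fst z \<otimes>\<^bsub>H\<^esub> inv\<^bsub>H\<^esub> snd z \<in> topspace T - N}"
    have "openin (prod_topology T T) E"
      unfolding E_def using closed \<open>continuous_map (prod_topology T T) T _\<close>
      by (intro openin_continuous_map_preimage) auto
    moreover have "(x, y) \<in> E"
      using xy q_eq_iff by (auto simp: E_def top)
    ultimately have "\<exists>U V. openin T U \<and> openin T V \<and> x \<in> U \<and> y \<in> V \<and> U \<times> V \<subseteq> E"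
      using iffD1 [OF openin_prod_topology_alt, rule_format, of T T E x y] by simp
    then obtain U V where UV: "openin T U" "openin T V" "x \<in> U" "y \<in> V" "U \<times> V \<subseteq> E"
      by (elim exE conjE)
    have "q u \<noteq> q v" if "u \<in> U" "v \<in> V" for u v
      using UV(5) that q_eq_iff [of u v] by (auto simp: E_def top subset_iff)
    then have "disjnt (q ` U) (q ` V)"
      by (auto simp: disjnt_iff)
    then show "\<exists>U V. openin Q U \<and> openin Q V \<and> X \<in> U \<and> Y \<in> V \<and> disjnt U V"
      using UV openq xy unfolding open_map_def
      by (intro exI [of _ "q ` U"] exI [of _ "q ` V"]) simp
  qed
  moreover have "compact_space Q"
    using H contq image_compactin [OF _ contq, of "topspace T"]
    by (simp add: compact_group_def compact_space_def topQ top)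
  ultimately show ?thesis
    using mult inv factorgroup_is_group topQ
    by (simp add: compact_group_def topological_group_def carrier_FactGroup Q_def [symmetric]
        q_def [symmetric])
qed

lemma compact_group_power:
  assumes "compact_group H T"
  shows "compact_group (product_group I (\<lambda>_. H)) (product_topology (\<lambda>_. T) I)"
proof -
  have T: "topological_group H T" and top: "topspace T = carrier H" and gr: "group H"
    using assms by (auto simp: compact_group_def topological_group_def)
  let ?T = "product_topology (\<lambda>_. T) I"
  have "continuous_map (prod_topology ?T ?T) ?T (\<lambda>z. \<lambda>i\<in>I. fst z i \<otimes>\<^bsub>H\<^esub> snd z i)"
    unfolding continuous_map_componentwise
    by (auto intro!: continuous_map_group_mult [OF T] 
        continuous_map_compose [OF continuous_map_fst continuous_map_product_projection, unfolded o_def]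
        continuous_map_compose [OF continuous_map_snd continuous_map_product_projection, unfolded o_def])
  moreover have "continuous_map ?T ?T (\<lambda>x. \<lambda>i\<in>I. inv\<^bsub>H\<^esub> x i)"
    unfolding continuous_map_componentwise
    by (auto intro!: continuous_map_group_inv [OF T] continuous_map_product_projection)
  then have "continuous_map ?T ?T (\<lambda>x. inv\<^bsub>product_group I (\<lambda>_. H)\<^esub> x)"
    by (rule continuous_map_eq) (auto simp: gr top)
  ultimately show ?thesis
    using assms gr top
    by (auto simp: compact_group_def topological_group_def case_prod_unfold Hausdorff_space_product_topology
        compact_space_product_topology)
qed

lemma (in group) comm_group_quotient:
  assumes "N \<lhd> G" "\<And>x y. x \<in> carrier G \<Longrightarrow> y \<in> carrier G \<Longrightarrow> \<exists>n\<in>N. x \<otimes> y = n \<otimes> (y \<otimes> x)"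
  shows "comm_group (G Mod N)"
proof -
  interpret N: normal N G by (rule assms)
  have "N #> (x \<otimes> y) = N #> (y \<otimes> x)" if xy: "x \<in> carrier G" "y \<in> carrier G" for x y
  proof -
    obtain n where "n \<in> N" "x \<otimes> y = n \<otimes> (y \<otimes> x)"
      using assms(2) [OF xy] by blast
    then have "x \<otimes> y \<in> N #> (y \<otimes> x)"
      by (auto simp: r_coset_def)
    then show ?thesis
      using repr_independence [OF _ _ N.subgroup_axioms] xy by simp
  qed
  then show ?thesis
    by (intro group.group_comm_groupI [OF N.factorgroup_is_group])
       (auto simp: carrier_FactGroup N.rcos_sum)
qed

text \<open>Such a subgroup is normal because \<open>x n x\<^sup>-\<^sup>1\<close> is the product of a commutator and \<open>n\<close>.\<close>

lemma (in group) normal_of_commutators: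
  assumes N: "subgroup N G" and comm: "\<And>x y. x \<in> carrier G \<Longrightarrow> y \<in> carrier G \<Longrightarrow> \<exists>n\<in>N. x \<otimes> y = n \<otimes> (y \<otimes> x)"
  shows "N \<lhd> G" "derived G (carrier G) \<subseteq> N"
proof -
  have commutator: "x \<otimes> y \<otimes> inv x \<otimes> inv y \<in> N" if xy: "x \<in> carrier G" "y \<in> carrier G" for x y
  proof -
    obtain n where n: "n \<in> N" "x \<otimes> y = n \<otimes> (y \<otimes> x)"
      using comm [OF xy] by blast
    then have "n \<in> carrier G"
      using N subgroup.mem_carrier by metis
    then have "x \<otimes> y \<otimes> inv x \<otimes> inv y = n"
      using n xy by (simp add: m_assoc)
    then show ?thesis
      using n by simp
  qed
  then show "derived G (carrier G) \<subseteq> N"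
    unfolding derived_def by (intro generate_subgroup_incl [OF _ N]) auto
  show "N \<lhd> G"
    unfolding normal_inv_iff
  proof (intro conjI ballI N)
    fix x n assume x: "x \<in> carrier G" and n: "n \<in> N"
    then have nG: "n \<in> carrier G"
      using N subgroup.mem_carrier by metis
    have "x \<otimes> n \<otimes> inv x = (x \<otimes> n \<otimes> inv x \<otimes> inv n) \<otimes> n"
      using x nG by (simp add: m_assoc)
    also have "\<dots> \<in> N"
      using commutator [OF x nG] n subgroup.m_closed [OF N] by blast
    finally show "x \<otimes> n \<otimes> inv x \<in> N" .
  qed
qed

section \<open>The coefficient groups\<close>

lemma to_circle_eq_iff: "to_circle x = to_circle y \<longleftrightarrow> x - y \<in> \<int>"
  by (rule real_mod_int.abs_eq_iff)

lemma surj_to_circle: "range to_circle = UNIV"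
  by (metis Quotient3_abs_rep Quotient3_real_mod_int surjI)

lemma to_circle_add: "to_circle x + to_circle y = to_circle (x + y)"
  by (rule plus_real_mod_int.abs_eq)

lemma to_circle_uminus: "- to_circle x = to_circle (- x)"
  by (rule uminus_real_mod_int.abs_eq)

lemma to_circle_diff: "to_circle x - to_circle y = to_circle (x - y)"
  by (rule minus_real_mod_int.abs_eq)

lemma to_circle_0: "to_circle 0 = 0"
  by (simp add: zero_real_mod_int_def)

lemma quotient_map_to_circle: "quotient_map euclidean euclidean to_circle"
  unfolding quotient_map_def by (simp add: surj_to_circle open_real_mod_int_def vimage_def)

lemma continuous_to_circle: "continuous_map euclidean euclidean to_circle"
  by (rule quotient_imp_continuous_map [OF quotient_map_to_circle])

lemma open_map_to_circle: "open_map euclidean euclidean to_circle"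
  unfolding open_map_def
proof (intro allI impI)
  fix U :: "real set" assume "openin euclidean U"
  then have "open (\<Union>n::int. (+) (of_int n) ` U)"
    by (intro open_UN ballI open_translation) simp
  also have "(\<Union>n::int. (+) (of_int n) ` U) = to_circle -` to_circle ` U"
  proof (intro equalityI subsetI)
    fix x assume "x \<in> to_circle -` to_circle ` U"
    then obtain u where u: "u \<in> U" "x - u \<in> \<int>"
      by (auto simp: to_circle_eq_iff)
    then obtain n where "x - u = of_int n"
      by (auto elim: Ints_cases)
    then have "x = of_int n + u" by simp
    then show "x \<in> (\<Union>n::int. (+) (of_int n) ` U)"
      using u by blast
  next
    fix x assume "x \<in> (\<Union>n::int. (+) (of_int n) ` U)"
    then obtain n :: int and u where "u \<in> U" "x = of_int n + u" by blast
    then have "to_circle x = to_circle u"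
      by (simp add: to_circle_eq_iff)
    then show "x \<in> to_circle -` to_circle ` U"
      using \<open>u \<in> U\<close> by simp
  qed
  finally show "openin euclidean (to_circle ` U)"
    by (simp add: open_real_mod_int_def)
qed

text \<open>The integers are closed, so they miss a ball around \<open>x - y\<close> when \<open>x\<close> and \<open>y\<close> are inequivalent; the
  balls of half that radius around \<open>x\<close> and \<open>y\<close> then have disjoint images.\<close>

lemma Hausdorff_circle: "Hausdorff_space (euclidean :: real_mod_int topology)"
  unfolding Hausdorff_space_def
proof (intro allI impI)
  fix X Y :: real_mod_int
  assume "X \<in> topspace euclidean \<and> Y \<in> topspace euclidean \<and> X \<noteq> Y"
  moreover obtain x y where xy: "X = to_circle x" "Y = to_circle y"
    using surj_to_circle by (metis rangeE UNIV_I)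
  ultimately have "x - y \<notin> \<int>"
    by (simp add: to_circle_eq_iff)
  moreover have "closed (\<int> :: real set)"
    by (rule closed_Ints)
  ultimately obtain e where e: "e > 0" "ball (x - y) e \<inter> \<int> = {}"
    by (metis ComplI open_Compl open_contains_ball disjoint_eq_subset_Compl)
  let ?U = "to_circle ` ball x (e/2)" and ?V = "to_circle ` ball y (e/2)"
  have "to_circle u \<noteq> to_circle v" if "u \<in> ball x (e/2)" "v \<in> ball y (e/2)" for u v
  proof -
    have "dist (x - y) (u - v) < e"
      using that by (simp add: dist_real_def abs_if split: if_splits)
    then show ?thesis
      using e by (auto simp: to_circle_eq_iff)
  qed
  then have "disjnt ?U ?V"
    by (auto simp: disjnt_iff)
  moreover have "openin euclidean ?U" "openin euclidean ?V"
    using open_map_to_circle by (auto simp: open_map_def)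
  moreover have "X \<in> ?U" "Y \<in> ?V"
    using e by (auto simp: xy)
  ultimately show "\<exists>U V. openin euclidean U \<and> openin euclidean V \<and> X \<in> U \<and> Y \<in> V \<and> disjnt U V"
    by blast
qed

lemma compact_circle: "compact_space (euclidean :: real_mod_int topology)"
proof -
  have "to_circle x \<in> to_circle ` {0..1}" for x
  proof (rule image_eqI)
    show "to_circle x = to_circle (frac x)"
      by (simp add: to_circle_eq_iff frac_def)
    show "frac x \<in> {0..1}"
      using frac_lt_1 [of x] by simp
  qed
  then have "UNIV = to_circle ` {0..1}"
    using surj_to_circle by (metis UNIV_eq_I rangeE UNIV_I)
  moreover have "compactin euclidean (to_circle ` {0..1})"
    by (rule image_compactin [OF _ continuous_to_circle]) simp
  ultimately show ?thesis
    by (simp add: compact_space_def)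
qed

text \<open>The projection of the line to the circle is open, so its square is a quotient map, through which
  the continuity of the addition can be tested.\<close>

lemma continuous_map_circle_add:
  assumes "continuous_map T euclidean f" "continuous_map T euclidean g"
  shows "continuous_map T euclidean (\<lambda>x. f x + g x :: real_mod_int)"
proof -
  let ?e = "euclidean :: real_mod_int topology" and ?c = "\<lambda>(x, y). (to_circle x, to_circle y)"
  have "quotient_map (prod_topology euclidean euclidean) (prod_topology ?e ?e) ?c"
  proof (rule continuous_open_imp_quotient_map)
    show "continuous_map (prod_topology euclidean euclidean) (prod_topology ?e ?e) ?c"
      unfolding case_prod_unfold
      by (intro continuous_map_pairedI continuous_map_compose [OF _ continuous_to_circle, unfolded o_def]
          continuous_map_fst continuous_map_snd)
    show "?c ` topspace (prod_topology euclidean euclidean) = topspace (prod_topology ?e ?e)"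
    proof -
      have "(X, Y) \<in> range ?c" for X Y
      proof -
        obtain x y where "X = to_circle x" "Y = to_circle y"
          using surj_to_circle by (metis rangeE UNIV_I)
        then have "(X, Y) = ?c (x, y)" by simp
        then show ?thesis by (rule range_eqI)
      qed
      then show ?thesis by auto
    qed
    show "open_map (prod_topology euclidean euclidean) (prod_topology ?e ?e) ?c"
      unfolding open_map_def openin_prod_topology_alt
    proof (intro allI impI)
      fix W X Y
      assume W: "\<forall>x y. (x, y) \<in> W \<longrightarrow>
          (\<exists>U V. openin euclidean U \<and> openin euclidean V \<and> x \<in> U \<and> y \<in> V \<and> U \<times> V \<subseteq> W)"
        and "(X, Y) \<in> ?c ` W"
      then obtain x y where xy: "(x, y) \<in> W" "X = to_circle x" "Y = to_circle y"
        by auto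
      from W [rule_format, OF xy(1)]
      obtain U V where UV: "openin euclidean U" "openin euclidean V" "x \<in> U" "y \<in> V" "U \<times> V \<subseteq> W"
        by (elim exE conjE)
      have "to_circle ` U \<times> to_circle ` V \<subseteq> ?c ` W"
        using UV(5) by force
      then show "\<exists>U V. openin ?e U \<and> openin ?e V \<and> X \<in> U \<and> Y \<in> V \<and> U \<times> V \<subseteq> ?c ` W"
        using UV xy open_map_to_circle unfolding open_map_def
        by (intro exI [of _ "to_circle ` U"] exI [of _ "to_circle ` V"]) auto
    qed
  qed
  moreover have "continuous_map (prod_topology euclidean euclidean) ?e ((\<lambda>z. fst z + snd z) \<circ> ?c)"
  proof (rule continuous_map_eq)
    show "continuous_map (prod_topology euclidean euclidean) ?e (\<lambda>z. to_circle (fst z + snd z))"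
      by (intro continuous_map_compose [OF _ continuous_to_circle, unfolded o_def]
          continuous_map_add continuous_map_fst continuous_map_snd)
  qed (auto simp: to_circle_add)
  ultimately have "continuous_map (prod_topology ?e ?e) ?e (\<lambda>z. fst z + snd z)"
    by (rule continuous_compose_quotient_map)
  from continuous_map_compose [OF continuous_map_pairedI [OF assms] this]
  show ?thesis by (simp add: o_def)
qed

lemma continuous_map_circle_uminus:
  assumes "continuous_map T euclidean f"
  shows "continuous_map T euclidean (\<lambda>x. - f x :: real_mod_int)"
proof -
  have "continuous_map euclidean euclidean (uminus \<circ> to_circle)"
    by (rule continuous_map_eq [of _ _ "\<lambda>x. to_circle (- x)"])
       (intro continuous_map_compose [OF _ continuous_to_circle, unfolded o_def] continuous_map_minus
          continuous_map_id [unfolded id_def] | simp add: to_circle_uminus)+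
  then have "continuous_map euclidean euclidean (uminus :: real_mod_int \<Rightarrow> _)"
    by (rule continuous_compose_quotient_map [OF quotient_map_to_circle])
  from continuous_map_compose [OF assms this] show ?thesis
    by (simp add: o_def)
qed

lemma continuous_map_discrete:
  fixes f :: "'a \<Rightarrow> 'd::discrete_topology"
  assumes "continuous_map T euclidean f" and "range F \<subseteq> topspace S"
  shows "continuous_map T S (\<lambda>x. F (f x))"
proof -
  have "continuous_map euclidean S F"
    using assms(2) by (auto simp: continuous_map_def open_discrete)
  from continuous_map_compose [OF assms(1) this] show ?thesis
    by (simp add: o_def)
qed

lemma continuous_map_discrete2:
  fixes f :: "'a \<Rightarrow> 'd::discrete_topology" and g :: "'a \<Rightarrow> 'e::discrete_topology"
  assumes f: "continuous_map T euclidean f" and g: "continuous_map T euclidean g"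
    and "\<And>u v. F u v \<in> topspace S"
  shows "continuous_map T S (\<lambda>x. F (f x) (g x))"
proof -
  have "openin T {x \<in> topspace T. F (f x) (g x) \<in> U}" for U
  proof -
    have "{x \<in> topspace T. F (f x) (g x) \<in> U} =
        (\<Union>(u, v)\<in>{(u, v). F u v \<in> U}. {x \<in> topspace T. f x \<in> {u}} \<inter> {x \<in> topspace T. g x \<in> {v}})"
      by auto
    also have "openin T \<dots>"
    proof (intro openin_Union ballI, clarify)
      fix u v
      have "openin T {x \<in> topspace T. f x \<in> {u}}" "openin T {x \<in> topspace T. g x \<in> {v}}"
        by (rule openin_continuous_map_preimage [OF f] openin_continuous_map_preimage [OF g],
            simp add: open_discrete)+
      then show "openin T ({x \<in> topspace T. f x \<in> {u}} \<inter> {x \<in> topspace T. g x \<in> {v}})"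
        by (rule openin_Int)
    qed
    finally show ?thesis .
  qed
  then show ?thesis
    using assms(3) by (auto simp: continuous_map_def)
qed

lemma group_coefficient_group [simp]: "comm_group (coefficient_group :: 'm::ab_group_add monoid)"
proof (rule comm_groupI)
  fix x :: 'm
  show "\<exists>y\<in>carrier coefficient_group. y \<otimes>\<^bsub>coefficient_group\<^esub> x = \<one>\<^bsub>coefficient_group\<^esub>"
    by (rule bexI [of _ "- x"]) (simp_all add: coefficient_group_def)
qed (simp_all add: coefficient_group_def add_ac)

lemma carrier_coefficient_group [simp]: "carrier coefficient_group = UNIV"
  and mult_coefficient_group [simp]: "x \<otimes>\<^bsub>coefficient_group\<^esub> y = x + y"
  and one_coefficient_group [simp]: "\<one>\<^bsub>coefficient_group\<^esub> = 0"
  by (simp_all add: coefficient_group_def)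

lemma inv_coefficient_group [simp]: "inv\<^bsub>coefficient_group\<^esub> (x :: 'm::ab_group_add) = - x"
  by (rule group.inv_equality) (simp_all add: comm_group.axioms)

lemma compact_group_circle: "compact_group coefficient_group (euclidean :: real_mod_int topology)"
proof -
  let ?e = "euclidean :: real_mod_int topology"
  have "continuous_map (prod_topology ?e ?e) ?e (\<lambda>z. fst z + snd z)" "continuous_map ?e ?e uminus"
    using continuous_map_circle_uminus [OF continuous_map_id]
    by (auto intro: continuous_map_circle_add continuous_map_fst continuous_map_snd
        simp del: euclidean_product_topology continuous_map_iff_continuous2 prod_topology_euclidean)
  then show ?thesis
    unfolding compact_group_def topological_group_def case_prod_unfold
    using Hausdorff_circle compact_circle by (simp add: comm_group.axioms)
qed

lemma finite_UNIV_bit: "finite (UNIV :: bit set)"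
proof (rule finite_subset)
  show "(UNIV :: bit set) \<subseteq> {0, 1}"
    by (metis (full_types) bit_not_zero_iff insertCI subsetI)
qed simp

lemma compact_group_bit: "compact_group coefficient_group (euclidean :: bit topology)"
proof -
  have "compact_space (euclidean :: bit topology)"
    using finite_UNIV_bit by (simp add: compact_space_def finite_imp_compact)
  moreover have "Hausdorff_space (euclidean :: bit topology)"
    unfolding Hausdorff_space_def
  proof (intro allI impI)
    fix x y :: bit assume "x \<in> topspace euclidean \<and> y \<in> topspace euclidean \<and> x \<noteq> y"
    then show "\<exists>U V. openin euclidean U \<and> openin euclidean V \<and> x \<in> U \<and> y \<in> V \<and> disjnt U V"
      by (intro exI [of _ "{x}"] exI [of _ "{y}"]) (auto simp: open_discrete)
  qed
  moreover have "continuous_map (prod_topology euclidean euclidean) euclidean (\<lambda>z. fst z + snd z :: bit)"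
    by (rule continuous_map_discrete2 [OF continuous_map_fst continuous_map_snd]) simp
  moreover have "continuous_map euclidean euclidean (\<lambda>x. - x :: bit)"
    by (simp add: id_def)
  ultimately show ?thesis
    unfolding compact_group_def topological_group_def case_prod_unfold
    by (simp add: comm_group.axioms)
qed

lemma half_add: "half (x + y) = half x + half y"
  by (cases x; cases y) (simp_all add: half_def to_circle_add to_circle_eq_iff)

lemma half_0 [simp]: "half 0 = 0"
  by (simp add: half_def to_circle_0)

lemma uminus_half [simp]: "- half x = half x"
  by (cases x) (simp_all add: half_def to_circle_uminus to_circle_eq_iff)

text \<open>Both \<open>half\<close> and \<open>quarter\<close> are read off from this function, which turns identities in the
  circle into congruences of integers modulo eight.\<close>

definition eighth :: "int \<Rightarrow> real_mod_int" where
  "eighth n = to_circle (of_int n / 8)"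

lemma eighth_eq_iff: "eighth m = eighth n \<longleftrightarrow> m mod 8 = n mod 8"
proof -
  have "(of_int m / 8 - of_int n / 8 :: real) \<in> \<int> \<longleftrightarrow> 8 dvd m - n"
  proof
    assume "(of_int m / 8 - of_int n / 8 :: real) \<in> \<int>"
    then obtain k where "(of_int m / 8 - of_int n / 8 :: real) = of_int k"
      by (auto elim: Ints_cases)
    then have "(of_int (m - n) :: real) = of_int (8 * k)" by simp
    then have "m - n = 8 * k" unfolding of_int_eq_iff .
    then show "8 dvd m - n" by simp
  next
    assume "8 dvd m - n"
    then obtain k where "m = n + 8 * k" by (metis dvdE add.commute diff_add_cancel)
    then show "(of_int m / 8 - of_int n / 8 :: real) \<in> \<int>"
      by (simp add: add_divide_distrib)
  qed
  then show ?thesis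
    by (simp add: eighth_def to_circle_eq_iff mod_eq_dvd_iff)
qed

lemma eighth_add: "eighth m + eighth n = eighth (m + n)"
  by (simp add: eighth_def to_circle_add add_divide_distrib)

lemma eighth_diff: "eighth m - eighth n = eighth (m - n)"
  by (simp add: eighth_def to_circle_diff diff_divide_distrib)

abbreviation lift01 :: "bit \<Rightarrow> int" where
  "lift01 e \<equiv> (if e = 1 then 1 else 0)"

lemma half_eq_eighth: "half e = eighth (4 * lift01 e)"
  by (simp add: half_def eighth_def)

lemma quarter_eq_eighth: "quarter n = eighth (2 * n)"
  by (simp add: quarter_def eighth_def)

text \<open>Bits are kept as ring elements, so that their identities can be normalized, and \<open>1\<close> is not
  rewritten to \<open>Suc 0\<close>, so that vertex lists and degrees keep their form.\<close>

declare add_bit_eq_xor [simp del] mult_bit_eq_and [simp del] One_nat_def [simp del]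

section \<open>Faces of singular simplices\<close>

text \<open>The affine map of standard simplices that sends the \<open>j\<close>-th vertex to the vertex \<open>vs ! j\<close>.\<close>

definition push :: "nat list \<Rightarrow> (nat \<Rightarrow> real) \<Rightarrow> nat \<Rightarrow> real" where
  "push vs x = (\<lambda>i. \<Sum>j<length vs. if i = vs ! j then x j else 0)"

lemma subsimplex_eq:
  assumes "vs \<noteq> []"
  shows "subsimplex vs \<sigma> = (\<lambda>x\<in>standard_simplex (length vs - 1). \<sigma> (push vs x))"
proof -
  have *: "{..length vs - 1} = {..<length vs}"
    using assms by (cases vs) (simp_all add: lessThan_Suc_atMost)
  have "(\<Sum>j\<le>length vs - 1. (if i = vs ! j then 1 else 0) * x j) = push vs x i" for x i
    unfolding push_def * by (intro sum.cong) simp_all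
  then show ?thesis
    by (simp add: subsimplex_def simplex_map_def oriented_simplex_def Let_def o_def restrict_def fun_eq_iff)
qed

lemma push_in_standard_simplex:
  assumes "set vs \<subseteq> {..n}" "vs \<noteq> []" "x \<in> standard_simplex (length vs - 1)"
  shows "push vs x \<in> standard_simplex n"
proof -
  have *: "{..length vs - 1} = {..<length vs}"
    using assms by (cases vs) (auto simp: lessThan_Suc_atMost)
  have x: "x j \<ge> 0" "sum x {..<length vs} = 1" for j
    using assms * by (auto simp: standard_simplex_def)
  have le: "vs ! j \<le> n" if "j < length vs" for j
    using assms(1) that by (meson atMost_iff nth_mem subsetD)
  have nonneg: "push vs x i \<ge> 0" for i
    by (auto simp: push_def x intro: sum_nonneg)
  have "push vs x i \<le> 1" for i
    unfolding push_def x(2) [symmetric] by (rule sum_mono) (simp add: x)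
  moreover have "push vs x i = 0" if "i > n" for i
    unfolding push_def using that le by (intro sum.neutral ballI) (simp, metis leD)
  moreover have "(\<Sum>i\<le>n. push vs x i) = (\<Sum>j<length vs. \<Sum>i\<le>n. if i = vs ! j then x j else 0)"
    unfolding push_def by (rule sum.swap)
  then have "(\<Sum>i\<le>n. push vs x i) = 1"
    using x le by simp
  ultimately show ?thesis
    using nonneg by (simp add: standard_simplex_def)
qed

text \<open>A linear functional pulls back along an affine map by composing its values at the vertices.\<close>

lemma sum_push:
  assumes "set us \<subseteq> {..<n}"
  shows "(\<Sum>j<n. g j * push us x j) = (\<Sum>k<length us. g (us ! k) * x k)"
proof -
  have "(\<Sum>j<n. g j * push us x j) = (\<Sum>k<length us. \<Sum>j<n. g j * (if j = us ! k then x k else 0))"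
    unfolding push_def sum_distrib_left by (rule sum.swap)
  also have "\<dots> = (\<Sum>k<length us. g (us ! k) * x k)"
  proof (rule sum.cong [OF refl])
    fix k assume "k \<in> {..<length us}"
    then have k: "us ! k < n"
      using assms by (meson lessThan_iff nth_mem subsetD)
    have "(\<Sum>j<n. g j * (if j = us ! k then x k else 0)) = (\<Sum>j<n. if j = us ! k then g (us ! k) * x k else 0)"
      by (rule sum.cong) auto
    then show "(\<Sum>j<n. g j * (if j = us ! k then x k else 0)) = g (us ! k) * x k"
      using k by simp
  qed
  finally show ?thesis .
qed

lemma push_push:
  assumes "set us \<subseteq> {..<length vs}"
  shows "push vs (push us x) = push (map ((!) vs) us) x"
proof
  fix i
  have *: "push ws y i = (\<Sum>j<length ws. of_bool (i = ws ! j) * y j)" for ws y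
    unfolding push_def by (intro sum.cong) auto
  show "push vs (push us x) i = push (map ((!) vs) us) x i"
    unfolding * [of vs] sum_push [OF assms] by (simp add: *)
qed

lemma continuous_map_push:
  assumes "set vs \<subseteq> {..n}" "vs \<noteq> []"
  shows "continuous_map (subtopology (powertop_real UNIV) (standard_simplex (length vs - 1)))
           (subtopology (powertop_real UNIV) (standard_simplex n)) (push vs)"
proof -
  have "continuous_map (powertop_real UNIV) euclideanreal (\<lambda>x. push vs x i)" for i
    unfolding push_def
    by (intro continuous_map_sum) (auto intro: continuous_map_product_projection)
  then have "continuous_map (subtopology (powertop_real UNIV) (standard_simplex (length vs - 1)))
      (powertop_real UNIV) (push vs)"
    by (simp add: continuous_map_componentwise_UNIV continuous_map_from_subtopology)
  then show ?thesis
    using push_in_standard_simplex [OF assms] by (auto simp: continuous_map_in_subtopology)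
qed

lemma singular_simplex_subsimplex:
  assumes \<sigma>: "singular_simplex n X \<sigma>" and vs: "set vs \<subseteq> {..n}" "length vs = Suc k"
  shows "singular_simplex k X (subsimplex vs \<sigma>)"
proof -
  have vs': "vs \<noteq> []" "length vs - 1 = k" using vs by auto
  have "continuous_map (subtopology (powertop_real UNIV) (standard_simplex k)) X (\<sigma> \<circ> push vs)"
    using continuous_map_compose [OF continuous_map_push [OF vs(1) vs'(1)], of X \<sigma>] \<sigma> vs'
    by (simp add: singular_simplex_def)
  then show ?thesis
    using vs' by (auto simp: singular_simplex_def subsimplex_eq o_def intro: continuous_map_eq)
qed

text \<open>Together with the description of the faces below, this reduces the combinatorics of iterated faces
  to the composition of lists of vertices.\<close>

lemma subsimplex_subsimplex:
  assumes "set us \<subseteq> {..<length vs}" "us \<noteq> []"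
  shows "subsimplex us (subsimplex vs \<sigma>) = subsimplex (map ((!) vs) us) \<sigma>"
proof -
  have vs: "vs \<noteq> []" using assms by (cases us) auto
  then have "set us \<subseteq> {..length vs - 1}"
    using assms by (cases vs) (auto simp: lessThan_Suc_atMost)
  then have "push us x \<in> standard_simplex (length vs - 1)" if "x \<in> standard_simplex (length us - 1)" for x
    using push_in_standard_simplex assms that by blast
  then show ?thesis
    using assms vs by (auto simp: subsimplex_eq push_push)
qed

lemma push_upt:
  assumes "x \<in> standard_simplex n"
  shows "push [0..<Suc n] x = x"
proof
  fix i
  have "push [0..<Suc n] x i = (\<Sum>j<Suc n. if i = j then x j else 0)"
    unfolding push_def by (intro sum.cong) (auto simp del: upt_Suc)
  then show "push [0..<Suc n] x i = x i"
    using assms by (simp add: standard_simplex_def)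
qed

lemma subsimplex_upt:
  assumes "singular_simplex n X \<sigma>"
  shows "subsimplex [0..<Suc n] \<sigma> = \<sigma>"
proof -
  have "\<sigma> \<in> extensional (standard_simplex n)"
    using assms by (simp add: singular_simplex_def)
  then show ?thesis
    by (subst subsimplex_eq) (auto simp: push_upt extensional_def simp del: upt_Suc)
qed

text \<open>The vertices of the face of an \<open>n\<close>-simplex opposite to the vertex \<open>i\<close>.\<close>

definition omit :: "nat \<Rightarrow> nat \<Rightarrow> nat list" where
  "omit n i = map (\<lambda>j. if j < i then j else Suc j) [0..<n]"

lemma singular_face_eq_subsimplex:
  assumes "i \<le> Suc n"
  shows "singular_face (Suc n) i \<sigma> = subsimplex (omit (Suc n) i) \<sigma>"
proof -
  have "simplical_face i x = push (omit (Suc n) i) x" if x: "x \<in> standard_simplex n" for x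
  proof
    fix m
    have x0: "x j = 0" if "j > n" for j
      using x that by (simp add: standard_simplex_def)
    have "push (omit (Suc n) i) x m = (\<Sum>j<Suc n. if m = (if j < i then j else Suc j) then x j else 0)"
      unfolding push_def omit_def by (intro sum.cong) (auto simp del: upt_Suc)
    also have "\<dots> = (\<Sum>j<Suc n. if j = (if m < i then m else m - 1) then (if m = i then 0 else x j) else 0)"
      by (rule sum.cong) auto
    also have "\<dots> = simplical_face i x m"
      using assms x0 by (auto simp: simplical_face_def)
    finally show "simplical_face i x m = push (omit (Suc n) i) x m" by simp
  qed
  then show ?thesis
    by (auto simp: singular_face_def subsimplex_eq omit_def simp del: upt_Suc)
qed

lemma subsimplex_simplex_map:
  assumes "set vs \<subseteq> {..n}" "length vs = Suc k"
  shows "subsimplex vs (simplex_map n f \<sigma>) = simplex_map k f (subsimplex vs \<sigma>)"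
proof -
  have vs: "vs \<noteq> []" "length vs - 1 = k" using assms by auto
  then show ?thesis
    using push_in_standard_simplex [OF assms(1) vs(1)] by (auto simp: subsimplex_eq simplex_map_def)
qed

section \<open>Groups of cochains\<close>

lemma carrier_cochains: "carrier (cochains k X) = singular_simplex_set k X \<rightarrow>\<^sub>E UNIV"
  by (simp add: cochains_def)

lemma restrict_in_cochains [simp]: "(\<lambda>\<sigma>\<in>singular_simplex_set k X. h \<sigma>) \<in> carrier (cochains k X)"
  by (simp add: carrier_cochains)

lemma cochain_eqI:
  assumes "x \<in> carrier (cochains k X)" "y \<in> carrier (cochains k X)"
    and "\<And>\<sigma>. singular_simplex k X \<sigma> \<Longrightarrow> x \<sigma> = y \<sigma>"
  shows "x = y"
  using assms by (metis PiE_ext carrier_cochains mem_Collect_eq)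

lemma comm_group_cochains: "comm_group (cochains k X :: ('a, 'm::ab_group_add) cochain monoid)"
proof (rule group.group_comm_groupI)
  show "group (cochains k X :: ('a, 'm) cochain monoid)"
    unfolding cochains_def by (simp add: comm_group.axioms)
qed (auto simp: cochains_def add.commute)

lemmas group_cochains = comm_group.axioms(2) [OF comm_group_cochains]

lemma cochain_add_apply [simp]: "singular_simplex k X \<sigma> \<Longrightarrow> (x +\<^bsub>k,X\<^esub> y) \<sigma> = x \<sigma> + y \<sigma>"
  by (simp add: cochains_def)

lemma cochain_zero_apply [simp]: "singular_simplex k X \<sigma> \<Longrightarrow> \<one>\<^bsub>cochains k X\<^esub> \<sigma> = 0"
  by (simp add: cochains_def)

lemma cochain_add_closed [simp]: "x +\<^bsub>k,X\<^esub> y \<in> carrier (cochains k X)"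
  by (simp add: cochains_def)

lemma cochain_zero_closed [simp]: "\<one>\<^bsub>cochains k X\<^esub> \<in> carrier (cochains k X)"
  by (simp add: cochains_def)

lemma coboundary_closed [simp]: "coboundary k X x \<in> carrier (cochains (Suc k) X)"
  by (simp add: coboundary_def)

lemma coboundary_closed_numerals [simp]:
  "coboundary 0 X x \<in> carrier (cochains 1 X)" "coboundary 1 X x \<in> carrier (cochains 2 X)"
  "coboundary 2 X x \<in> carrier (cochains 3 X)" "coboundary 3 X x \<in> carrier (cochains 4 X)"
  using coboundary_closed [of 0 X x] coboundary_closed [of 1 X x] coboundary_closed [of 2 X x]
    coboundary_closed [of 3 X x]
  by (simp_all add: numeral_eq_Suc One_nat_def)

lemma change_coefficients_closed [simp]: "change_coefficients h k X c \<in> carrier (cochains k X)"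
  and pull_cochain_closed [simp]: "pull_cochain k X f c' \<in> carrier (cochains k X)"
  and cup1_deg1_closed [simp]: "cup1_deg1 X a b \<in> carrier (cochains 1 X)"
  and cup1_deg2_closed [simp]: "cup1_deg2 X p q \<in> carrier (cochains 3 X)"
  by (simp_all add: change_coefficients_def pull_cochain_def cup1_deg1_def cup1_deg2_def)

lemma cup_closed: "cup m n X y z \<in> carrier (cochains (m + n) X)"
  by (simp add: cup_def)

lemma cup_closed_numerals [simp]:
  fixes y z :: "('a, 'm::comm_ring_1) cochain"
  shows "cup 0 1 X y z \<in> carrier (cochains 1 X)" "cup 1 1 X y z \<in> carrier (cochains 2 X)"
  "cup 1 2 X y z \<in> carrier (cochains 3 X)" "cup 2 2 X y z \<in> carrier (cochains 4 X)"
  using cup_closed [of 0 1 X y z] cup_closed [of 1 1 X y z] cup_closed [of 1 2 X y z] cup_closed [of 2 2 X y z]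
  by simp_all

lemma compact_group_cochains:
  assumes "compact_group (coefficient_group :: 'm::{ab_group_add, topological_space} monoid) euclidean"
  shows "compact_group (cochains k X :: ('a, 'm) cochain monoid) (cochain_topology k X)"
  unfolding cochains_def cochain_topology_def by (rule compact_group_power [OF assms])

lemmas compact_group_circle_cochains = compact_group_cochains [OF compact_group_circle]
lemmas compact_group_bit_cochains = compact_group_cochains [OF compact_group_bit]

lemma topspace_cochain_topology [simp]: "topspace (cochain_topology k X) = carrier (cochains k X)"
  by (simp add: cochain_topology_def carrier_cochains)

lemma continuous_map_into_cochains:
  "continuous_map T (cochain_topology k X) f \<longleftrightarrow>
     f ` topspace T \<subseteq> carrier (cochains k X) \<and>
     (\<forall>\<sigma>. singular_simplex k X \<sigma> \<longrightarrow> continuous_map T euclidean (\<lambda>x. f x \<sigma>))"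
  unfolding cochain_topology_def continuous_map_componentwise carrier_cochains
  by (auto simp: PiE_def)

lemma continuous_map_cochain_apply:
  assumes "continuous_map T (cochain_topology k X) f" "singular_simplex k X \<sigma>"
  shows "continuous_map T euclidean (\<lambda>x. f x \<sigma>)"
  using assms by (simp add: continuous_map_into_cochains)

section \<open>Evaluation of cochains on faces\<close>

text \<open>All identities between cochains are checked on one simplex \<open>\<sigma>\<close> at a time. The following
  rules express the value of each operation on a face of \<open>\<sigma>\<close> by values of the arguments on smaller
  faces of \<open>\<sigma>\<close>; a face is named by the list of its vertices.\<close>

lemma upt_numerals:
  "[0..<1] = [0]" "[0..<2] = [0, 1]" "[0..<3] = [0, 1, 2]" "[1..<3] = [1, 2]" "[1..<4] = [1, 2, 3]"
  "[2..<5] = [2, 3, 4]" "[0..<4] = [0, 1, 2, 3]" "[0..<5] = [0, 1, 2, 3, 4]"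
  by (simp_all add: upt_rec One_nat_def eval_nat_numeral)

lemma sum_atMost_numerals:
  fixes f :: "nat \<Rightarrow> 'm::ab_group_add"
  shows "sum f {..1} = f 0 + f 1" "sum f {..2} = f 0 + f 1 + f 2" "sum f {..3} = f 0 + f 1 + f 2 + f 3"
    "sum f {..4} = f 0 + f 1 + f 2 + f 3 + f 4"
  by (simp_all add: One_nat_def eval_nat_numeral)

lemma faces_numerals:
  "singular_face 1 0 \<sigma> = subsimplex [1] \<sigma>" "singular_face 1 1 \<sigma> = subsimplex [0] \<sigma>"
  "singular_face 2 0 \<sigma> = subsimplex [1, 2] \<sigma>" "singular_face 2 1 \<sigma> = subsimplex [0, 2] \<sigma>"
  "singular_face 2 2 \<sigma> = subsimplex [0, 1] \<sigma>"
  "singular_face 3 0 \<sigma> = subsimplex [1, 2, 3] \<sigma>" "singular_face 3 1 \<sigma> = subsimplex [0, 2, 3] \<sigma>"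
  "singular_face 3 2 \<sigma> = subsimplex [0, 1, 3] \<sigma>" "singular_face 3 3 \<sigma> = subsimplex [0, 1, 2] \<sigma>"
  "singular_face 4 0 \<sigma> = subsimplex [1, 2, 3, 4] \<sigma>" "singular_face 4 1 \<sigma> = subsimplex [0, 2, 3, 4] \<sigma>"
  "singular_face 4 2 \<sigma> = subsimplex [0, 1, 3, 4] \<sigma>" "singular_face 4 3 \<sigma> = subsimplex [0, 1, 2, 4] \<sigma>"
  "singular_face 4 4 \<sigma> = subsimplex [0, 1, 2, 3] \<sigma>"
  using singular_face_eq_subsimplex [of _ 0 \<sigma>] singular_face_eq_subsimplex [of _ 1 \<sigma>]
    singular_face_eq_subsimplex [of _ 2 \<sigma>] singular_face_eq_subsimplex [of _ 3 \<sigma>]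
  by (simp_all add: omit_def upt_numerals One_nat_def [symmetric] del: upt_Suc)

context
  fixes n :: nat and X :: "'a topology" and \<sigma> :: "(nat \<Rightarrow> real) \<Rightarrow> 'a"
  assumes \<sigma>: "singular_simplex n X \<sigma>"
begin

lemma face: "length vs = Suc k \<Longrightarrow> set vs \<subseteq> {..n} \<Longrightarrow> singular_simplex k X (subsimplex vs \<sigma>)"
  by (rule singular_simplex_subsimplex [OF \<sigma>])

lemma add_on_face: "length vs = Suc k \<Longrightarrow> set vs \<subseteq> {..n} \<Longrightarrow>
    (u +\<^bsub>k,X\<^esub> v) (subsimplex vs \<sigma>) = u (subsimplex vs \<sigma>) + v (subsimplex vs \<sigma>)"
  by (simp add: face)

lemma zero_on_face: "length vs = Suc k \<Longrightarrow> set vs \<subseteq> {..n} \<Longrightarrow> \<one>\<^bsub>cochains k X\<^esub> (subsimplex vs \<sigma>) = 0"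
  by (simp add: face)

lemma change_coefficients_on_face: "length vs = Suc k \<Longrightarrow> set vs \<subseteq> {..n} \<Longrightarrow>
    change_coefficients h k X c (subsimplex vs \<sigma>) = h (c (subsimplex vs \<sigma>))"
  by (simp add: change_coefficients_def face)

lemma special_lift_on_face:
  "{i, j} \<subseteq> {..n} \<Longrightarrow> special_lift X a (subsimplex [i, j] \<sigma>) = lift01 (a (subsimplex [i, j] \<sigma>))"
  unfolding special_lift_def by (simp add: change_coefficients_on_face)

lemma cup_on_face:
  fixes y z :: "('a, 'm::comm_ring_1) cochain"
  shows
  "{i, j} \<subseteq> {..n} \<Longrightarrow> cup 0 1 X y z (subsimplex [i, j] \<sigma>) = y (subsimplex [i] \<sigma>) * z (subsimplex [i, j] \<sigma>)"
  "{i, j, k} \<subseteq> {..n} \<Longrightarrow>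
    cup 1 1 X y z (subsimplex [i, j, k] \<sigma>) = y (subsimplex [i, j] \<sigma>) * z (subsimplex [j, k] \<sigma>)"
  "{i, j, k, l} \<subseteq> {..n} \<Longrightarrow>
    cup 1 2 X y z (subsimplex [i, j, k, l] \<sigma>) = y (subsimplex [i, j] \<sigma>) * z (subsimplex [j, k, l] \<sigma>)"
  "{i, j, k, l, m} \<subseteq> {..n} \<Longrightarrow>
    cup 2 2 X y z (subsimplex [i, j, k, l, m] \<sigma>) = y (subsimplex [i, j, k] \<sigma>) * z (subsimplex [k, l, m] \<sigma>)"
  by (simp_all add: cup_def face subsimplex_subsimplex upt_numerals nth_Cons')

lemma cup1_on_face:
  "{i, j} \<subseteq> {..n} \<Longrightarrow>
    cup1_deg1 X a b (subsimplex [i, j] \<sigma>) = a (subsimplex [i, j] \<sigma>) * b (subsimplex [i, j] \<sigma>)"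
  "{i, j, k, l} \<subseteq> {..n} \<Longrightarrow> cup1_deg2 X a b (subsimplex [i, j, k, l] \<sigma>) =
    a (subsimplex [i, j, l] \<sigma>) * b (subsimplex [j, k, l] \<sigma>) + a (subsimplex [i, k, l] \<sigma>) * b (subsimplex [i, j, k] \<sigma>)"
  by (simp_all add: cup1_deg1_def cup1_deg2_def face subsimplex_subsimplex nth_Cons')

lemma coboundary_on_face:
  "{i, j} \<subseteq> {..n} \<Longrightarrow> coboundary 0 X c (subsimplex [i, j] \<sigma>) =
    c (subsimplex [j] \<sigma>) - c (subsimplex [i] \<sigma>)"
  "{i, j, k} \<subseteq> {..n} \<Longrightarrow> coboundary 1 X c (subsimplex [i, j, k] \<sigma>) =
    c (subsimplex [j, k] \<sigma>) - c (subsimplex [i, k] \<sigma>) + c (subsimplex [i, j] \<sigma>)"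
  "{i, j, k, l} \<subseteq> {..n} \<Longrightarrow> coboundary 2 X c (subsimplex [i, j, k, l] \<sigma>) =
    c (subsimplex [j, k, l] \<sigma>) - c (subsimplex [i, k, l] \<sigma>) + c (subsimplex [i, j, l] \<sigma>) - c (subsimplex [i, j, k] \<sigma>)"
  "{i, j, k, l, m} \<subseteq> {..n} \<Longrightarrow> coboundary 3 X c (subsimplex [i, j, k, l, m] \<sigma>) =
    c (subsimplex [j, k, l, m] \<sigma>) - c (subsimplex [i, k, l, m] \<sigma>) + c (subsimplex [i, j, l, m] \<sigma>)
      - c (subsimplex [i, j, k, m] \<sigma>) + c (subsimplex [i, j, k, l] \<sigma>)"
  by (simp_all add: coboundary_def face sum_atMost_numerals faces_numerals subsimplex_subsimplex nth_Cons'
      One_nat_def [symmetric])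

lemma pull_cochain_on_face: "length vs = Suc k \<Longrightarrow> set vs \<subseteq> {..n} \<Longrightarrow>
    pull_cochain k X f c (subsimplex vs \<sigma>) = c (subsimplex vs (simplex_map n f \<sigma>))"
  by (simp add: pull_cochain_def face subsimplex_simplex_map)

end

lemmas on_face = add_on_face zero_on_face change_coefficients_on_face special_lift_on_face cup_on_face
  cup1_on_face coboundary_on_face

lemma simplex_eq_subsimplex:
  "singular_simplex 0 X \<sigma> \<Longrightarrow> \<sigma> = subsimplex [0] \<sigma>"
  "singular_simplex 1 X \<sigma> \<Longrightarrow> \<sigma> = subsimplex [0, 1] \<sigma>"
  "singular_simplex 2 X \<sigma> \<Longrightarrow> \<sigma> = subsimplex [0, 1, 2] \<sigma>"
  "singular_simplex 3 X \<sigma> \<Longrightarrow> \<sigma> = subsimplex [0, 1, 2, 3] \<sigma>"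
  "singular_simplex 4 X \<sigma> \<Longrightarrow> \<sigma> = subsimplex [0, 1, 2, 3, 4] \<sigma>"
  using subsimplex_upt [of 0 X \<sigma>] subsimplex_upt [of 1 X \<sigma>] subsimplex_upt [of 2 X \<sigma>]
    subsimplex_upt [of 3 X \<sigma>] subsimplex_upt [of 4 X \<sigma>]
  by (simp_all add: upt_numerals One_nat_def [symmetric] del: upt_Suc)

lemma cochain0_eqI:
  assumes "x \<in> carrier (cochains 0 X)" "y \<in> carrier (cochains 0 X)"
    and "\<And>\<sigma>. singular_simplex 0 X \<sigma> \<Longrightarrow> x (subsimplex [0] \<sigma>) = y (subsimplex [0] \<sigma>)"
  shows "x = y"
  using assms by (metis cochain_eqI simplex_eq_subsimplex(1))

lemma cochain1_eqI:
  assumes "x \<in> carrier (cochains 1 X)" "y \<in> carrier (cochains 1 X)"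
    and "\<And>\<sigma>. singular_simplex 1 X \<sigma> \<Longrightarrow> x (subsimplex [0, 1] \<sigma>) = y (subsimplex [0, 1] \<sigma>)"
  shows "x = y"
  using assms by (metis cochain_eqI simplex_eq_subsimplex(2))

lemma cochain2_eqI:
  assumes "x \<in> carrier (cochains 2 X)" "y \<in> carrier (cochains 2 X)"
    and "\<And>\<sigma>. singular_simplex 2 X \<sigma> \<Longrightarrow> x (subsimplex [0, 1, 2] \<sigma>) = y (subsimplex [0, 1, 2] \<sigma>)"
  shows "x = y"
  using assms by (metis cochain_eqI simplex_eq_subsimplex(3))

lemma cochain3_eqI:
  assumes "x \<in> carrier (cochains 3 X)" "y \<in> carrier (cochains 3 X)"
    and "\<And>\<sigma>. singular_simplex 3 X \<sigma> \<Longrightarrow> x (subsimplex [0, 1, 2, 3] \<sigma>) = y (subsimplex [0, 1, 2, 3] \<sigma>)"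
  shows "x = y"
  using assms by (metis cochain_eqI simplex_eq_subsimplex(4))

lemma cochain4_eqI:
  assumes "x \<in> carrier (cochains 4 X)" "y \<in> carrier (cochains 4 X)"
    and "\<And>\<sigma>. singular_simplex 4 X \<sigma> \<Longrightarrow> x (subsimplex [0, 1, 2, 3, 4] \<sigma>) = y (subsimplex [0, 1, 2, 3, 4] \<sigma>)"
  shows "x = y"
  using assms by (metis cochain_eqI simplex_eq_subsimplex(5))

section \<open>Identities on a single simplex\<close>

lemma bit_ring:
  fixes x y :: bit
  shows "x + x = 0" "x + (x + y) = y" "x * x = x" "x * (x * y) = x * y" "- x = x" "x - y = x + y"
  by (cases x; cases y; simp)+

lemma half_cancel: "half x + half x = 0" "half x + (half x + u) = u" "u - half x = u + half x"
proof -
  show *: "half x + half x = 0" for x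
    using half_add [of x x] by (simp add: bit_ring)
  show "half x + (half x + u) = u"
    by (simp add: * flip: add.assoc)
  show "u - half x = u + half x"
    by (metis diff_conv_add_uminus uminus_half)
qed

text \<open>The value on a 3-simplex of \<open>1/2 a(a \<union>\<^sub>1 b)b + 1/4 AB\<^sup>2\<close>, the part of the twisting cochain that
  depends on the cocycles of degree one alone. Here and below, the digits in the name of a variable
  are the vertices of the face on which the cochain takes this value.\<close>

definition degree1_twist :: "bit \<Rightarrow> bit \<Rightarrow> bit \<Rightarrow> bit \<Rightarrow> real_mod_int" where
  "degree1_twist a01 a12 b12 b23 =
     half (a01 * a12 * b12 * b23) + quarter (lift01 a01 * lift01 b12 * lift01 b23)"

text \<open>The value of \<open>p \<union>\<^sub>1 q + (p + q) \<union>\<^sub>1 ab\<close> on a 3-simplex.\<close>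

definition cup1_part :: "bit \<Rightarrow> bit \<Rightarrow> bit \<Rightarrow> bit \<Rightarrow> bit \<Rightarrow> bit \<Rightarrow> bit \<Rightarrow> bit \<Rightarrow> bit \<Rightarrow> bit \<Rightarrow> bit" where
  "cup1_part p013 p023 q012 q013 q023 q123 a01 a12 b12 b23 =
     p013 * q123 + p023 * q012 + (p013 + q013) * (a12 * b23) + (p023 + q023) * (a01 * b12)"

definition twist_value where
  "twist_value p013 p023 q012 q013 q023 q123 a01 a12 b12 b23 =
     half (cup1_part p013 p023 q012 q013 q023 q123 a01 a12 b12 b23) + degree1_twist a01 a12 b12 b23"

lemma degree1_twist_0: "degree1_twist 0 0 b12 b23 = 0" "degree1_twist a01 a12 0 0 = 0"
  by (simp_all add: degree1_twist_def quarter_def to_circle_0)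

text \<open>The next three functions are 2-cochains on a triangle. Their coboundaries are the defects, in degree
  one, of associativity, of commutativity and of the multiplicativity of \<open>D'\<close>. They come from solving
  linear equations for the values of an unknown function, one equation for each assignment of bits to
  the edges or vertices of a 3-simplex. For commutativity these equations have no solution with
  values in \<open>1/4 Z/Z\<close>, which is why eighths appear.\<close>

definition assoc_primitive where
  "assoc_primitive a01 a12 b01 b12 c01 c12 =
     quarter (3 * lift01 (a01 * a12) + 2 * lift01 (a12 * b01) + lift01 (b01 * b12)
       + 2 * lift01 (a01 * c12) + 2 * lift01 (b01 * c12) + 2 * lift01 (a01 * b01 * c12)
       + lift01 (a01 * b12 * c12) + 2 * lift01 (a01 * b01 * b12 * c12)
       + lift01 (c01 * c12))"

definition comm_primitive where
  "comm_primitive a01 a12 b01 b12 =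
     eighth (5 * lift01 (a01 * a12) + 6 * lift01 (a01 * a12 * b01)
       + 7 * lift01 (a01 * b12) + 2 * lift01 (a01 * a12 * b12)
       + 4 * lift01 (a12 * b01 * b12))"

definition exact_primitive where
  "exact_primitive x0 x1 y0 y1 y2 =
     quarter (lift01 (x0 * y1) + 2 * lift01 (x0 * x1 * y1)
       + 2 * lift01 (x0 * x1 * y0 * y1) + 2 * lift01 (x0 * x1 * y0 * y2)
       + 3 * lift01 (x0 * y1 * y2) + lift01 (x1 * y1 * y2)
       + 2 * lift01 (x0 * x1 * y1 * y2))"

lemma degree1_twist_assoc:
  assumes "a02 = a01 + a12" "b02 = b01 + b12" "c02 = c01 + c12" "a13 = a12 + a23" "b13 = b12 + b23" "c13 = c12 + c23"
  shows "degree1_twist a01 a12 b12 b23 + degree1_twist (a01 + b01) (a12 + b12) c12 c23 +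
     half (a01 * b13 * ((a12 + b12) * c23) + a02 * b23 * ((a01 + b01) * c12)
       + b01 * c13 * (a12 * (b23 + c23)) + b02 * c23 * (a01 * (b12 + c12))) =
   degree1_twist b01 b12 c12 c23 + degree1_twist a01 a12 (b12 + c12) (b23 + c23) +
     (assoc_primitive a12 a23 b12 b23 c12 c23 - assoc_primitive a02 a23 b02 b23 c02 c23
       + assoc_primitive a01 a13 b01 b13 c01 c13 - assoc_primitive a01 a12 b01 b12 c01 c12)"
  unfolding assms degree1_twist_def assoc_primitive_def half_eq_eighth quarter_eq_eighth eighth_add
    eighth_diff eighth_eq_iff
  by (cases a01; cases a12; cases a23; cases b01; cases b12; cases b23; cases c01; cases c12; cases c23; simp)

lemma degree1_twist_comm:
  assumes "a02 = a01 + a12" "b02 = b01 + b12" "a13 = a12 + a23" "b13 = b12 + b23"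
  shows "degree1_twist a01 a12 b12 b23 = degree1_twist b01 b12 a12 a23 +
     half (a01 * b01 * (a12 * b23 + b12 * a23)
       + (a01 * b13 + b01 * a13) * (b12 * a23) + (a02 * b23 + b02 * a23) * (b01 * a12)) +
     (comm_primitive a12 a23 b12 b23 - comm_primitive a02 a23 b02 b23
       + comm_primitive a01 a13 b01 b13 - comm_primitive a01 a12 b01 b12)"
  unfolding assms degree1_twist_def comm_primitive_def half_eq_eighth quarter_eq_eighth eighth_add
    eighth_diff eighth_eq_iff
  by (cases a01; cases a12; cases a23; cases b01; cases b12; cases b23; simp)

lemma degree1_twist_exact:
  shows "half (x0 * (y0 + y1) * ((x1 + x2) * (y2 + y3))) =
     degree1_twist (x0 + x1) (x1 + x2) (y1 + y2) (y2 + y3) +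
     (exact_primitive x1 x2 y1 y2 y3 - exact_primitive x0 x2 y0 y2 y3
       + exact_primitive x0 x1 y0 y1 y3 - exact_primitive x0 x1 y0 y1 y2)"
  unfolding degree1_twist_def exact_primitive_def half_eq_eighth quarter_eq_eighth eighth_add eighth_diff eighth_eq_iff
  by (cases x0; cases x1; cases x2; cases y0; cases y1; cases y2; cases y3; simp)

text \<open>The special lift of a cocycle satisfies \<open>dA = 2A\<^sup>2\<close>, so \<open>d(1/4 AB\<^sup>2) = 1/2 a\<^sup>2b\<^sup>2\<close>. This cancels one of
  the two terms of \<open>d(1/2 a(a \<union>\<^sub>1 b)b) = 1/2 (a\<^sup>2b\<^sup>2 + abab)\<close>.\<close>

lemma degree1_twist_coboundary:
  "degree1_twist a12 a23 b23 b34 - degree1_twist (a01 + a12) a23 b23 b34 + degree1_twist a01 (a12 + a23) (b12 + b23) b34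
     - degree1_twist a01 a12 b12 (b23 + b34) + degree1_twist a01 a12 b12 b23 =
   half (a01 * b12 * (a23 * b34))"
  unfolding degree1_twist_def half_eq_eighth quarter_eq_eighth eighth_add eighth_diff eighth_eq_iff
  by (cases a01; cases a12; cases a23; cases b12; cases b23; cases b34; simp)

text \<open>By bilinearity of \<open>\<union>\<^sub>1\<close>, all terms with \<open>p\<close> and \<open>q\<close> cancel, and those with \<open>r\<close> leave
  \<open>ab \<union>\<^sub>1 r + r \<union>\<^sub>1 ab = d(ab \<union>\<^sub>2 r)\<close>. The rest is a statement about cocycles of degree one.\<close>

lemma twist_value_assoc:
  assumes "a02 = a01 + a12" "b02 = b01 + b12" "c02 = c01 + c12" "a13 = a12 + a23" "b13 = b12 + b23" "c13 = c12 + c23"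
    and r123: "r123 = r023 + r013 + r012"
  shows "twist_value p013 p023 q012 q013 q023 q123 a01 a12 b12 b23 +
     twist_value (p013 + q013 + a01 * b13) (p023 + q023 + a02 * b23) r012 r013 r023 r123 (a01 + b01) (a12 +
       b12) c12 c23 =
     twist_value q013 q023 r012 r013 r023 r123 b01 b12 c12 c23 +
     twist_value p013 p023 (q012 + r012 + b01 * c12) (q013 + r013 + b01 * c13) (q023 + r023 + b02 * c23)
        (q123 + r123 + b12 * c23) a01 a12 (b12 + c12) (b23 + c23) +
     ((half (a12 * b23 * r123) + assoc_primitive a12 a23 b12 b23 c12 c23)
       - (half (a02 * b23 * r023) + assoc_primitive a02 a23 b02 b23 c02 c23)
       + (half (a01 * b13 * r013) + assoc_primitive a01 a13 b01 b13 c01 c13)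
       - (half (a01 * b12 * r012) + assoc_primitive a01 a12 b01 b12 c01 c12))"
proof -
  let ?Z = "a01 * b13 * ((a12 + b12) * c23) + a02 * b23 * ((a01 + b01) * c12)
       + b01 * c13 * (a12 * (b23 + c23)) + b02 * c23 * (a01 * (b12 + c12))"
  have "cup1_part p013 p023 q012 q013 q023 q123 a01 a12 b12 b23 =
     cup1_part (p013 + q013 + a01 * b13) (p023 + q023 + a02 * b23) r012 r013 r023 r123 (a01 + b01) (a12 + b12) c12 c23 +
     cup1_part q013 q023 r012 r013 r023 r123 b01 b12 c12 c23 +
     cup1_part p013 p023 (q012 + r012 + b01 * c12) (q013 + r013 + b01 * c13) (q023 + r023 + b02 * c23)
        (q123 + r123 + b12 * c23) a01 a12 (b12 + c12) (b23 + c23) +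
     (a12 * b23 * r123 + a02 * b23 * r023 + a01 * b13 * r013 + a01 * b12 * r012) + ?Z"
    unfolding assms cup1_part_def by (simp add: algebra_simps bit_ring)
  note half_eq = arg_cong [OF this, of half, unfolded half_add [of "_ + ?Z"] half_add [of _ ?Z]]
  have degree1_twist_eq: "degree1_twist a01 a12 b12 b23 = degree1_twist b01 b12 c12 c23 +
    degree1_twist a01 a12 (b12 + c12) (b23 + c23) +
     (assoc_primitive a12 a23 b12 b23 c12 c23 - assoc_primitive a02 a23 b02 b23 c02 c23
       + assoc_primitive a01 a13 b01 b13 c01 c13 - assoc_primitive a01 a12 b01 b12 c01 c12)
     - degree1_twist (a01 + b01) (a12 + b12) c12 c23 - half ?Z"
    using degree1_twist_assoc [OF assms(1-6)] by (simp add: eq_diff_eq add_ac)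
  show ?thesis
    unfolding twist_value_def half_eq degree1_twist_eq
    unfolding half_add by (simp add: algebra_simps half_cancel)
qed

text \<open>For \<open>t = a \<union>\<^sub>1 b\<close> one has \<open>dt = ab + ba\<close>, and the terms with \<open>p\<close> and \<open>q\<close> are
  \<open>p \<union>\<^sub>1 q + q \<union>\<^sub>1 p\<close> and \<open>(p + q) \<union>\<^sub>1 dt + dt \<union>\<^sub>1 (p + q)\<close>, both coboundaries of \<open>\<union>\<^sub>2\<close>-products.\<close>

lemma twist_value_comm:
  assumes "a02 = a01 + a12" "b02 = b01 + b12" "a13 = a12 + a23" "b13 = b12 + b23"
    and "p123 = p023 + p013 + p012" "q123 = q023 + q013 + q012"
  shows "twist_value p013 p023 q012 q013 q023 q123 a01 a12 b12 b23 =
    half (a01 * b01 * (a12 * b23 + b12 * a23)) +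
    twist_value q013 q023 p012 p013 p023 p123 b01 b12 a12 a23 +
    twist_value (a01 * b13 + b01 * a13) (a02 * b23 + b02 * a23)
      (q012 + p012 + b01 * a12) u013 u023 (q123 + p123 + b12 * a23) 0 0 e12 e23 +
    ((half (p123 * q123 + (p123 + q123) * (a12 * b23 + b12 * a23)) + comm_primitive a12 a23 b12 b23)
     - (half (p023 * q023 + (p023 + q023) * (a02 * b23 + b02 * a23)) + comm_primitive a02 a23 b02 b23)
     + (half (p013 * q013 + (p013 + q013) * (a01 * b13 + b01 * a13)) + comm_primitive a01 a13 b01 b13)
     - (half (p012 * q012 + (p012 + q012) * (a01 * b12 + b01 * a12)) + comm_primitive a01 a12 b01 b12))"
proof -
  let ?Z = "a01 * b01 * (a12 * b23 + b12 * a23)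
       + (a01 * b13 + b01 * a13) * (b12 * a23) + (a02 * b23 + b02 * a23) * (b01 * a12)"
  have "cup1_part p013 p023 q012 q013 q023 q123 a01 a12 b12 b23 =
     a01 * b01 * (a12 * b23 + b12 * a23) + cup1_part q013 q023 p012 p013 p023 p123 b01 b12 a12 a23 +
     cup1_part (a01 * b13 + b01 * a13) (a02 * b23 + b02 * a23)
      (q012 + p012 + b01 * a12) u013 u023 (q123 + p123 + b12 * a23) 0 0 e12 e23 +
     ((p123 * q123 + (p123 + q123) * (a12 * b23 + b12 * a23)) + (p023 * q023 + (p023 + q023) * (a02 * b23 + b02 * a23))
     + (p013 * q013 + (p013 + q013) * (a01 * b13 + b01 * a13)) + (p012 * q012 + (p012 + q012) * (a01 * b12 +
       b01 * a12))) + ?Z"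
    unfolding assms cup1_part_def by (simp add: algebra_simps bit_ring)
  note half_eq = arg_cong [OF this, of half, unfolded half_add [of "_ + ?Z"] half_add [of _ ?Z]]
  show ?thesis
    unfolding twist_value_def half_eq degree1_twist_0 degree1_twist_comm [OF assms(1-4)]
    unfolding half_add by (simp add: algebra_simps half_cancel)
qed

text \<open>The terms with \<open>t\<close> and \<open>s\<close> are \<open>t ds + s dt + dt \<union>\<^sub>1 ds\<close>, which is the coboundary of
  \<open>t \<union>\<^sub>1 ds + st\<close>, where \<open>(t \<union>\<^sub>1 q)(0,1,2) = t(0,2) q(0,1,2)\<close>; and the same expression with \<open>t + s\<close> and
  \<open>x dy\<close> in place of \<open>t\<close> and \<open>s\<close>.\<close>

lemma twist_value_exact:
  assumes "a01 = x0 + x1" "a02 = x0 + x2" "a12 = x1 + x2" "b01 = y0 + y1" "b12 = y1 + y2" "b13 = y1 +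
    y3" "b23 = y2 + y3"
  shows "half ((t01 + s01 + x0 * b01) * ((t23 + s23 + x2 * b23) + (t13 + s13 + x1 * b13) + (t12 + s12 + x1 * b12))) =
    half (t01 * (t23 + t13 + t12)) + half (s01 * (s23 + s13 + s12)) +
    twist_value (t13 + t03 + t01) (t23 + t03 + t02) (s12 + s02 + s01) (s13 + s03 + s01) (s23 + s03 +
      s02) (s23 + s13 + s12)
      a01 a12 b12 b23 +
    ((half (t13 * (s23 + s13 + s12) + s12 * t23 + (t13 + s13) * (a12 * b23) + x1 * b12 * (t23 + s23)) +
      exact_primitive x1 x2 y1 y2 y3)
    - (half (t03 * (s23 + s03 + s02) + s02 * t23 + (t03 + s03) * (a02 * b23) + x0 * (y0 + y2) * (t23 + s23)) +
      exact_primitive x0 x2 y0 y2 y3)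
    + (half (t03 * (s13 + s03 + s01) + s01 * t13 + (t03 + s03) * (a01 * b13) + x0 * b01 * (t13 + s13)) +
      exact_primitive x0 x1 y0 y1 y3)
    - (half (t02 * (s12 + s02 + s01) + s01 * t12 + (t02 + s02) * (a01 * b12) + x0 * b01 * (t12 + s12)) +
      exact_primitive x0 x1 y0 y1 y2))"
proof -
  let ?Z = "x0 * (y0 + y1) * ((x1 + x2) * (y2 + y3))"
  have "(t01 + s01 + x0 * b01) * ((t23 + s23 + x2 * b23) + (t13 + s13 + x1 * b13) + (t12 + s12 + x1 * b12)) =
    t01 * (t23 + t13 + t12) + s01 * (s23 + s13 + s12) +
    cup1_part (t13 + t03 + t01) (t23 + t03 + t02) (s12 + s02 + s01) (s13 + s03 + s01) (s23 + s03 + s02) (s23 +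
      s13 + s12)
      a01 a12 b12 b23 +
    ((t13 * (s23 + s13 + s12) + s12 * t23 + (t13 + s13) * (a12 * b23) + x1 * b12 * (t23 + s23))
    + (t03 * (s23 + s03 + s02) + s02 * t23 + (t03 + s03) * (a02 * b23) + x0 * (y0 + y2) * (t23 + s23))
    + (t03 * (s13 + s03 + s01) + s01 * t13 + (t03 + s03) * (a01 * b13) + x0 * b01 * (t13 + s13))
    + (t02 * (s12 + s02 + s01) + s01 * t12 + (t02 + s02) * (a01 * b12) + x0 * b01 * (t12 + s12))) + ?Z"
    unfolding assms cup1_part_def by (simp add: algebra_simps bit_ring)
  note half_eq = arg_cong [OF this, of half, unfolded half_add [of "_ + ?Z"] half_add [of _ ?Z]]
  show ?thesis
    unfolding twist_value_def half_eq degree1_twist_exact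
    unfolding half_add assms by (simp add: algebra_simps half_cancel)
qed

text \<open>On cocycles \<open>d(p \<union>\<^sub>1 q) = pq + qp\<close>, which yields all mixed terms of \<open>(p + q + ab)\<^sup>2\<close>; the term \<open>abab\<close>
  comes from the part of degree one.\<close>

lemma twist_value_coboundary:
  assumes "a02 = a01 + a12" "a13 = a12 + a23" "b13 = b12 + b23" "b24 = b23 + b34"
    and p: "p123 = p023 + p013 + p012" "p124 = p024 + p014 + p012" "p134 = p034 + p014 + p013" "p234 = p034 +
      p024 + p023"
    and q: "q123 = q023 + q013 + q012" "q124 = q024 + q014 + q012" "q134 = q034 + q014 + q013" "q234 = q034 +
      q024 + q023"
  shows "twist_value p124 p134 q123 q124 q134 q234 a12 a23 b23 b34
    - twist_value p024 p034 q023 q024 q034 q234 a02 a23 b23 b34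
    + twist_value p014 p034 q013 q014 q034 q134 a01 a13 b13 b34
    - twist_value p014 p024 q012 q014 q024 q124 a01 a12 b12 b24
    + twist_value p013 p023 q012 q013 q023 q123 a01 a12 b12 b23
    + half (p012 * p234) + half (q012 * q234) =
    half ((p012 + q012 + a01 * b12) * (p234 + q234 + a23 * b34))"
proof -
  let ?Z = "a01 * b12 * (a23 * b34)"
  have "cup1_part p124 p134 q123 q124 q134 q234 a12 a23 b23 b34 =
    cup1_part p024 p034 q023 q024 q034 q234 a02 a23 b23 b34 + cup1_part p014 p034 q013 q014 q034 q134 a01 a13 b13 b34
    + cup1_part p014 p024 q012 q014 q024 q124 a01 a12 b12 b24 + cup1_part p013 p023 q012 q013 q023 q123 a01 a12 b12 b23
    + p012 * p234 + q012 * q234 + (p012 + q012 + a01 * b12) * (p234 + q234 + a23 * b34) + ?Z"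
    unfolding assms cup1_part_def by (simp add: algebra_simps bit_ring)
  note half_eq = arg_cong [OF this, of half, unfolded half_add [of "_ + ?Z"] half_add [of _ ?Z]]
  have degree1_twist_eq: "degree1_twist a12 a23 b23 b34 = half ?Z + degree1_twist a02 a23 b23 b34 -
    degree1_twist a01 a13 b13 b34
     + degree1_twist a01 a12 b12 b24 - degree1_twist a01 a12 b12 b23"
    using degree1_twist_coboundary [of a12 a23 b23 b34 a01 b12] unfolding assms by (simp add: algebra_simps)
  show ?thesis
    unfolding twist_value_def half_eq degree1_twist_eq
    unfolding half_add by (simp add: algebra_simps half_cancel)
qed

section \<open>Coboundaries and cocycles\<close>

lemma coboundary_hom:
  "coboundary k X \<in> hom (cochains k X :: ('a, 'm::ab_group_add) cochain monoid) (cochains (Suc k) X)"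
proof (rule homI)
  fix x y :: "('a, 'm) cochain"
  show "coboundary k X (x +\<^bsub>k,X\<^esub> y) = coboundary k X x +\<^bsub>Suc k,X\<^esub> coboundary k X y"
  proof (rule cochain_eqI)
    fix \<sigma> assume \<sigma>: "singular_simplex (Suc k) X \<sigma>"
    then have face: "singular_simplex k X (singular_face (Suc k) i \<sigma>)" if "i \<le> Suc k" for i
      using singular_simplex_singular_face [OF \<sigma>, of i] that by (simp add: One_nat_def)
    have "coboundary k X (x +\<^bsub>k,X\<^esub> y) \<sigma> =
      (\<Sum>i\<le>Suc k. (if even i then x (singular_face (Suc k) i \<sigma>) else - x (singular_face (Suc k) i \<sigma>)) +
        (if even i then y (singular_face (Suc k) i \<sigma>) else - y (singular_face (Suc k) i \<sigma>)))"
      using \<sigma> face unfolding coboundary_def by (auto intro!: sum.cong simp del: sum.atMost_Suc)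
    then show "coboundary k X (x +\<^bsub>k,X\<^esub> y) \<sigma> = (coboundary k X x +\<^bsub>Suc k,X\<^esub> coboundary k X y) \<sigma>"
      using \<sigma> by (simp add: coboundary_def sum.distrib del: sum.atMost_Suc)
  qed auto
qed auto

lemma cocycles_iff:
  "c \<in> cocycles k X \<longleftrightarrow> c \<in> carrier (cochains k X) \<and> (\<forall>\<sigma>. singular_simplex (Suc k) X \<sigma> \<longrightarrow> coboundary k X c \<sigma> = 0)"
proof -
  have "coboundary k X c = \<one>\<^bsub>cochains (Suc k) X\<^esub> \<longleftrightarrow> (\<forall>\<sigma>. singular_simplex (Suc k) X \<sigma> \<longrightarrow> coboundary k X c \<sigma> = 0)"
    by (metis cochain_eqI cochain_zero_apply cochain_zero_closed coboundary_closed)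
  then show ?thesis
    by (simp add: cocycles_def kernel_def)
qed

lemma cocycles_closed: "c \<in> cocycles k X \<Longrightarrow> c \<in> carrier (cochains k X)"
  by (simp add: cocycles_iff)

lemma cocycles1I:
  assumes "a \<in> carrier (cochains 1 X)"
    and "\<And>\<sigma>. singular_simplex 2 X \<sigma> \<Longrightarrow>
      a (subsimplex [1, 2] \<sigma>) - a (subsimplex [0, 2] \<sigma>) + a (subsimplex [0, 1] \<sigma>) = 0"
  shows "a \<in> cocycles 1 X"
  unfolding cocycles_iff
proof (intro conjI allI impI assms)
  fix \<sigma> assume "singular_simplex (Suc 1) X \<sigma>"
  then have \<sigma>: "singular_simplex 2 X \<sigma>" by simp
  have "coboundary 1 X a (subsimplex [0, 1, 2] \<sigma>) = 0"
    by (subst coboundary_on_face(2) [OF \<sigma>]) (simp_all add: assms(2) [OF \<sigma>])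
  then show "coboundary 1 X a \<sigma> = 0"
    by (simp only: simplex_eq_subsimplex(3) [OF \<sigma>, symmetric])
qed

lemma cocycles2I:
  assumes "p \<in> carrier (cochains 2 X)"
    and "\<And>\<sigma>. singular_simplex 3 X \<sigma> \<Longrightarrow> p (subsimplex [1, 2, 3] \<sigma>) - p (subsimplex [0, 2, 3] \<sigma>)
      + p (subsimplex [0, 1, 3] \<sigma>) - p (subsimplex [0, 1, 2] \<sigma>) = 0"
  shows "p \<in> cocycles 2 X"
  unfolding cocycles_iff
proof (intro conjI allI impI assms)
  fix \<sigma> assume "singular_simplex (Suc 2) X \<sigma>"
  then have \<sigma>: "singular_simplex 3 X \<sigma>" by simp
  have "coboundary 2 X p (subsimplex [0, 1, 2, 3] \<sigma>) = 0"
    by (subst coboundary_on_face(3) [OF \<sigma>]) (simp_all add: assms(2) [OF \<sigma>])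
  then show "coboundary 2 X p \<sigma> = 0"
    by (simp only: simplex_eq_subsimplex(4) [OF \<sigma>, symmetric])
qed

lemma cocycle1_on_face:
  fixes a :: "('a, bit) cochain"
  assumes "a \<in> cocycles 1 X" and \<sigma>: "singular_simplex n X \<sigma>" and "i \<le> n" "j \<le> n" "k \<le> n"
  shows "a (subsimplex [i, k] \<sigma>) = a (subsimplex [i, j] \<sigma>) + a (subsimplex [j, k] \<sigma>)"
proof -
  have "coboundary 1 X a (subsimplex [i, j, k] \<sigma>) = 0"
    using assms(1) face [OF \<sigma>, of "[i, j, k]" 2] assms(3-) by (simp add: cocycles_iff)
  then show ?thesis
    using assms by (simp add: coboundary_on_face [OF \<sigma>] bit_ring add_ac) (metis add.commute add_left_cancel
      bit_ring(1,2))
qed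

lemma cocycle2_on_face:
  fixes p :: "('a, bit) cochain"
  assumes "p \<in> cocycles 2 X" and \<sigma>: "singular_simplex n X \<sigma>" and "i \<le> n" "j \<le> n" "k \<le> n" "l \<le> n"
  shows "p (subsimplex [j, k, l] \<sigma>) = p (subsimplex [i, k, l] \<sigma>) + p (subsimplex [i, j, l] \<sigma>) +
    p (subsimplex [i, j, k] \<sigma>)"
proof -
  have "coboundary 2 X p (subsimplex [i, j, k, l] \<sigma>) = 0"
    using assms(1) face [OF \<sigma>, of "[i, j, k, l]" 3] assms(3-) by (simp add: cocycles_iff)
  then have "p (subsimplex [j, k, l] \<sigma>) - p (subsimplex [i, k, l] \<sigma>) + p (subsimplex [i, j, l] \<sigma>) -
    p (subsimplex [i, j, k] \<sigma>) = 0"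
    using assms(3-) coboundary_on_face(3) [OF \<sigma>, of i j k l p] by simp
  moreover have "u - v + w - x = 0 \<Longrightarrow> u = v + w + x" for u v w x :: bit
    by (cases u; cases v; cases w; cases x; simp)
  ultimately show ?thesis
    by blast
qed

lemma add_cocycles [simp]:
  assumes "x \<in> cocycles k X" "y \<in> cocycles k X"
  shows "x +\<^bsub>k,X\<^esub> y \<in> cocycles k X"
proof -
  interpret group_hom "cochains k X" "cochains (Suc k) X" "coboundary k X"
    by (simp add: group_hom_def group_hom_axioms_def group_cochains coboundary_hom)
  show ?thesis
    using assms subgroup.m_closed [OF subgroup_kernel] by (simp add: cocycles_def)
qed

lemma zero_cocycles [simp]: "\<one>\<^bsub>cochains k X\<^esub> \<in> cocycles k X"
proof -
  interpret group_hom "cochains k X" "cochains (Suc k) X" "coboundary k X"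
    by (simp add: group_hom_def group_hom_axioms_def group_cochains coboundary_hom)
  show ?thesis
    using subgroup.one_closed [OF subgroup_kernel] by (simp add: cocycles_def)
qed

lemma cup_cocycles [simp]:
  fixes a b :: "('a, bit) cochain"
  assumes "a \<in> cocycles 1 X" "b \<in> cocycles 1 X"
  shows "cup 1 1 X a b \<in> cocycles 2 X"
proof (rule cocycles2I)
  fix \<sigma> assume \<sigma>: "singular_simplex 3 X \<sigma>"
  show "cup 1 1 X a b (subsimplex [1, 2, 3] \<sigma>) - cup 1 1 X a b (subsimplex [0, 2, 3] \<sigma>)
      + cup 1 1 X a b (subsimplex [0, 1, 3] \<sigma>) - cup 1 1 X a b (subsimplex [0, 1, 2] \<sigma>) = 0"
    using cocycle1_on_face [OF assms(1) \<sigma>, of 0 1 2] cocycle1_on_face [OF assms(2) \<sigma>, of 1 2 3]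
    by (simp add: on_face [OF \<sigma>] algebra_simps bit_ring)
qed simp

lemma coboundary_cocycles [simp]:
  fixes x :: "('a, 'm::ab_group_add) cochain"
  shows "coboundary 0 X x \<in> cocycles 1 X" "coboundary 1 X x \<in> cocycles 2 X"
proof -
  show "coboundary 0 X x \<in> cocycles 1 X"
  proof (rule cocycles1I)
    fix \<sigma> assume \<sigma>: "singular_simplex 2 X \<sigma>"
    show "coboundary 0 X x (subsimplex [1, 2] \<sigma>) - coboundary 0 X x (subsimplex [0, 2] \<sigma>)
      + coboundary 0 X x (subsimplex [0, 1] \<sigma>) = 0"
      by (simp add: coboundary_on_face [OF \<sigma>])
  qed simp
  show "coboundary 1 X x \<in> cocycles 2 X"
  proof (rule cocycles2I)
    fix \<sigma> assume \<sigma>: "singular_simplex 3 X \<sigma>"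
    show "coboundary 1 X x (subsimplex [1, 2, 3] \<sigma>) - coboundary 1 X x (subsimplex [0, 2, 3] \<sigma>)
      + coboundary 1 X x (subsimplex [0, 1, 3] \<sigma>) - coboundary 1 X x (subsimplex [0, 1, 2] \<sigma>) = 0"
      by (simp add: coboundary_on_face [OF \<sigma>])
  qed simp
qed

lemma coboundary_coboundary_2:
  fixes h :: "('a, 'm::ab_group_add) cochain"
  shows "coboundary 3 X (coboundary 2 X h) = \<one>\<^bsub>cochains 4 X\<^esub>"
proof (rule cochain_eqI)
  fix \<sigma> assume \<sigma>: "singular_simplex 4 X \<sigma>"
  have "coboundary 3 X (coboundary 2 X h) (subsimplex [0, 1, 2, 3, 4] \<sigma>) = 0"
    by (simp add: coboundary_on_face [OF \<sigma>])
  then show "coboundary 3 X (coboundary 2 X h) \<sigma> = \<one>\<^bsub>cochains 4 X\<^esub> \<sigma>"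
    using \<sigma> by (simp flip: simplex_eq_subsimplex(5) [OF \<sigma>])
qed simp_all

lemma continuous_map_coboundary:
  fixes X :: "'a topology"
  assumes cg: "compact_group (coefficient_group :: 'm::{ab_group_add, topological_space} monoid) euclidean"
  shows "continuous_map (cochain_topology k X :: ('a, 'm) cochain topology) (cochain_topology (Suc k) X)
    (coboundary k X)"
  unfolding continuous_map_into_cochains
proof (intro conjI allI impI)
  let ?T = "cochain_topology k X :: ('a, 'm) cochain topology"
  have tg: "topological_group (coefficient_group :: 'm monoid) euclidean"
    using cg by (simp add: compact_group_def)
  fix \<sigma> assume \<sigma>: "singular_simplex (Suc k) X \<sigma>"
  have "continuous_map ?T euclidean (\<lambda>c. c (singular_face (Suc k) i \<sigma>))" if "i \<le> Suc k" for i
    using singular_simplex_singular_face [OF \<sigma>, of i] that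
    by (intro continuous_map_cochain_apply [of _ k X "\<lambda>c. c"] continuous_map_id [unfolded id_def])
       (simp_all add: One_nat_def)
  then have summand: "continuous_map ?T euclidean
      (\<lambda>c. if even i then c (singular_face (Suc k) i \<sigma>) else - c (singular_face (Suc k) i \<sigma>))" if "i \<le> Suc k" for i
    using continuous_map_group_inv [OF tg] that by auto
  have "continuous_map ?T euclidean
      (\<lambda>c. \<Sum>i\<in>I. if even i then c (singular_face (Suc k) i \<sigma>) else - c (singular_face (Suc k) i \<sigma>))"
    if "finite I" "I \<subseteq> {..Suc k}" for I
    using that
  proof (induction I rule: finite_induct)
    case (insert i I)
    then show ?case
      using continuous_map_group_mult [OF tg summand [of i]] by simp
  qed simp
  from this [of "{..Suc k}"] show "continuous_map ?T euclidean (\<lambda>c. coboundary k X c \<sigma>)"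
    using \<sigma> by (simp add: coboundary_def del: sum.atMost_Suc)
qed auto

lemma closedin_cocycles:
  fixes X :: "'a topology"
  assumes cg: "compact_group (coefficient_group :: 'm::{ab_group_add, topological_space} monoid) euclidean"
  shows "closedin (cochain_topology k X) (cocycles k X :: ('a, 'm) cochain set)"
proof -
  have "closedin (cochain_topology (Suc k) X) {\<one>\<^bsub>cochains (Suc k) X\<^esub> :: ('a, 'm) cochain}"
    using compact_group_cochains [OF cg, of "Suc k" X] by (simp add: compact_group_def closedin_Hausdorff_singleton)
  from closedin_continuous_map_preimage [OF continuous_map_coboundary [OF cg, of k X] this]
  show ?thesis
    by (simp add: cocycles_def kernel_def)
qed

section \<open>Three-cochains modulo coboundaries\<close>

lemma B3_normal: "B3 X \<lhd> cochains 3 X"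
proof -
  interpret group_hom "cochains 2 X" "cochains 3 X" "coboundary 2 X"
    using coboundary_hom [of 2 X] by (simp add: group_hom_def group_hom_axioms_def group_cochains)
  show ?thesis
    using img_is_subgroup comm_group.subgroup_imp_normal [OF comm_group_cochains]
    by (simp add: B3_def)
qed

lemma closedin_B3: "closedin (cochain_topology 3 X) (B3 X)"
proof -
  have "compactin (cochain_topology 3 X) (B3 X)"
    unfolding B3_def topspace_cochain_topology [symmetric]
    using compact_group_circle_cochains [of 2 X] continuous_map_coboundary [OF compact_group_circle, of 2 X]
    by (intro image_compactin) (auto simp: compact_group_def compact_space_def)
  then show ?thesis
    using compact_group_circle_cochains [of 3 X] compactin_imp_closedin
    by (auto simp: compact_group_def)
qed

lemma compact_group_C3_mod_B3:
  "compact_group (C3_mod_B3 X) (quotient_topology (cochain_topology 3 X) (cls3 X))"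
  using compact_group_quotient [OF compact_group_circle_cochains B3_normal closedin_B3]
  unfolding C3_mod_B3_def cls3_def .

lemma comm_group_C3_mod_B3: "comm_group (C3_mod_B3 X)"
  unfolding C3_mod_B3_def
  by (rule comm_group.abelian_FactGroup [OF comm_group_cochains]) (rule normal_imp_subgroup [OF B3_normal])

lemma carrier_C3_mod_B3: "carrier (C3_mod_B3 X) = cls3 X ` carrier (cochains 3 X)"
  by (simp add: C3_mod_B3_def cls3_def carrier_FactGroup)

lemma cls3_closed [simp]: "z \<in> carrier (cochains 3 X) \<Longrightarrow> cls3 X z \<in> carrier (C3_mod_B3 X)"
  by (simp add: carrier_C3_mod_B3)

lemma cls3_add:
  assumes "w \<in> carrier (cochains 3 X)" "v \<in> carrier (cochains 3 X)"
  shows "cls3 X w \<otimes>\<^bsub>C3_mod_B3 X\<^esub> cls3 X v = cls3 X (w +\<^bsub>3,X\<^esub> v)"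
  using normal.rcos_sum [OF B3_normal assms] by (simp add: C3_mod_B3_def cls3_def)

lemma cls3_eq_iff:
  assumes "x \<in> carrier (cochains 3 X)" "y \<in> carrier (cochains 3 X)"
  shows "cls3 X x = cls3 X y \<longleftrightarrow> (\<exists>h \<in> carrier (cochains 2 X). x = coboundary 2 X h +\<^bsub>3,X\<^esub> y)"
proof -
  interpret normal "B3 X" "cochains 3 X" by (rule B3_normal)
  have "cls3 X x = cls3 X y \<longleftrightarrow> x \<in> cls3 X y"
    using assms repr_independence [OF _ assms(2) subgroup_axioms] rcos_self [OF assms(1) subgroup_axioms]
    unfolding cls3_def by metis
  then show ?thesis
    by (auto simp: cls3_def r_coset_def B3_def)
qed

lemma one_C3_mod_B3: "\<one>\<^bsub>C3_mod_B3 X\<^esub> = cls3 X \<one>\<^bsub>cochains 3 X\<^esub>"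
proof -
  interpret normal "B3 X" "cochains 3 X" by (rule B3_normal)
  show ?thesis
    using coset_join2 [OF one_closed subgroup_axioms] by (simp add: C3_mod_B3_def cls3_def)
qed

text \<open>Only the values of \<open>h\<close> on singular simplices enter its coboundary, so a formula can serve as the
  primitive directly.\<close>

lemma cls3_eqI:
  assumes "x \<in> carrier (cochains 3 X)" "y \<in> carrier (cochains 3 X)"
    and "\<And>\<sigma>. singular_simplex 3 X \<sigma> \<Longrightarrow> x (subsimplex [0, 1, 2, 3] \<sigma>) = y (subsimplex [0, 1, 2, 3] \<sigma>) +
      coboundary 2 X h (subsimplex [0, 1, 2, 3] \<sigma>)"
  shows "cls3 X x = cls3 X y"
proof -
  let ?h = "\<lambda>\<tau>\<in>singular_simplex_set 2 X. h \<tau>"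
  have "x = coboundary 2 X ?h +\<^bsub>3,X\<^esub> y"
  proof (rule cochain_eqI)
    fix \<sigma> assume \<sigma>: "singular_simplex 3 X \<sigma>"
    have "(coboundary 2 X ?h +\<^bsub>3,X\<^esub> y) (subsimplex [0, 1, 2, 3] \<sigma>) = x (subsimplex [0, 1, 2, 3] \<sigma>)"
      using assms(3) [OF \<sigma>] by (simp add: add_on_face [OF \<sigma>] coboundary_on_face [OF \<sigma>] face [OF \<sigma>] add.commute)
    then show "x \<sigma> = (coboundary 2 X ?h +\<^bsub>3,X\<^esub> y) \<sigma>"
      by (simp only: simplex_eq_subsimplex(4) [OF \<sigma>, symmetric])
  qed (use assms in auto)
  then show ?thesis
    using assms by (auto simp: cls3_eq_iff)
qed

lemma twist_on_face:
  assumes \<sigma>: "singular_simplex n X \<sigma>" "i \<le> n" "j \<le> n" "k \<le> n" "l \<le> n"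
  shows "twist X p a q b (subsimplex [i, j, k, l] \<sigma>) =
    twist_value (p (subsimplex [i, j, l] \<sigma>)) (p (subsimplex [i, k, l] \<sigma>)) (q (subsimplex [i, j, k] \<sigma>))
      (q (subsimplex [i, j, l] \<sigma>)) (q (subsimplex [i, k, l] \<sigma>)) (q (subsimplex [j, k, l] \<sigma>))
      (a (subsimplex [i, j] \<sigma>)) (a (subsimplex [j, k] \<sigma>)) (b (subsimplex [j, k] \<sigma>)) (b (subsimplex [k, l] \<sigma>))"
  using assms unfolding twist_def Let_def twist_value_def cup1_part_def degree1_twist_def
  by (simp add: on_face [OF \<sigma>(1)] half_add add.assoc mult.assoc)

lemma twist_closed [simp]: "twist X p a q b \<in> carrier (cochains 3 X)"
  by (simp add: twist_def Let_def)

section \<open>The group C(X)\<close>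

lemma bigC_cases:
  assumes "c \<in> carrier (bigC X)"
  obtains w p a where "c = (cls3 X w, p, a)" "w \<in> carrier (cochains 3 X)" "p \<in> cocycles 2 X" "a \<in> cocycles 1 X"
  using assms by (auto simp: bigC_def carrier_C3_mod_B3)

lemma bigC_closed [simp]:
  "(cls3 X w, p, a) \<in> carrier (bigC X)"
  if "w \<in> carrier (cochains 3 X)" "p \<in> cocycles 2 X" "a \<in> cocycles 1 X"
  using that by (simp add: bigC_def)

lemma bigC_mult:
  assumes "w \<in> carrier (cochains 3 X)" "v \<in> carrier (cochains 3 X)"
  shows "(cls3 X w, p, a) \<otimes>\<^bsub>bigC X\<^esub> (cls3 X v, q, b) =
    (cls3 X (w +\<^bsub>3,X\<^esub> v +\<^bsub>3,X\<^esub> twist X p a q b), p +\<^bsub>2,X\<^esub> q +\<^bsub>2,X\<^esub> cup 1 1 X a b, a +\<^bsub>1,X\<^esub> b)"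
  using assms by (simp add: bigC_def cls3_add)

lemma bigC_one: "\<one>\<^bsub>bigC X\<^esub> = (cls3 X \<one>\<^bsub>cochains 3 X\<^esub>, \<one>\<^bsub>cochains 2 X\<^esub>, \<one>\<^bsub>cochains 1 X\<^esub>)"
  by (simp add: bigC_def one_C3_mod_B3)

lemma bigC_assoc:
  assumes p: "p \<in> cocycles 2 X" and q: "q \<in> cocycles 2 X" and r: "r \<in> cocycles 2 X"
    and a: "a \<in> cocycles 1 X" and b: "b \<in> cocycles 1 X" and c: "c \<in> cocycles 1 X"
    and w: "w \<in> carrier (cochains 3 X)" "v \<in> carrier (cochains 3 X)" "u \<in> carrier (cochains 3 X)"
  shows "((cls3 X w, p, a) \<otimes>\<^bsub>bigC X\<^esub> (cls3 X v, q, b)) \<otimes>\<^bsub>bigC X\<^esub> (cls3 X u, r, c) =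
    (cls3 X w, p, a) \<otimes>\<^bsub>bigC X\<^esub> ((cls3 X v, q, b) \<otimes>\<^bsub>bigC X\<^esub> (cls3 X u, r, c))"
proof -
  let ?pq = "p +\<^bsub>2,X\<^esub> q +\<^bsub>2,X\<^esub> cup 1 1 X a b" and ?qr = "q +\<^bsub>2,X\<^esub> r +\<^bsub>2,X\<^esub> cup 1 1 X b c"
  let ?T1 = "twist X p a q b" and ?T2 = "twist X ?pq (a +\<^bsub>1,X\<^esub> b) r c"
  let ?T3 = "twist X q b r c" and ?T4 = "twist X p a ?qr (b +\<^bsub>1,X\<^esub> c)"
  have "cls3 X (w +\<^bsub>3,X\<^esub> v +\<^bsub>3,X\<^esub> ?T1 +\<^bsub>3,X\<^esub> u +\<^bsub>3,X\<^esub> ?T2) =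
      cls3 X (w +\<^bsub>3,X\<^esub> (v +\<^bsub>3,X\<^esub> u +\<^bsub>3,X\<^esub> ?T3) +\<^bsub>3,X\<^esub> ?T4)"
  proof (rule cls3_eqI)
    fix \<sigma> assume \<sigma>: "singular_simplex 3 X \<sigma>"
    define e where "e vs = subsimplex vs \<sigma>" for vs
    define h where "h \<tau> = half (a (subsimplex [0, 1] \<tau>) * b (subsimplex [1, 2] \<tau>) * r \<tau>) +
      assoc_primitive (a (subsimplex [0, 1] \<tau>)) (a (subsimplex [1, 2] \<tau>)) (b (subsimplex [0, 1] \<tau>)) (b
        (subsimplex [1, 2] \<tau>))
        (c (subsimplex [0, 1] \<tau>)) (c (subsimplex [1, 2] \<tau>))" for \<tau>
    have "?T1 (e [0, 1, 2, 3]) + ?T2 (e [0, 1, 2, 3]) = ?T3 (e [0, 1, 2, 3]) + ?T4 (e [0, 1, 2, 3]) +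
      coboundary 2 X h (e [0, 1, 2, 3])"
      using twist_value_assoc [OF cocycle1_on_face [OF a \<sigma>, of 0 1 2] cocycle1_on_face [OF b \<sigma>, of 0 1 2]
        cocycle1_on_face [OF c \<sigma>, of 0 1 2] cocycle1_on_face [OF a \<sigma>, of 1 2 3] cocycle1_on_face [OF b \<sigma>, of 1 2 3]
        cocycle1_on_face [OF c \<sigma>, of 1 2 3] cocycle2_on_face [OF r \<sigma>, of 0 1 2 3],
        of "p (e [0, 1, 3])" "p (e [0, 2, 3])" "q (e [0, 1, 2])" "q (e [0, 1, 3])" "q (e [0, 2, 3])" "q (e [1, 2, 3])"]
      by (simp add: coboundary_on_face(3) [OF \<sigma>] h_def e_def twist_on_face [OF \<sigma>] on_face [OF \<sigma>]
        subsimplex_subsimplex nth_Cons')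
    then show "(w +\<^bsub>3,X\<^esub> v +\<^bsub>3,X\<^esub> ?T1 +\<^bsub>3,X\<^esub> u +\<^bsub>3,X\<^esub> ?T2) (subsimplex [0, 1, 2, 3] \<sigma>) =
      (w +\<^bsub>3,X\<^esub> (v +\<^bsub>3,X\<^esub> u +\<^bsub>3,X\<^esub> ?T3) +\<^bsub>3,X\<^esub> ?T4) (subsimplex [0, 1, 2, 3] \<sigma>) +
      coboundary 2 X h (subsimplex [0, 1, 2, 3] \<sigma>)"
      by (simp add: add_on_face [OF \<sigma>] e_def algebra_simps)
  qed simp_all
  moreover have "?pq +\<^bsub>2,X\<^esub> r +\<^bsub>2,X\<^esub> cup 1 1 X (a +\<^bsub>1,X\<^esub> b) c = p +\<^bsub>2,X\<^esub> ?qr +\<^bsub>2,X\<^esub> cup 1 1 X a (b +\<^bsub>1,X\<^esub> c)"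
    by (rule cochain2_eqI [where X = X]) (simp_all add: on_face algebra_simps)
  moreover have "a +\<^bsub>1,X\<^esub> b +\<^bsub>1,X\<^esub> c = a +\<^bsub>1,X\<^esub> (b +\<^bsub>1,X\<^esub> c)"
    by (rule cochain1_eqI [where X = X]) (simp_all add: on_face add.assoc)
  ultimately show ?thesis
    using w by (simp add: bigC_mult)
qed

text \<open>The middle component is forced by \<open>p' + p + aa = 0\<close>, and then the first one by the group law.\<close>

definition bigC_inverse where
  "bigC_inverse X = (\<lambda>(w, p, a). let p' = p +\<^bsub>2,X\<^esub> cup 1 1 X a a in
     (inv\<^bsub>C3_mod_B3 X\<^esub> (w \<otimes>\<^bsub>C3_mod_B3 X\<^esub> cls3 X (twist X p' a p a)), p', a))"

lemma bigC_inverse: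
  assumes "c \<in> carrier (bigC X)"
  shows "bigC_inverse X c \<in> carrier (bigC X)" "bigC_inverse X c \<otimes>\<^bsub>bigC X\<^esub> c = \<one>\<^bsub>bigC X\<^esub>"
proof -
  obtain w p a where c: "c = (w, p, a)" "w \<in> carrier (C3_mod_B3 X)" "p \<in> cocycles 2 X" "a \<in> cocycles 1 X"
    using assms by (auto simp: bigC_def)
  interpret C3: comm_group "C3_mod_B3 X" by (rule comm_group_C3_mod_B3)
  let ?p = "p +\<^bsub>2,X\<^esub> cup 1 1 X a a"
  let ?T = "cls3 X (twist X ?p a p a)"
  have "?p +\<^bsub>2,X\<^esub> p +\<^bsub>2,X\<^esub> cup 1 1 X a a = \<one>\<^bsub>cochains 2 X\<^esub>"
    by (rule cochain2_eqI [where X = X]) (simp_all add: on_face algebra_simps bit_ring)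
  moreover have "a +\<^bsub>1,X\<^esub> a = \<one>\<^bsub>cochains 1 X\<^esub>"
    by (rule cochain1_eqI [where X = X]) (simp_all add: on_face bit_ring)
  moreover have "inv\<^bsub>C3_mod_B3 X\<^esub> (w \<otimes>\<^bsub>C3_mod_B3 X\<^esub> ?T) \<otimes>\<^bsub>C3_mod_B3 X\<^esub> w \<otimes>\<^bsub>C3_mod_B3 X\<^esub> ?T = \<one>\<^bsub>C3_mod_B3 X\<^esub>"
    using c by (simp add: C3.m_assoc)
  ultimately show "bigC_inverse X c \<otimes>\<^bsub>bigC X\<^esub> c = \<one>\<^bsub>bigC X\<^esub>"
    by (simp add: c bigC_inverse_def bigC_def Let_def)
  show "bigC_inverse X c \<in> carrier (bigC X)"
    using c by (simp add: bigC_inverse_def bigC_def Let_def)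
qed

lemma group_bigC: "group (bigC (X :: 'a topology))"
proof (rule groupI)
  fix c d e assume "c \<in> carrier (bigC X)" "d \<in> carrier (bigC X)" "e \<in> carrier (bigC X)"
  then show "c \<otimes>\<^bsub>bigC X\<^esub> d \<otimes>\<^bsub>bigC X\<^esub> e = c \<otimes>\<^bsub>bigC X\<^esub> (d \<otimes>\<^bsub>bigC X\<^esub> e)"
    by (elim bigC_cases) (simp add: bigC_assoc)
next
  fix c d assume "c \<in> carrier (bigC X)" "d \<in> carrier (bigC X)"
  then show "c \<otimes>\<^bsub>bigC X\<^esub> d \<in> carrier (bigC X)"
    by (elim bigC_cases) (simp add: bigC_mult)
next
  show "\<one>\<^bsub>bigC X\<^esub> \<in> carrier (bigC X)"
    by (simp add: bigC_one)
next
  fix c assume "c \<in> carrier (bigC X)"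
  then obtain w p a where c: "c = (cls3 X w, p, a)" "w \<in> carrier (cochains 3 X)" "p \<in> cocycles 2 X" "a \<in> cocycles 1 X"
    by (rule bigC_cases)
  have "\<one>\<^bsub>cochains 3 X\<^esub> +\<^bsub>3,X\<^esub> w +\<^bsub>3,X\<^esub> twist X \<one>\<^bsub>cochains 2 X\<^esub> \<one>\<^bsub>cochains 1 X\<^esub> p a = w"
    by (rule cochain3_eqI [where X =
      X]) (simp_all add: c on_face twist_on_face twist_value_def cup1_part_def degree1_twist_0)
  moreover have "\<one>\<^bsub>cochains 2 X\<^esub> +\<^bsub>2,X\<^esub> p +\<^bsub>2,X\<^esub> cup 1 1 X \<one>\<^bsub>cochains 1 X\<^esub> a = p"
    using c by (intro cochain2_eqI [where X = X]) (simp_all add: on_face cocycles_closed)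
  moreover have "\<one>\<^bsub>cochains 1 X\<^esub> +\<^bsub>1,X\<^esub> a = a"
    using c by (intro cochain1_eqI [where X = X]) (simp_all add: on_face cocycles_closed)
  ultimately show "\<one>\<^bsub>bigC X\<^esub> \<otimes>\<^bsub>bigC X\<^esub> c = c"
    using c by (simp add: bigC_one bigC_mult)
next
  fix c assume "c \<in> carrier (bigC X)"
  then show "\<exists>d\<in>carrier (bigC X). d \<otimes>\<^bsub>bigC X\<^esub> c = \<one>\<^bsub>bigC X\<^esub>"
    using bigC_inverse by blast
qed

lemma topspace_bigC_topology: "topspace (bigC_topology X) = carrier (bigC X)"
  by (auto simp: bigC_topology_def bigC_def carrier_C3_mod_B3 cocycles_closed)

lemmas continuous_map_value = continuous_map_cochain_apply [OF _ face]

text \<open>Each value of the twisting cochain involves finitely many values of cochains with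
  coefficients in a discrete group.\<close>

lemma continuous_map_twist:
  fixes X :: "'a topology"
  assumes "continuous_map T (cochain_topology 2 X) p" "continuous_map T (cochain_topology 2 X) q"
    "continuous_map T (cochain_topology 1 X) a" "continuous_map T (cochain_topology 1 X) b"
  shows "continuous_map T (cochain_topology 3 X) (\<lambda>x. twist X (p x) (a x) (q x) (b x))"
  unfolding continuous_map_into_cochains
proof (intro conjI allI impI)
  fix \<sigma> assume \<sigma>: "singular_simplex 3 X \<sigma>"
  note bit2 = continuous_map_discrete2 [where S = "euclidean :: bit topology"]
  have "continuous_map T euclidean (\<lambda>x. twist X (p x) (a x) (q x) (b x) (subsimplex [0, 1, 2, 3] \<sigma>))"
    unfolding twist_on_face [OF \<sigma>, of 0 1 2 3, simplified] twist_value_def cup1_part_def degree1_twist_def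
    by (intro continuous_map_circle_add continuous_map_discrete [where F =
      half] continuous_map_discrete [where F = quarter]
        bit2 [where F = "(*)"] bit2 [where F = "(+)"] continuous_map_discrete2 [where F = "(*)" and S =
          "euclidean :: int topology"]
        continuous_map_discrete [where F = lift01 and S = "euclidean :: int topology"]
        continuous_map_value [OF assms(1) \<sigma>] continuous_map_value [OF assms(2) \<sigma>]
        continuous_map_value [OF assms(3) \<sigma>] continuous_map_value [OF assms(4) \<sigma>]) simp_all
  then show "continuous_map T euclidean (\<lambda>x. twist X (p x) (a x) (q x) (b x) \<sigma>)"
    by (simp only: simplex_eq_subsimplex(4) [OF \<sigma>, symmetric])
qed auto

lemma continuous_map_cup11:
  fixes X :: "'a topology"
  assumes "continuous_map T (cochain_topology 1 X) a" "continuous_map T (cochain_topology 1 X) b"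
  shows "continuous_map T (cochain_topology 2 X) (\<lambda>x. cup 1 1 X (a x) (b x) :: ('a, bit) cochain)"
  unfolding continuous_map_into_cochains
proof (intro conjI allI impI)
  fix \<sigma> assume \<sigma>: "singular_simplex 2 X \<sigma>"
  have "continuous_map T euclidean (\<lambda>x. cup 1 1 X (a x) (b x) (subsimplex [0, 1, 2] \<sigma>))"
    unfolding cup_on_face(2) [OF \<sigma>, of 0 1 2, simplified]
    by (intro continuous_map_discrete2 [where F = "(*)"] continuous_map_value [OF assms(1) \<sigma>]
        continuous_map_value [OF assms(2) \<sigma>]) simp_all
  then show "continuous_map T euclidean (\<lambda>x. cup 1 1 X (a x) (b x) \<sigma>)"
    by (simp only: simplex_eq_subsimplex(3) [OF \<sigma>, symmetric])
qed auto

lemma continuous_map_into_bigC: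
  "continuous_map T (bigC_topology X) f \<longleftrightarrow>
     continuous_map T (quotient_topology (cochain_topology 3 X) (cls3 X)) (\<lambda>x. fst (f x)) \<and>
     continuous_map T (cochain_topology 2 X) (\<lambda>x. fst (snd (f x))) \<and>
     (\<forall>x\<in>topspace T. fst (snd (f x)) \<in> cocycles 2 X) \<and>
     continuous_map T (cochain_topology 1 X) (\<lambda>x. snd (snd (f x))) \<and>
     (\<forall>x\<in>topspace T. snd (snd (f x)) \<in> cocycles 1 X)"
  unfolding bigC_topology_def continuous_map_pairwise continuous_map_in_subtopology o_def by auto

lemma continuous_map_cls3:
  assumes "continuous_map T (cochain_topology 3 X) f"
  shows "continuous_map T (quotient_topology (cochain_topology 3 X) (cls3 X)) (\<lambda>x. cls3 X (f x))"
  using continuous_map_compose [OF assms quotient_imp_continuous_map [OF quotient_map_quotient_topology]]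
  by (simp add: o_def)

lemma compact_group_bigC: "compact_group (bigC X) (bigC_topology X)"
proof -
  let ?T = "bigC_topology X"
  have C3: "topological_group (C3_mod_B3 X) (quotient_topology (cochain_topology 3 X) (cls3 X))"
    using compact_group_C3_mod_B3 by (auto simp: compact_group_def)
  have bits: "topological_group (cochains k X) (cochain_topology k X :: ('a, bit) cochain topology)" for k
    using compact_group_bit_cochains by (auto simp: compact_group_def)
  have mult: "continuous_map T ?T (\<lambda>x. f x \<otimes>\<^bsub>bigC X\<^esub> g x)"
    if "continuous_map T ?T f" "continuous_map T ?T g" for T :: "'x topology" and f g
  proof (rule continuous_map_eq)
    show "continuous_map T ?T (\<lambda>x.
        (fst (f x) \<otimes>\<^bsub>C3_mod_B3 X\<^esub> fst (g x) \<otimes>\<^bsub>C3_mod_B3 X\<^esub>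
           cls3 X (twist X (fst (snd (f x))) (snd (snd (f x))) (fst (snd (g x))) (snd (snd (g x)))),
         fst (snd (f x)) +\<^bsub>2,X\<^esub> fst (snd (g x)) +\<^bsub>2,X\<^esub> cup 1 1 X (snd (snd (f x))) (snd (snd (g x))),
         snd (snd (f x)) +\<^bsub>1,X\<^esub> snd (snd (g x))))"
      using that unfolding continuous_map_into_bigC
      by (simp add: continuous_map_group_mult [OF C3] continuous_map_group_mult [OF bits]
          continuous_map_cls3 continuous_map_twist continuous_map_cup11)
  qed (simp add: bigC_def case_prod_unfold)
  have "continuous_map ?T ?T (\<lambda>c. bigC_inverse X c)"
  proof (rule continuous_map_eq)
    have id: "continuous_map ?T ?T (\<lambda>c. c)" by simp
    show "continuous_map ?T ?T (\<lambda>c.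
        (inv\<^bsub>C3_mod_B3 X\<^esub> (fst c \<otimes>\<^bsub>C3_mod_B3 X\<^esub>
           cls3 X (twist X (fst (snd c) +\<^bsub>2,X\<^esub> cup 1 1 X (snd (snd c)) (snd (snd c))) (snd (snd c)) (fst
             (snd c)) (snd (snd c)))),
         fst (snd c) +\<^bsub>2,X\<^esub> cup 1 1 X (snd (snd c)) (snd (snd c)), snd (snd c)))"
      using id unfolding continuous_map_into_bigC
      by (simp add: continuous_map_group_mult [OF C3] continuous_map_group_mult [OF bits]
          continuous_map_group_inv [OF C3] continuous_map_cls3 continuous_map_twist continuous_map_cup11)
  qed (simp add: bigC_inverse_def case_prod_unfold Let_def)
  then have "continuous_map ?T ?T (\<lambda>c. inv\<^bsub>bigC X\<^esub> c)"
    by (rule continuous_map_eq)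
       (use bigC_inverse in \<open>auto simp: topspace_bigC_topology intro!: group.inv_equality [OF group_bigC, symmetric]\<close>)
  moreover have "continuous_map (prod_topology ?T ?T) ?T (\<lambda>(x, y). x \<otimes>\<^bsub>bigC X\<^esub> y)"
    using mult [OF continuous_map_fst continuous_map_snd] by (simp add: case_prod_unfold)
  moreover have "compact_space ?T"
    using compact_group_C3_mod_B3 [of X] compact_group_bit_cochains [of _ X]
    by (auto simp: bigC_topology_def compact_space_prod_topology compact_group_def
        intro!: disjI2 compact_space_subtopology closedin_compact_space closedin_cocycles [OF compact_group_bit])
  moreover have "Hausdorff_space ?T"
    using compact_group_C3_mod_B3 [of X] compact_group_bit_cochains [of _ X]
    by (auto simp: bigC_topology_def Hausdorff_space_prod_topology compact_group_def Hausdorff_space_subtopology)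
  ultimately show ?thesis
    using group_bigC by (simp add: compact_group_def topological_group_def topspace_bigC_topology)
qed

section \<open>The homomorphism D\<close>

lemma coboundary_cls3:
  assumes z: "z \<in> carrier (cochains 3 X)"
  shows "the_elem (coboundary 3 X ` cls3 X z) = coboundary 3 X z"
proof -
  have "coboundary 3 X y = coboundary 3 X z" if y: "y \<in> cls3 X z" for y
  proof -
    obtain h where "y = coboundary 2 X h +\<^bsub>3,X\<^esub> z"
      using y by (auto simp: cls3_def r_coset_def B3_def)
    then have "coboundary 3 X y = \<one>\<^bsub>cochains 4 X\<^esub> +\<^bsub>4,X\<^esub> coboundary 3 X z"
      using hom_mult [OF coboundary_hom [of 3 X], of "coboundary 2 X h" z] z
      by (simp add: coboundary_coboundary_2)
    then show ?thesis
      by (simp add: group.is_monoid [OF group_cochains])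
  qed
  moreover have "z \<in> cls3 X z"
    using group.rcos_self [OF group_cochains z normal_imp_subgroup [OF B3_normal]] by (simp add: cls3_def)
  ultimately have "coboundary 3 X ` cls3 X z = {coboundary 3 X z}"
    by blast
  then show ?thesis
    by simp
qed

lemma bigD_eq:
  assumes "z \<in> carrier (cochains 3 X)"
  shows "bigD X (cls3 X z, p, a) = coboundary 3 X z +\<^bsub>4,X\<^esub> change_coefficients half 4 X (cup 2 2 X p p)"
  using assms by (simp add: bigD_def coboundary_cls3)

lemma bigD_hom: "bigD X \<in> hom (bigC X) (cochains 4 (X :: 'a topology))"
proof (rule homI)
  fix c d assume "c \<in> carrier (bigC X)" "d \<in> carrier (bigC X)"
  then obtain w p a v q b where c: "c = (cls3 X w, p, a)" "w \<in> carrier (cochains 3 X)" "p \<in> cocycles 2 X" "a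
    \<in> cocycles 1 X"
    and d: "d = (cls3 X v, q, b)" "v \<in> carrier (cochains 3 X)" "q \<in> cocycles 2 X" "b \<in> cocycles 1 X"
    by (elim bigC_cases)
  let ?pq = "p +\<^bsub>2,X\<^esub> q +\<^bsub>2,X\<^esub> cup 1 1 X a b" and ?T = "twist X p a q b"
  have dsum: "coboundary 3 X (w +\<^bsub>3,X\<^esub> v +\<^bsub>3,X\<^esub> ?T) =
      coboundary 3 X w +\<^bsub>4,X\<^esub> coboundary 3 X v +\<^bsub>4,X\<^esub> coboundary 3 X ?T"
    using hom_mult [OF coboundary_hom [of 3 X], of "w +\<^bsub>3,X\<^esub> v" ?T] hom_mult [OF coboundary_hom [of 3 X], of w v] c d
    by simp
  have "coboundary 3 X (w +\<^bsub>3,X\<^esub> v +\<^bsub>3,X\<^esub> ?T) +\<^bsub>4,X\<^esub> change_coefficients half 4 X (cup 2 2 X ?pq ?pq) =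
    (coboundary 3 X w +\<^bsub>4,X\<^esub> change_coefficients half 4 X (cup 2 2 X p p)) +\<^bsub>4,X\<^esub>
    (coboundary 3 X v +\<^bsub>4,X\<^esub> change_coefficients half 4 X (cup 2 2 X q q))"
  proof (rule cochain4_eqI [where X = X])
    fix \<sigma> assume \<sigma>: "singular_simplex 4 X \<sigma>"
    define e where "e vs = subsimplex vs \<sigma>" for vs
    note a = cocycle1_on_face [OF c(4) \<sigma>] and b = cocycle1_on_face [OF d(4) \<sigma>]
      and p = cocycle2_on_face [OF c(3) \<sigma>] and q = cocycle2_on_face [OF d(3) \<sigma>]
    have T: "coboundary 3 X ?T (e [0, 1, 2, 3, 4]) + half (p (e [0, 1, 2]) * p (e [2, 3, 4]))
        + half (q (e [0, 1, 2]) * q (e [2, 3, 4])) = half (?pq (e [0, 1, 2]) * ?pq (e [2, 3, 4]))"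
      using twist_value_coboundary [OF a [of 0 1 2] a [of 1 2 3] b [of 1 2 3] b [of 2 3 4]
        p [of 0 1 2 3] p [of 0 1 2 4] p [of 0 1 3 4] p [of 0 2 3 4]
        q [of 0 1 2 3] q [of 0 1 2 4] q [of 0 1 3 4] q [of 0 2 3 4]]
      by (simp add: e_def on_face [OF \<sigma>] twist_on_face [OF \<sigma>])
    have dT: "coboundary 3 X ?T (e [0, 1, 2, 3, 4]) = half (?pq (e [0, 1, 2]) * ?pq (e [2, 3, 4]))
        + half (p (e [0, 1, 2]) * p (e [2, 3, 4])) + half (q (e [0, 1, 2]) * q (e [2, 3, 4]))"
      by (subst T [symmetric]) (simp add: half_cancel add_ac)
    show "(coboundary 3 X (w +\<^bsub>3,X\<^esub> v +\<^bsub>3,X\<^esub> ?T) +\<^bsub>4,X\<^esub> change_coefficients half 4 X (cup 2 2 X ?pq ?pq))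
        (subsimplex [0, 1, 2, 3, 4] \<sigma>) =
      ((coboundary 3 X w +\<^bsub>4,X\<^esub> change_coefficients half 4 X (cup 2 2 X p p)) +\<^bsub>4,X\<^esub>
       (coboundary 3 X v +\<^bsub>4,X\<^esub> change_coefficients half 4 X (cup 2 2 X q q))) (subsimplex [0, 1, 2, 3, 4] \<sigma>)"
      unfolding dsum using dT
      by (simp add: e_def add_on_face [OF \<sigma>] change_coefficients_on_face [OF \<sigma>] cup_on_face(4) [OF \<sigma>] add_ac
        half_cancel)
  qed simp_all
  then show "bigD X (c \<otimes>\<^bsub>bigC X\<^esub> d) = bigD X c +\<^bsub>4,X\<^esub> bigD X d"
    using c d by (simp add: bigC_mult bigD_eq)
next
  fix c assume "c \<in> carrier (bigC X)"
  then show "bigD X c \<in> carrier (cochains 4 X)"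
    by (auto simp: bigD_eq elim!: bigC_cases)
qed

lemma continuous_map_bigD: "continuous_map (bigC_topology X) (cochain_topology 4 (X :: 'a topology)) (bigD X)"
proof -
  let ?T = "bigC_topology X" and ?Q = "quotient_topology (cochain_topology 3 X) (cls3 X)"
  have C4: "topological_group (cochains 4 X) (cochain_topology 4 X :: ('a, real_mod_int) cochain topology)"
    using compact_group_circle_cochains by (auto simp: compact_group_def)
  have "continuous_map ?T ?T (\<lambda>c. c)" by simp
  then have w: "continuous_map ?T ?Q (\<lambda>c. fst c)" and p: "continuous_map ?T (cochain_topology 2 X) (\<lambda>c. fst (snd c))"
    unfolding continuous_map_into_bigC by auto
  have "continuous_map (cochain_topology 3 X) (cochain_topology 4 X) (\<lambda>z. the_elem (coboundary 3 X ` cls3 X z))"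
    by (rule continuous_map_eq [of _ _ "coboundary 3 X"])
       (use continuous_map_coboundary [OF compact_group_circle, of 3 X] in \<open>simp_all add: coboundary_cls3\<close>)
  then have "continuous_map ?Q (cochain_topology 4 X) (\<lambda>w. the_elem (coboundary 3 X ` w))"
    by (rule continuous_map_through_quotient)
  then have dw: "continuous_map ?T (cochain_topology 4 X) (\<lambda>c. the_elem (coboundary 3 X ` fst c))"
    using continuous_map_compose [OF w] by (simp add: o_def)
  have "continuous_map ?T (cochain_topology 4 X) (\<lambda>c. change_coefficients half 4 X (cup 2 2 X (fst (snd c))
    (fst (snd c))))"
    unfolding continuous_map_into_cochains
  proof (intro conjI allI impI)
    fix \<sigma> assume \<sigma>: "singular_simplex 4 X \<sigma>"
    have "continuous_map ?T euclidean (\<lambda>c. half (fst (snd c) (subsimplex [0, 1, 2] \<sigma>) * fst (snd c)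
      (subsimplex [2, 3, 4] \<sigma>)))"
      by (rule continuous_map_discrete2 [where F = "\<lambda>u v. half (u * v)"]) (simp_all add: continuous_map_value [OF p \<sigma>])
    then have "continuous_map ?T euclidean
       (\<lambda>c. change_coefficients half 4 X (cup 2 2 X (fst (snd c)) (fst (snd c))) (subsimplex [0, 1, 2, 3, 4] \<sigma>))"
      by (simp add: on_face [OF \<sigma>])
    then show "continuous_map ?T euclidean (\<lambda>c. change_coefficients half 4 X (cup 2 2 X (fst (snd c)) (fst (snd c))) \<sigma>)"
      by (simp only: simplex_eq_subsimplex(5) [OF \<sigma>, symmetric])
  qed auto
  from continuous_map_group_mult [OF C4 dw this] show ?thesis
    by (simp add: bigD_def case_prod_unfold)
qed

section \<open>The group C'(X) and the homomorphism D'\<close>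

lemma bigC'_mult:
  "(t, x) \<otimes>\<^bsub>bigC' X\<^esub> (s, y) = (t +\<^bsub>1,X\<^esub> s +\<^bsub>1,X\<^esub> cup 0 1 X x (coboundary 0 X y), x +\<^bsub>0,X\<^esub> y)"
  by (simp add: bigC'_def)

lemma carrier_bigC': "carrier (bigC' X) = carrier (cochains 1 X) \<times> carrier (cochains 0 X)"
  by (simp add: bigC'_def)

definition bigC'_inverse where
  "bigC'_inverse X = (\<lambda>(t, x). (t +\<^bsub>1,X\<^esub> cup 0 1 X x (coboundary 0 X x), x))"

lemma bigC'_inverse:
  assumes "c \<in> carrier (bigC' X)"
  shows "bigC'_inverse X c \<in> carrier (bigC' X)" "bigC'_inverse X c \<otimes>\<^bsub>bigC' X\<^esub> c = \<one>\<^bsub>bigC' X\<^esub>"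
proof -
  obtain t x where c: "c = (t, x)" "t \<in> carrier (cochains 1 X)" "x \<in> carrier (cochains 0 X)"
    using assms by (auto simp: carrier_bigC')
  then show "bigC'_inverse X c \<in> carrier (bigC' X)"
    by (simp add: bigC'_inverse_def carrier_bigC')
  have "t +\<^bsub>1,X\<^esub> cup 0 1 X x (coboundary 0 X x) +\<^bsub>1,X\<^esub> t +\<^bsub>1,X\<^esub> cup 0 1 X x (coboundary 0 X x) = \<one>\<^bsub>cochains 1 X\<^esub>"
    by (rule cochain1_eqI [where X = X]) (simp_all add: on_face algebra_simps bit_ring)
  moreover have "x +\<^bsub>0,X\<^esub> x = \<one>\<^bsub>cochains 0 X\<^esub>"
    by (rule cochain0_eqI [where X = X]) (simp_all add: on_face bit_ring)
  ultimately show "bigC'_inverse X c \<otimes>\<^bsub>bigC' X\<^esub> c = \<one>\<^bsub>bigC' X\<^esub>"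
    by (simp add: c bigC'_inverse_def bigC'_def)
qed

lemma group_bigC': "group (bigC' X)"
proof (rule groupI)
  fix c d e assume cde: "c \<in> carrier (bigC' X)" "d \<in> carrier (bigC' X)" "e \<in> carrier (bigC' X)"
  obtain t x s y r z where "c = (t, x)" "d = (s, y)" "e = (r, z)"
    by (metis surj_pair)
  moreover have "t +\<^bsub>1,X\<^esub> s +\<^bsub>1,X\<^esub> cup 0 1 X x (coboundary 0 X y) +\<^bsub>1,X\<^esub> r +\<^bsub>1,X\<^esub> cup 0 1 X (x +\<^bsub>0,X\<^esub> y)
    (coboundary 0 X z) =
    t +\<^bsub>1,X\<^esub> (s +\<^bsub>1,X\<^esub> r +\<^bsub>1,X\<^esub> cup 0 1 X y (coboundary 0 X z)) +\<^bsub>1,X\<^esub> cup 0 1 X x (coboundary 0 X (y +\<^bsub>0,X\<^esub> z))"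
    by (rule cochain1_eqI [where X = X]) (simp_all add: on_face algebra_simps bit_ring)
  moreover have "x +\<^bsub>0,X\<^esub> y +\<^bsub>0,X\<^esub> z = x +\<^bsub>0,X\<^esub> (y +\<^bsub>0,X\<^esub> z)"
    by (rule cochain0_eqI [where X = X]) (simp_all add: on_face add_ac)
  ultimately show "c \<otimes>\<^bsub>bigC' X\<^esub> d \<otimes>\<^bsub>bigC' X\<^esub> e = c \<otimes>\<^bsub>bigC' X\<^esub> (d \<otimes>\<^bsub>bigC' X\<^esub> e)"
    by (simp add: bigC'_mult)
next
  fix c d assume "c \<in> carrier (bigC' X)" "d \<in> carrier (bigC' X)"
  then show "c \<otimes>\<^bsub>bigC' X\<^esub> d \<in> carrier (bigC' X)"
    by (auto simp: bigC'_mult carrier_bigC')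
next
  show "\<one>\<^bsub>bigC' X\<^esub> \<in> carrier (bigC' X)"
    by (simp add: bigC'_def)
next
  fix c assume "c \<in> carrier (bigC' X)"
  then obtain t x where c: "c = (t, x)" "t \<in> carrier (cochains 1 X)" "x \<in> carrier (cochains 0 X)"
    by (auto simp: carrier_bigC')
  have "\<one>\<^bsub>cochains 1 X\<^esub> +\<^bsub>1,X\<^esub> t +\<^bsub>1,X\<^esub> cup 0 1 X \<one>\<^bsub>cochains 0 X\<^esub> (coboundary 0 X x) = t"
    using c by (intro cochain1_eqI [where X = X]) (simp_all add: on_face)
  moreover have "\<one>\<^bsub>cochains 0 X\<^esub> +\<^bsub>0,X\<^esub> x = x"
    using c by (simp add: group.is_monoid [OF group_cochains])
  ultimately show "\<one>\<^bsub>bigC' X\<^esub> \<otimes>\<^bsub>bigC' X\<^esub> c = c"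
    by (simp add: c bigC'_def)
next
  fix c assume "c \<in> carrier (bigC' X)"
  then show "\<exists>d\<in>carrier (bigC' X). d \<otimes>\<^bsub>bigC' X\<^esub> c = \<one>\<^bsub>bigC' X\<^esub>"
    using bigC'_inverse by blast
qed

lemma continuous_map_cup01_coboundary:
  fixes X :: "'a topology"
  assumes "continuous_map T (cochain_topology 0 X) x" "continuous_map T (cochain_topology 0 X) y"
  shows "continuous_map T (cochain_topology 1 X) (\<lambda>u. cup 0 1 X (x u) (coboundary 0 X (y u)) :: ('a, bit) cochain)"
  unfolding continuous_map_into_cochains
proof (intro conjI allI impI)
  fix \<sigma> assume \<sigma>: "singular_simplex 1 X \<sigma>"
  have "continuous_map T euclidean (\<lambda>u. x u (subsimplex [0] \<sigma>) * (y u (subsimplex [1] \<sigma>) - y u (subsimplex [0] \<sigma>)))"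
    by (intro continuous_map_discrete2 [where F = "(*)"] continuous_map_discrete2 [where F = "(-)"]
        continuous_map_value [OF assms(1) \<sigma>] continuous_map_value [OF assms(2) \<sigma>]) simp_all
  then have "continuous_map T euclidean (\<lambda>u. cup 0 1 X (x u) (coboundary 0 X (y u)) (subsimplex [0, 1] \<sigma>))"
    by (simp add: on_face [OF \<sigma>])
  then show "continuous_map T euclidean (\<lambda>u. cup 0 1 X (x u) (coboundary 0 X (y u)) \<sigma>)"
    by (simp only: simplex_eq_subsimplex(2) [OF \<sigma>, symmetric])
qed auto

lemma compact_group_bigC': "compact_group (bigC' X) (bigC'_topology (X :: 'a topology))"
proof -
  let ?T = "bigC'_topology X"
  have bits: "topological_group (cochains k X) (cochain_topology k X :: ('a, bit) cochain topology)" for k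
    using compact_group_bit_cochains by (auto simp: compact_group_def)
  have top: "topspace ?T = carrier (bigC' X)"
    by (simp add: bigC'_topology_def carrier_bigC')
  have fs: "continuous_map ?T (cochain_topology 1 X) fst" "continuous_map ?T (cochain_topology 0 X) snd"
    unfolding bigC'_topology_def by (rule continuous_map_fst continuous_map_snd)+
  have f: "continuous_map (prod_topology ?T ?T) (cochain_topology 1 X) (\<lambda>z. fst (fst z))"
    "continuous_map (prod_topology ?T ?T) (cochain_topology 0 X) (\<lambda>z. snd (fst z))"
    "continuous_map (prod_topology ?T ?T) (cochain_topology 1 X) (\<lambda>z. fst (snd z))"
    "continuous_map (prod_topology ?T ?T) (cochain_topology 0 X) (\<lambda>z. snd (snd z))"
    using continuous_map_compose [OF continuous_map_fst fs(1)] continuous_map_compose [OF continuous_map_fst fs(2)]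
      continuous_map_compose [OF continuous_map_snd fs(1)] continuous_map_compose [OF continuous_map_snd fs(2)]
    by (auto simp: o_def)
  have "continuous_map (prod_topology ?T ?T) ?T (\<lambda>z. (fst (fst z) +\<^bsub>1,X\<^esub> fst (snd z) +\<^bsub>1,X\<^esub>
      cup 0 1 X (snd (fst z)) (coboundary 0 X (snd (snd z))), snd (fst z) +\<^bsub>0,X\<^esub> snd (snd z)))"
    unfolding bigC'_topology_def [of X]
    by (intro continuous_map_pairedI continuous_map_group_mult [OF bits] continuous_map_cup01_coboundary
        f [unfolded bigC'_topology_def])
  then have "continuous_map (prod_topology ?T ?T) ?T (\<lambda>(c, d). c \<otimes>\<^bsub>bigC' X\<^esub> d)"
    by (simp add: bigC'_def case_prod_unfold)
  moreover have "continuous_map ?T ?T (\<lambda>c. (fst c +\<^bsub>1,X\<^esub> cup 0 1 X (snd c) (coboundary 0 X (snd c)), snd c))"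
    unfolding bigC'_topology_def [of X]
    by (intro continuous_map_pairedI continuous_map_group_mult [OF bits] continuous_map_cup01_coboundary
        fs [unfolded bigC'_topology_def])
  then have "continuous_map ?T ?T (\<lambda>c. inv\<^bsub>bigC' X\<^esub> c)"
    by (rule continuous_map_eq)
       (use bigC'_inverse [of _ X] in \<open>auto simp: top bigC'_inverse_def case_prod_unfold
          intro!: group.inv_equality [OF group_bigC', symmetric]\<close>)
  moreover have "compact_space ?T" "Hausdorff_space ?T"
    using compact_group_bit_cochains [of _ X]
    by (auto simp: bigC'_topology_def compact_group_def compact_space_prod_topology Hausdorff_space_prod_topology)
  ultimately show ?thesis
    using group_bigC' by (simp add: compact_group_def topological_group_def top)
qed

lemma bigD'_hom: "bigD' X \<in> hom (bigC' X) (bigC (X :: 'a topology))"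
proof (rule homI)
  fix c assume "c \<in> carrier (bigC' X)"
  then show "bigD' X c \<in> carrier (bigC X)"
    by (auto simp: bigD'_def carrier_bigC')
next
  fix c d assume "c \<in> carrier (bigC' X)" "d \<in> carrier (bigC' X)"
  then obtain t x s y where c: "c = (t, x)" "t \<in> carrier (cochains 1 X)" "x \<in> carrier (cochains 0 X)"
    and d: "d = (s, y)" "s \<in> carrier (cochains 1 X)" "y \<in> carrier (cochains 0 X)"
    by (auto simp: carrier_bigC')
  let ?ts = "t +\<^bsub>1,X\<^esub> s +\<^bsub>1,X\<^esub> cup 0 1 X x (coboundary 0 X y)"
  let ?a = "coboundary 0 X x" and ?b = "coboundary 0 X y" and ?p = "coboundary 1 X t" and ?q = "coboundary 1 X s"
  define h where "h \<tau> = half (t (subsimplex [0, 2] \<tau>) * ?q \<tau> + s (subsimplex [0, 1] \<tau>) * t (subsimplex [1, 2] \<tau>)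
     + (t (subsimplex [0, 2] \<tau>) + s (subsimplex [0, 2] \<tau>)) * (?a (subsimplex [0, 1] \<tau>) * ?b (subsimplex [1, 2] \<tau>))
     + x (subsimplex [0] \<tau>) * ?b (subsimplex [0, 1] \<tau>) * (t (subsimplex [1, 2] \<tau>) + s (subsimplex [1, 2] \<tau>))) +
    exact_primitive (x (subsimplex [0] \<tau>)) (x (subsimplex [1] \<tau>)) (y (subsimplex [0] \<tau>)) (y (subsimplex [1]
      \<tau>)) (y (subsimplex [2] \<tau>))" for \<tau>
  have "cls3 X (change_coefficients half 3 X (cup 1 2 X ?ts (coboundary 1 X ?ts))) =
    cls3 X (change_coefficients half 3 X (cup 1 2 X t ?p) +\<^bsub>3,X\<^esub> change_coefficients half 3 X (cup 1 2 X s ?q)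
      +\<^bsub>3,X\<^esub> twist X ?p ?a ?q ?b)"
  proof (rule cls3_eqI [where h = h])
    fix \<sigma> assume \<sigma>: "singular_simplex 3 X \<sigma>"
    let ?x = "\<lambda>i. x (subsimplex [i] \<sigma>)" and ?y = "\<lambda>i. y (subsimplex [i] \<sigma>)"
      and ?t = "\<lambda>i j. t (subsimplex [i, j] \<sigma>)" and ?s = "\<lambda>i j. s (subsimplex [i, j] \<sigma>)"
    show "change_coefficients half 3 X (cup 1 2 X ?ts (coboundary 1 X ?ts)) (subsimplex [0, 1, 2, 3] \<sigma>) =
      (change_coefficients half 3 X (cup 1 2 X t ?p) +\<^bsub>3,X\<^esub> change_coefficients half 3 X (cup 1 2 X s ?q)
      +\<^bsub>3,X\<^esub> twist X ?p ?a ?q ?b) (subsimplex [0, 1, 2, 3] \<sigma>) +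
      coboundary 2 X h (subsimplex [0, 1, 2, 3] \<sigma>)"
      using twist_value_exact [of "?x 0 + ?x 1" "?x 0" "?x 1" "?x 0 + ?x 2" "?x 2" "?x 1 + ?x 2"
          "?y 0 + ?y 1" "?y 0" "?y 1" "?y 1 + ?y 2" "?y 2" "?y 1 + ?y 3" "?y 3" "?y 2 + ?y 3"
          "?t 0 1" "?s 0 1" "?t 2 3" "?s 2 3" "?t 1 3" "?s 1 3" "?t 1 2" "?s 1 2" "?t 0 3" "?t 0 2" "?s 0 2" "?s 0 3"]
      by (simp add: h_def on_face [OF \<sigma>] twist_on_face [OF \<sigma>] subsimplex_subsimplex nth_Cons' bit_ring add_ac)
  qed simp_all
  moreover have "coboundary 1 X ?ts = ?p +\<^bsub>2,X\<^esub> ?q +\<^bsub>2,X\<^esub> cup 1 1 X ?a ?b"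
    by (rule cochain2_eqI [where X = X]) (simp_all add: on_face algebra_simps bit_ring)
  moreover have "coboundary 0 X (x +\<^bsub>0,X\<^esub> y) = ?a +\<^bsub>1,X\<^esub> ?b"
    using hom_mult [OF coboundary_hom [of 0 X] c(3) d(3)] by (simp add: One_nat_def)
  ultimately show "bigD' X (c \<otimes>\<^bsub>bigC' X\<^esub> d) = bigD' X c \<otimes>\<^bsub>bigC X\<^esub> bigD' X d"
    using c d by (simp add: bigC'_mult bigD'_def bigC_mult)
qed

lemma continuous_map_bigD': "continuous_map (bigC'_topology X) (bigC_topology (X :: 'a topology)) (bigD' X)"
proof -
  let ?T = "bigC'_topology X"
  have t: "continuous_map ?T (cochain_topology 1 X) fst" and x: "continuous_map ?T (cochain_topology 0 X) snd"
    unfolding bigC'_topology_def by (rule continuous_map_fst continuous_map_snd)+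
  have "continuous_map (cochain_topology 1 X) (cochain_topology 2 X) (coboundary 1 X :: ('a, bit) cochain \<Rightarrow> _)"
    "continuous_map (cochain_topology 0 X) (cochain_topology 1 X) (coboundary 0 X :: ('a, bit) cochain \<Rightarrow> _)"
    using continuous_map_coboundary [OF compact_group_bit, of 1 X] continuous_map_coboundary [OF
      compact_group_bit, of 0 X]
    by (simp_all add: One_nat_def [symmetric])
  then have d: "continuous_map ?T (cochain_topology 2 X) (\<lambda>c. coboundary 1 X (fst c))"
    "continuous_map ?T (cochain_topology 1 X) (\<lambda>c. coboundary 0 X (snd c))"
    using continuous_map_compose [OF t] continuous_map_compose [OF x] by (auto simp: o_def)
  have "continuous_map ?T (cochain_topology 3 X)
      (\<lambda>c. change_coefficients half 3 X (cup 1 2 X (fst c) (coboundary 1 X (fst c))))"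
    unfolding continuous_map_into_cochains
  proof (intro conjI allI impI)
    fix \<sigma> assume \<sigma>: "singular_simplex 3 X \<sigma>"
    have "continuous_map ?T euclidean (\<lambda>c. half (fst c (subsimplex [0, 1] \<sigma>) * coboundary 1 X (fst c)
      (subsimplex [1, 2, 3] \<sigma>)))"
      by (rule continuous_map_discrete2 [where F = "\<lambda>u v. half (u * v)"])
         (simp_all add: continuous_map_value [OF t \<sigma>] continuous_map_value [OF d(1) \<sigma>])
    then have "continuous_map ?T euclidean
       (\<lambda>c. change_coefficients half 3 X (cup 1 2 X (fst c) (coboundary 1 X (fst c))) (subsimplex [0, 1, 2, 3] \<sigma>))"
      by (simp add: cup_on_face [OF \<sigma>] change_coefficients_on_face [OF \<sigma>])
    then show "continuous_map ?T euclidean (\<lambda>c. change_coefficients half 3 X (cup 1 2 X (fst c) (coboundary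
      1 X (fst c))) \<sigma>)"
      by (simp only: simplex_eq_subsimplex(4) [OF \<sigma>, symmetric])
  qed auto
  then show ?thesis
    unfolding continuous_map_into_bigC using d
    by (simp add: bigD'_def case_prod_unfold continuous_map_cls3)
qed

lemma bigD_bigD':
  assumes "c \<in> carrier (bigC' X)"
  shows "bigD X (bigD' X c) = \<one>\<^bsub>cochains 4 (X :: 'a topology)\<^esub>"
proof -
  obtain t x where c: "c = (t, x)" by (metis surj_pair)
  let ?p = "coboundary 1 X t"
  have "coboundary 3 X (change_coefficients half 3 X (cup 1 2 X t ?p)) +\<^bsub>4,X\<^esub> change_coefficients half 4 X
    (cup 2 2 X ?p ?p) = \<one>\<^bsub>cochains 4 X\<^esub>"
    by (rule cochain4_eqI [where X = X]) (simp_all add: on_face algebra_simps half_add half_cancel bit_ring)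
  then show ?thesis
    by (simp add: c bigD'_def bigD_eq)
qed

text \<open>The element of the image is \<open>D'(a \<union>\<^sub>1 b, 0)\<close>; its middle component \<open>ab + ba\<close> is the difference of
  the middle components of the two products.\<close>

lemma bigC_commute:
  assumes "c \<in> carrier (bigC X)" "d \<in> carrier (bigC (X :: 'a topology))"
  shows "\<exists>n\<in>ImD' X. c \<otimes>\<^bsub>bigC X\<^esub> d = n \<otimes>\<^bsub>bigC X\<^esub> (d \<otimes>\<^bsub>bigC X\<^esub> c)"
proof -
  obtain w p a v q b where c: "c = (cls3 X w, p, a)" "w \<in> carrier (cochains 3 X)" "p \<in> cocycles 2 X" "a \<in> cocycles 1 X"
    and d: "d = (cls3 X v, q, b)" "v \<in> carrier (cochains 3 X)" "q \<in> cocycles 2 X" "b \<in> cocycles 1 X"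
    using assms by (elim bigC_cases)
  define t where "t = cup1_deg1 X a b"
  let ?z = "coboundary 0 X \<one>\<^bsub>cochains 0 X\<^esub> :: ('a, bit) cochain"
  let ?dt = "coboundary 1 X t" and ?qp = "q +\<^bsub>2,X\<^esub> p +\<^bsub>2,X\<^esub> cup 1 1 X b a"
  have t: "t \<in> carrier (cochains 1 X)" by (simp add: t_def)
  have "cls3 X (w +\<^bsub>3,X\<^esub> v +\<^bsub>3,X\<^esub> twist X p a q b) =
    cls3 X (change_coefficients half 3 X (cup 1 2 X t ?dt) +\<^bsub>3,X\<^esub> (v +\<^bsub>3,X\<^esub> w +\<^bsub>3,X\<^esub> twist X q b p a)
       +\<^bsub>3,X\<^esub> twist X ?dt ?z ?qp (b +\<^bsub>1,X\<^esub> a))"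
  proof (rule cls3_eqI)
    fix \<sigma> assume \<sigma>: "singular_simplex 3 X \<sigma>"
    define e where "e vs = subsimplex vs \<sigma>" for vs
    define h where "h \<tau> = half (p \<tau> * q \<tau> + (p \<tau> + q \<tau>) *
        (a (subsimplex [0, 1] \<tau>) * b (subsimplex [1, 2] \<tau>) + b (subsimplex [0, 1] \<tau>) * a (subsimplex [1, 2] \<tau>))) +
      comm_primitive (a (subsimplex [0, 1] \<tau>)) (a (subsimplex [1, 2] \<tau>)) (b (subsimplex [0, 1] \<tau>)) (b
        (subsimplex [1, 2] \<tau>))" for \<tau>
    note a = cocycle1_on_face [OF c(4) \<sigma>] and b = cocycle1_on_face [OF d(4) \<sigma>]
    have dt: "?dt (subsimplex [i, j, k] \<sigma>) = a (subsimplex [i, j] \<sigma>) * b (subsimplex [j, k] \<sigma>) +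
      b (subsimplex [i, j] \<sigma>) * a (subsimplex [j, k] \<sigma>)"
      if "i \<le> 3" "j \<le> 3" "k \<le> 3" for i j k
      using that a [of i j k] b [of i j k]
      by (simp add: t_def coboundary_on_face [OF \<sigma>] cup1_on_face [OF \<sigma>] algebra_simps bit_ring)
    have "twist X p a q b (e [0, 1, 2, 3]) = half (t (e [0, 1]) * ?dt (e [1, 2, 3])) +
      twist X q b p a (e [0, 1, 2, 3]) + twist X ?dt ?z ?qp (b +\<^bsub>1,X\<^esub> a) (e [0, 1, 2, 3]) +
      coboundary 2 X h (e [0, 1, 2, 3])"
      using twist_value_comm [OF a [of 0 1 2] b [of 0 1 2] a [of 1 2 3] b [of 1 2 3]
        cocycle2_on_face [OF c(3) \<sigma>, of 0 1 2 3] cocycle2_on_face [OF d(3) \<sigma>, of 0 1 2 3],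
        of "?qp (e [0, 1, 3])" "?qp (e [0, 2, 3])" "(b +\<^bsub>1,X\<^esub> a) (e [1, 2])" "(b +\<^bsub>1,X\<^esub> a) (e [2, 3])"]
      by (simp add: coboundary_on_face(3) [OF \<sigma>] h_def e_def twist_on_face [OF \<sigma>] dt [unfolded t_def] t_def
        add_on_face [OF \<sigma>] zero_on_face [OF \<sigma>] cup_on_face [OF \<sigma>]
        cup1_on_face [OF \<sigma>] coboundary_on_face(1) [OF \<sigma>] subsimplex_subsimplex nth_Cons')
    then show "(w +\<^bsub>3,X\<^esub> v +\<^bsub>3,X\<^esub> twist X p a q b) (subsimplex [0, 1, 2, 3] \<sigma>) =
      (change_coefficients half 3 X (cup 1 2 X t ?dt) +\<^bsub>3,X\<^esub> (v +\<^bsub>3,X\<^esub> w +\<^bsub>3,X\<^esub> twist X q b p a)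
       +\<^bsub>3,X\<^esub> twist X ?dt ?z ?qp (b +\<^bsub>1,X\<^esub> a)) (subsimplex [0, 1, 2, 3] \<sigma>) +
      coboundary 2 X h (subsimplex [0, 1, 2, 3] \<sigma>)"
      by (simp add: e_def add_on_face [OF \<sigma>] change_coefficients_on_face [OF \<sigma>] cup_on_face(3) [OF \<sigma>] algebra_simps)
  qed simp_all
  moreover have "p +\<^bsub>2,X\<^esub> q +\<^bsub>2,X\<^esub> cup 1 1 X a b = ?dt +\<^bsub>2,X\<^esub> ?qp +\<^bsub>2,X\<^esub> cup 1 1 X ?z (b +\<^bsub>1,X\<^esub> a)"
  proof (rule cochain2_eqI [where X = X])
    fix \<sigma> assume \<sigma>: "singular_simplex 2 X \<sigma>"
    show "(p +\<^bsub>2,X\<^esub> q +\<^bsub>2,X\<^esub> cup 1 1 X a b) (subsimplex [0, 1, 2] \<sigma>) =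
      (?dt +\<^bsub>2,X\<^esub> ?qp +\<^bsub>2,X\<^esub> cup 1 1 X ?z (b +\<^bsub>1,X\<^esub> a)) (subsimplex [0, 1, 2] \<sigma>)"
      using cocycle1_on_face [OF c(4) \<sigma>, of 0 1 2] cocycle1_on_face [OF d(4) \<sigma>, of 0 1 2]
      by (simp add: t_def on_face [OF \<sigma>] algebra_simps bit_ring)
  qed simp_all
  moreover have "a +\<^bsub>1,X\<^esub> b = ?z +\<^bsub>1,X\<^esub> (b +\<^bsub>1,X\<^esub> a)"
    by (rule cochain1_eqI [where X = X]) (simp_all add: on_face add_ac)
  ultimately have "c \<otimes>\<^bsub>bigC X\<^esub> d = bigD' X (t, \<one>\<^bsub>cochains 0 X\<^esub>) \<otimes>\<^bsub>bigC X\<^esub> (d \<otimes>\<^bsub>bigC X\<^esub> c)"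
    using c d by (simp add: bigD'_def bigC_mult)
  moreover have "bigD' X (t, \<one>\<^bsub>cochains 0 X\<^esub>) \<in> ImD' X"
    using t by (auto simp: ImD'_def carrier_bigC')
  ultimately show ?thesis by blast
qed

lemma subgroup_ImD': "subgroup (ImD' X) (bigC X)"
proof -
  interpret group_hom "bigC' X" "bigC X" "bigD' X"
    by (simp add: group_hom_def group_hom_axioms_def group_bigC group_bigC' bigD'_hom)
  show ?thesis
    using img_is_subgroup by (simp add: ImD'_def)
qed

lemmas ImD'_normal = group.normal_of_commutators(1) [OF group_bigC subgroup_ImD' bigC_commute]
lemmas derived_bigC_subset = group.normal_of_commutators(2) [OF group_bigC subgroup_ImD' bigC_commute]

lemma closedin_ImD': "closedin (bigC_topology X) (ImD' X)"
proof -
  have "topspace (bigC'_topology X) = carrier (bigC' X)"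
    using compact_group_bigC' [of X] by (simp add: compact_group_def topological_group_def)
  then have "compactin (bigC_topology X) (ImD' X)"
    using image_compactin [OF _ continuous_map_bigD', of X "topspace (bigC'_topology X)"] compact_group_bigC' [of X]
    by (simp add: ImD'_def compact_group_def compact_space_def)
  then show ?thesis
    using compact_group_bigC compactin_imp_closedin by (auto simp: compact_group_def)
qed

section \<open>The group G(X)\<close>

lemma group_hom_bigD: "group_hom (bigC X) (cochains 4 X) (bigD X)"
  by (simp add: group_hom_def group_hom_axioms_def group_bigC group_cochains bigD_hom)

lemma subgroup_KerD: "subgroup (KerD X) (bigC X)"
  unfolding KerD_def by (rule group_hom.subgroup_kernel [OF group_hom_bigD])

lemma KerD_closed: "c \<in> KerD X \<Longrightarrow> c \<in> carrier (bigC X)"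
  using subgroup.mem_carrier [OF subgroup_KerD] .

lemma closedin_KerD: "closedin (bigC_topology X) (KerD X)"
proof -
  have "closedin (cochain_topology 4 X) {\<one>\<^bsub>cochains 4 X\<^esub> :: ('a, real_mod_int) cochain}" for X :: "'a topology"
    using compact_group_circle_cochains [of 4 X] by (simp add: compact_group_def closedin_Hausdorff_singleton)
  from closedin_continuous_map_preimage [OF continuous_map_bigD this]
  show ?thesis
    by (simp add: KerD_def kernel_def topspace_bigC_topology)
qed

lemma ImD'_subset_KerD: "ImD' X \<subseteq> KerD X"
proof
  fix c assume c: "c \<in> ImD' X"
  then have "c \<in> carrier (bigC X)"
    using subgroup.mem_carrier [OF subgroup_ImD'] by blast
  with c show "c \<in> KerD X"
    using bigD_bigD' by (auto simp: KerD_def kernel_def ImD'_def)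
qed

lemma compact_group_KerD: "compact_group (bigC X\<lparr>carrier := KerD X\<rparr>) (subtopology (bigC_topology X) (KerD X))"
  by (rule compact_group_closed_subgroup [OF compact_group_bigC subgroup_KerD closedin_KerD])

lemma group_KerD: "group (bigC X\<lparr>carrier := KerD X\<rparr>)"
  by (rule group.subgroup_imp_group [OF group_bigC subgroup_KerD])

lemma ImD'_normal_KerD: "ImD' X \<lhd> bigC X\<lparr>carrier := KerD X\<rparr>"
proof (rule group.normal_of_commutators(1) [OF group_KerD])
  show "subgroup (ImD' X) (bigC X\<lparr>carrier := KerD X\<rparr>)"
    by (rule group.subgroup_incl [OF group_bigC subgroup_ImD' subgroup_KerD ImD'_subset_KerD])
qed (auto intro!: bigC_commute KerD_closed)

lemma compact_group_G: "compact_group (G X) (G_topology X)"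
proof -
  have "closedin (subtopology (bigC_topology X) (KerD X)) (ImD' X)"
    by (rule closedin_subset_topspace [OF closedin_ImD' ImD'_subset_KerD])
  from compact_group_quotient [OF compact_group_KerD ImD'_normal_KerD this]
  show ?thesis
    by (simp add: G_def G_topology_def G_class_def [abs_def] r_coset_def)
qed

lemma comm_group_G: "comm_group (G X)"
  unfolding G_def
  by (rule group.comm_group_quotient [OF group_KerD ImD'_normal_KerD]) (auto intro!: bigC_commute KerD_closed)

lemma carrier_G: "carrier (G X) = G_class X ` KerD X"
  by (simp add: G_def carrier_FactGroup G_class_def r_coset_def)

lemma G_class_mult:
  assumes "c \<in> KerD X" "d \<in> KerD X"
  shows "G_class X c \<otimes>\<^bsub>G X\<^esub> G_class X d = G_class X (c \<otimes>\<^bsub>bigC X\<^esub> d)"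
  using normal.rcos_sum [OF ImD'_normal_KerD, of c X d] assms
  by (simp add: G_def G_class_def r_coset_def set_mult_def)

lemma G_class_eqI:
  assumes "c \<in> carrier (bigC X)" "n \<in> ImD' X"
  shows "G_class X (n \<otimes>\<^bsub>bigC X\<^esub> c) = G_class X c"
proof -
  have "n \<otimes>\<^bsub>bigC X\<^esub> c \<in> ImD' X #>\<^bsub>bigC X\<^esub> c"
    using assms by (auto simp: r_coset_def)
  from group.repr_independence [OF group_bigC this assms(1) subgroup_ImD'] show ?thesis
    by (simp add: G_class_def)
qed

lemma G_class_self: "c \<in> carrier (bigC X) \<Longrightarrow> c \<in> G_class X c"
  using group.rcos_self [OF group_bigC _ subgroup_ImD'] by (simp add: G_class_def)

section \<open>Pullback\<close>

context
  fixes X :: "'a topology" and Y :: "'b topology" and f :: "'a \<Rightarrow> 'b"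
  assumes f: "continuous_map X Y f"
begin

lemma simplex_map_closed: "singular_simplex k X \<sigma> \<Longrightarrow> singular_simplex k Y (simplex_map k f \<sigma>)"
  by (rule singular_simplex_simplex_map [OF _ f])

lemma pull_add: "pull_cochain k X f (x +\<^bsub>k,Y\<^esub> y) = pull_cochain k X f x +\<^bsub>k,X\<^esub> pull_cochain k X f y"
  by (rule cochain_eqI [where X = X and k = k]) (simp_all add: pull_cochain_def simplex_map_closed)

lemma pull_zero: "pull_cochain k X f \<one>\<^bsub>cochains k Y\<^esub> = \<one>\<^bsub>cochains k X\<^esub>"
  by (rule cochain_eqI [where X = X and k = k]) (simp_all add: pull_cochain_def simplex_map_closed)

lemma pull_change_coefficients:
  "pull_cochain k X f (change_coefficients h k Y c) = change_coefficients h k X (pull_cochain k X f c)"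
  by (auto simp: pull_cochain_def change_coefficients_def simplex_map_closed)

lemma pull_coboundary:
  fixes c :: "('b, 'm::ab_group_add) cochain"
  shows "pull_cochain 1 X f (coboundary 0 Y c) = coboundary 0 X (pull_cochain 0 X f c)"
    "pull_cochain 2 X f (coboundary 1 Y c) = coboundary 1 X (pull_cochain 1 X f c)"
    "pull_cochain 3 X f (coboundary 2 Y c) = coboundary 2 X (pull_cochain 2 X f c)"
    "pull_cochain 4 X f (coboundary 3 Y c) = coboundary 3 X (pull_cochain 3 X f c)"
  by (rule cochain1_eqI [where X = X] cochain2_eqI [where X = X] cochain3_eqI [where X = X] cochain4_eqI [where X = X],
      simp, simp, frule simplex_map_closed, simp add: pull_cochain_on_face on_face)+

lemma pull_cup:
  fixes x y :: "('b, 'm::comm_ring_1) cochain"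
  shows "pull_cochain 1 X f (cup 0 1 Y x y) = cup 0 1 X (pull_cochain 0 X f x) (pull_cochain 1 X f y)"
    "pull_cochain 2 X f (cup 1 1 Y x y) = cup 1 1 X (pull_cochain 1 X f x) (pull_cochain 1 X f y)"
    "pull_cochain 3 X f (cup 1 2 Y x y) = cup 1 2 X (pull_cochain 1 X f x) (pull_cochain 2 X f y)"
    "pull_cochain 4 X f (cup 2 2 Y x y) = cup 2 2 X (pull_cochain 2 X f x) (pull_cochain 2 X f y)"
  by (rule cochain1_eqI [where X = X] cochain2_eqI [where X = X] cochain3_eqI [where X = X] cochain4_eqI [where X = X],
      simp, simp, frule simplex_map_closed, simp add: pull_cochain_on_face on_face)+

lemma pull_twist:
  "pull_cochain 3 X f (twist Y p a q b) =
    twist X (pull_cochain 2 X f p) (pull_cochain 1 X f a) (pull_cochain 2 X f q) (pull_cochain 1 X f b)"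
  by (rule cochain3_eqI [where X =
    X], simp, simp, frule simplex_map_closed, simp add: pull_cochain_on_face twist_on_face)

lemma pull_cocycles1:
  fixes a :: "('b, 'm::ab_group_add) cochain"
  assumes "a \<in> cocycles 1 Y"
  shows "pull_cochain 1 X f a \<in> cocycles 1 X"
proof -
  have "coboundary 1 Y a = \<one>\<^bsub>cochains 2 Y\<^esub>"
    using assms by (simp add: cocycles_def kernel_def)
  then have "coboundary 1 X (pull_cochain 1 X f a) = \<one>\<^bsub>cochains 2 X\<^esub>"
    by (metis pull_coboundary(2) pull_zero)
  then show ?thesis by (simp add: cocycles_def kernel_def)
qed

lemma pull_cocycles2:
  fixes p :: "('b, 'm::ab_group_add) cochain"
  assumes "p \<in> cocycles 2 Y"
  shows "pull_cochain 2 X f p \<in> cocycles 2 X"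
proof -
  have "coboundary 2 Y p = \<one>\<^bsub>cochains 3 Y\<^esub>"
    using assms by (simp add: cocycles_def kernel_def)
  then have "coboundary 2 X (pull_cochain 2 X f p) = \<one>\<^bsub>cochains 3 X\<^esub>"
    by (metis pull_coboundary(3) pull_zero)
  then show ?thesis by (simp add: cocycles_def kernel_def)
qed

lemma pull_cls3:
  assumes z: "z \<in> carrier (cochains 3 Y)"
  shows "the_elem ((\<lambda>y. cls3 X (pull_cochain 3 X f y)) ` cls3 Y z) = cls3 X (pull_cochain 3 X f z)"
proof -
  have "cls3 X (pull_cochain 3 X f y) = cls3 X (pull_cochain 3 X f z)" if y: "y \<in> cls3 Y z" for y
  proof -
    obtain h where "y = coboundary 2 Y h +\<^bsub>3,Y\<^esub> z"
      using y by (auto simp: cls3_def r_coset_def B3_def)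
    then have "pull_cochain 3 X f y = coboundary 2 X (pull_cochain 2 X f h) +\<^bsub>3,X\<^esub> pull_cochain 3 X f z"
      by (simp add: pull_add pull_coboundary)
    then show ?thesis
      by (subst cls3_eq_iff) auto
  qed
  moreover have "z \<in> cls3 Y z"
    using group.rcos_self [OF group_cochains z normal_imp_subgroup [OF B3_normal]] by (simp add: cls3_def)
  ultimately have "(\<lambda>y. cls3 X (pull_cochain 3 X f y)) ` cls3 Y z = {cls3 X (pull_cochain 3 X f z)}"
    by blast
  then show ?thesis by simp
qed

lemma pull_triple_eq:
  assumes "z \<in> carrier (cochains 3 Y)"
  shows "pull_triple X f (cls3 Y z, p, a) = (cls3 X (pull_cochain 3 X f z), pull_cochain 2 X f p, pull_cochain 1 X f a)"
  using pull_cls3 [OF assms] by (simp add: pull_triple_def)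

lemma pull_triple_hom: "pull_triple X f \<in> hom (bigC Y) (bigC X)"
proof (rule homI)
  fix c assume "c \<in> carrier (bigC Y)"
  then show "pull_triple X f c \<in> carrier (bigC X)"
    by (elim bigC_cases) (simp add: pull_triple_eq pull_cocycles1 pull_cocycles2)
next
  fix c d assume "c \<in> carrier (bigC Y)" "d \<in> carrier (bigC Y)"
  then show "pull_triple X f (c \<otimes>\<^bsub>bigC Y\<^esub> d) = pull_triple X f c \<otimes>\<^bsub>bigC X\<^esub> pull_triple X f d"
    by (elim bigC_cases) (simp add: pull_triple_eq bigC_mult pull_add pull_twist pull_cup)
qed

lemma pull_bigD:
  assumes "c \<in> carrier (bigC Y)"
  shows "bigD X (pull_triple X f c) = pull_cochain 4 X f (bigD Y c)"
  using assms by (elim bigC_cases) (simp add: pull_triple_eq bigD_eq pull_add pull_coboundary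
    pull_change_coefficients pull_cup)

lemma pull_bigD':
  "pull_triple X f (bigD' Y (t, x)) = bigD' X (pull_cochain 1 X f t, pull_cochain 0 X f x)"
  by (simp add: bigD'_def pull_triple_eq pull_coboundary pull_change_coefficients pull_cup)

lemma pull_ImD': "n \<in> ImD' Y \<Longrightarrow> pull_triple X f n \<in> ImD' X"
  by (auto simp: ImD'_def carrier_bigC' pull_bigD')

lemma pull_KerD:
  assumes "c \<in> KerD Y"
  shows "pull_triple X f c \<in> KerD X"
  using assms pull_bigD [of c] hom_in_carrier [OF pull_triple_hom, of c]
  by (simp add: KerD_def kernel_def pull_zero)

lemma G_map_class:
  assumes c: "c \<in> KerD Y"
  shows "G_map X f (G_class Y c) = G_class X (pull_triple X f c)"
proof -
  have cY: "c \<in> carrier (bigC Y)" by (rule KerD_closed [OF c])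
  have "G_class X (pull_triple X f d) = G_class X (pull_triple X f c)" if "d \<in> G_class Y c" for d
  proof -
    obtain n where n: "n \<in> ImD' Y" "d = n \<otimes>\<^bsub>bigC Y\<^esub> c"
      using \<open>d \<in> G_class Y c\<close> by (auto simp: G_class_def r_coset_def)
    then have "pull_triple X f d = pull_triple X f n \<otimes>\<^bsub>bigC X\<^esub> pull_triple X f c"
      using hom_mult [OF pull_triple_hom _ cY] subgroup.mem_carrier [OF subgroup_ImD'] by blast
    then show ?thesis
      using G_class_eqI [OF hom_in_carrier [OF pull_triple_hom cY] pull_ImD' [OF n(1)]] by simp
  qed
  then have "(\<lambda>d. G_class X (pull_triple X f d)) ` G_class Y c = {G_class X (pull_triple X f c)}"
    using G_class_self [OF cY] by blast
  then show ?thesis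
    by (simp add: G_map_def)
qed

lemma continuous_map_pull_cochain:
  "continuous_map (cochain_topology k Y) (cochain_topology k X) (pull_cochain k X f)"
  unfolding continuous_map_into_cochains
proof (intro conjI allI impI)
  fix \<sigma> assume \<sigma>: "singular_simplex k X \<sigma>"
  then show "continuous_map (cochain_topology k Y) euclidean (\<lambda>x. pull_cochain k X f x \<sigma>)"
    using continuous_map_cochain_apply [OF continuous_map_id simplex_map_closed [OF \<sigma>]]
    by (simp add: pull_cochain_def)
qed auto

lemma continuous_map_pull_triple: "continuous_map (bigC_topology Y) (bigC_topology X) (pull_triple X f)"
proof -
  let ?T = "bigC_topology Y"
  have "continuous_map ?T ?T (\<lambda>c. c)" by simp
  then have w: "continuous_map ?T (quotient_topology (cochain_topology 3 Y) (cls3 Y)) (\<lambda>c. fst c)"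
    and p: "continuous_map ?T (cochain_topology 2 Y) (\<lambda>c. fst (snd c))"
    and a: "continuous_map ?T (cochain_topology 1 Y) (\<lambda>c. snd (snd c))"
    and into: "\<forall>c\<in>topspace ?T. fst (snd c) \<in> cocycles 2 Y" "\<forall>c\<in>topspace ?T. snd (snd c) \<in> cocycles 1 Y"
    unfolding continuous_map_into_bigC by auto
  have "continuous_map (cochain_topology 3 Y) (quotient_topology (cochain_topology 3 X) (cls3 X))
      (\<lambda>z. the_elem ((\<lambda>y. cls3 X (pull_cochain 3 X f y)) ` cls3 Y z))"
    by (rule continuous_map_eq [OF continuous_map_cls3 [OF continuous_map_pull_cochain]]) (simp add: pull_cls3)
  then have "continuous_map (quotient_topology (cochain_topology 3 Y) (cls3 Y)) (quotient_topology
    (cochain_topology 3 X) (cls3 X))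
      (\<lambda>w. the_elem ((\<lambda>y. cls3 X (pull_cochain 3 X f y)) ` w))"
    by (rule continuous_map_through_quotient)
  then have "continuous_map ?T (quotient_topology (cochain_topology 3 X) (cls3 X))
      (\<lambda>c. the_elem ((\<lambda>y. cls3 X (pull_cochain 3 X f y)) ` fst c))"
    using continuous_map_compose [OF w] by (simp add: o_def)
  then show ?thesis
    unfolding continuous_map_into_bigC
    using continuous_map_compose [OF p continuous_map_pull_cochain]
      continuous_map_compose [OF a continuous_map_pull_cochain] into
    by (auto simp: pull_triple_def case_prod_unfold o_def intro: pull_cocycles1 pull_cocycles2)
qed

lemma G_map_continuous_hom: "G_map X f \<in> continuous_hom (G Y) (G_topology Y) (G X) (G_topology X)"
proof -
  have "G_map X f \<in> hom (G Y) (G X)"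
  proof (rule homI)
    fix \<xi> assume "\<xi> \<in> carrier (G Y)"
    then show "G_map X f \<xi> \<in> carrier (G X)"
      by (auto simp: carrier_G G_map_class pull_KerD)
  next
    fix \<xi> \<eta> assume "\<xi> \<in> carrier (G Y)" "\<eta> \<in> carrier (G Y)"
    then obtain c d where "\<xi> = G_class Y c" "c \<in> KerD Y" "\<eta> = G_class Y d" "d \<in> KerD Y"
      by (auto simp: carrier_G)
    then show "G_map X f (\<xi> \<otimes>\<^bsub>G Y\<^esub> \<eta>) = G_map X f \<xi> \<otimes>\<^bsub>G X\<^esub> G_map X f \<eta>"
      using hom_mult [OF pull_triple_hom]
      by (simp add: G_class_mult G_map_class pull_KerD KerD_closed subgroup.m_closed [OF subgroup_KerD])
  qed
  moreover have "continuous_map (G_topology Y) (G_topology X) (G_map X f)"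
    unfolding G_topology_def [of Y]
  proof (rule continuous_map_through_quotient)
    let ?K = "\<lambda>X. subtopology (bigC_topology X) (KerD X)"
    have "continuous_map (?K Y) (?K X) (pull_triple X f)"
      by (auto simp: continuous_map_in_subtopology pull_KerD intro: continuous_map_from_subtopology
        continuous_map_pull_triple)
    moreover have "continuous_map (subtopology (bigC_topology X) (KerD X)) (G_topology X) (G_class X)"
      unfolding G_topology_def by (rule quotient_imp_continuous_map [OF quotient_map_quotient_topology])
    ultimately have "continuous_map (?K Y) (G_topology X) (\<lambda>c. G_class X (pull_triple X f c))"
      using continuous_map_compose by (fastforce simp: o_def)
    then show "continuous_map (?K Y) (G_topology X) (\<lambda>c. G_map X f (G_class Y c))"
      by (rule continuous_map_eq) (simp add: G_map_class)
  qed
  ultimately show ?thesis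
    by (simp add: continuous_hom_def)
qed

end

lemma pull_cochain_compose:
  assumes "continuous_map X Y f"
  shows "pull_cochain k X (g \<circ> f) c = pull_cochain k X f (pull_cochain k Y g c)"
  using simplex_map_closed [OF assms] by (auto simp: pull_cochain_def simplex_map_compose)

lemma pull_triple_compose:
  assumes f: "continuous_map X Y f" and g: "continuous_map Y Z g" and c: "c \<in> carrier (bigC Z)"
  shows "pull_triple X (g \<circ> f) c = pull_triple X f (pull_triple Y g c)"
  using c by (elim bigC_cases)
    (simp add: pull_triple_eq [OF f] pull_triple_eq [OF g] pull_triple_eq [OF continuous_map_compose [OF f g]]
      pull_cochain_compose [OF f])

lemma pull_cochain_id:
  assumes "c \<in> carrier (cochains k X)"
  shows "pull_cochain k X id c = c"
proof (rule cochain_eqI [OF _ assms])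
  fix \<sigma> assume \<sigma>: "singular_simplex k X \<sigma>"
  then have "simplex_map k id \<sigma> = \<sigma>"
    by (rule simplex_map_id_gen) simp
  then show "pull_cochain k X id c \<sigma> = c \<sigma>"
    using \<sigma> by (simp only: pull_cochain_def) simp
qed simp

lemma pull_triple_id:
  assumes "c \<in> carrier (bigC X)"
  shows "pull_triple X id c = c"
  using assms by (elim bigC_cases) (simp add: pull_triple_eq [OF continuous_map_id] pull_cochain_id cocycles_closed)

lemma G_map_compose:
  assumes "continuous_map X Y f" "continuous_map Y Z g" "\<xi> \<in> carrier (G Z)"
  shows "G_map X (g \<circ> f) \<xi> = G_map X f (G_map Y g \<xi>)"
  using assms by (auto simp: carrier_G G_map_class continuous_map_compose pull_KerD pull_triple_compose KerD_closed)

lemma G_map_id: "\<xi> \<in> carrier (G X) \<Longrightarrow> G_map X id \<xi> = \<xi>"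
  by (auto simp: carrier_G G_map_class [OF continuous_map_id] pull_triple_id KerD_closed)

section \<open>Homotopic maps on cocycles\<close>

text \<open>A list of pairs describes an affine simplex in the prism over a simplex: \<open>(i, False)\<close> is the vertex
  \<open>i\<close> of the bottom and \<open>(i, True)\<close> the vertex above it. The height of a point is its coordinate in
  the direction of the interval.\<close>

definition height :: "(nat \<times> bool) list \<Rightarrow> (nat \<Rightarrow> real) \<Rightarrow> real" where
  "height ws t = (\<Sum>j<length ws. of_bool (snd (ws ! j)) * t j)"

text \<open>The restriction of the homotopy \<open>F\<close>, along \<open>\<sigma>\<close>, to the affine simplex with vertices \<open>ws\<close>.\<close>

definition prism_simplex ::
    "(real \<times> 'a \<Rightarrow> 'b) \<Rightarrow> (nat \<times> bool) list \<Rightarrow> ((nat \<Rightarrow> real) \<Rightarrow> 'a) \<Rightarrow> (nat \<Rightarrow> real) \<Rightarrow> 'b" where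
  "prism_simplex F ws \<sigma> = (\<lambda>t\<in>standard_simplex (length ws - 1). F (height ws t, \<sigma> (push (map fst ws) t)))"

lemma height_push:
  assumes "set us \<subseteq> {..<length ws}"
  shows "height ws (push us t) = height (map ((!) ws) us) t"
  using sum_push [OF assms, of "\<lambda>j. of_bool (snd (ws ! j))" t] by (simp add: height_def)

lemma height_in_01:
  assumes "t \<in> standard_simplex (length ws - 1)" "ws \<noteq> []"
  shows "height ws t \<in> {0..1}"
proof -
  have *: "{..length ws - 1} = {..<length ws}"
    using assms by (cases ws) (simp_all add: lessThan_Suc_atMost)
  have t: "t j \<ge> 0" "sum t {..<length ws} = 1" for j
    using assms * by (auto simp: standard_simplex_def)
  have "height ws t \<le> (\<Sum>j<length ws. t j)"
    unfolding height_def by (rule sum_mono) (simp add: t)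
  moreover have "height ws t \<ge> 0"
    unfolding height_def by (rule sum_nonneg) (simp add: t)
  ultimately show ?thesis
    using t by simp
qed

lemma singular_simplex_prism_simplex:
  assumes \<sigma>: "singular_simplex n X \<sigma>" and ws: "fst ` set ws \<subseteq> {..n}" "length ws = Suc k"
    and F: "continuous_map (prod_topology (top_of_set {0..1::real}) X) Y F"
  shows "singular_simplex k Y (prism_simplex F ws \<sigma>)"
proof -
  let ?S = "\<lambda>k. subtopology (powertop_real UNIV) (standard_simplex k)"
  have ws': "ws \<noteq> []" "length ws - 1 = k" "map fst ws \<noteq> []" using ws by auto
  have "continuous_map (powertop_real UNIV) euclideanreal (height ws)"
    unfolding height_def [abs_def]
    by (intro continuous_map_sum continuous_map_real_mult) (auto intro: continuous_map_product_projection)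
  then have "continuous_map (?S k) (top_of_set {0..1::real}) (height ws)"
    using height_in_01 ws' by (auto simp: continuous_map_in_subtopology continuous_map_from_subtopology)
  moreover have "continuous_map (?S k) X (\<lambda>t. \<sigma> (push (map fst ws) t))"
    using continuous_map_compose [OF continuous_map_push [of "map fst ws" n], of X \<sigma>] \<sigma> ws ws'
    by (simp add: singular_simplex_def o_def)
  ultimately have "continuous_map (?S k) Y (\<lambda>t. F (height ws t, \<sigma> (push (map fst ws) t)))"
    using continuous_map_compose [OF continuous_map_pairedI F] by (fastforce simp: o_def)
  then have "continuous_map (?S k) Y (prism_simplex F ws \<sigma>)"
    by (rule continuous_map_eq) (simp add: prism_simplex_def ws')
  then show ?thesis
    using ws' by (simp add: singular_simplex_def prism_simplex_def)
qed

lemma subsimplex_prism_simplex: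
  assumes "set us \<subseteq> {..<length ws}" "us \<noteq> []"
  shows "subsimplex us (prism_simplex F ws \<sigma>) = prism_simplex F (map ((!) ws) us) \<sigma>"
proof -
  have ws: "ws \<noteq> []" using assms by (cases us) auto
  then have "set us \<subseteq> {..length ws - 1}"
    using assms by (cases ws) (auto simp: lessThan_Suc_atMost)
  then have "push us t \<in> standard_simplex (length ws - 1)" if "t \<in> standard_simplex (length us - 1)" for t
    using push_in_standard_simplex assms that by blast
  moreover have "map ((!) (map fst ws)) us = map fst (map ((!) ws) us)"
    using assms by (auto simp: subset_iff)
  then have "push (map fst ws) (push us t) = push (map fst (map ((!) ws) us)) t" for t
    using push_push [of us "map fst ws" t] assms by (simp only: length_map)
  ultimately show ?thesis
    using assms ws by (auto simp: subsimplex_eq prism_simplex_def height_push simp del: map_map intro!: restrict_ext)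
qed

lemma prism_simplex_subsimplex:
  assumes "fst ` set ws \<subseteq> {..<length vs}" "ws \<noteq> []"
  shows "prism_simplex F ws (subsimplex vs \<sigma>) = prism_simplex F (map (\<lambda>(i, e). (vs ! i, e)) ws) \<sigma>"
proof -
  have vs: "vs \<noteq> []" using assms by (cases ws) auto
  then have "set (map fst ws) \<subseteq> {..length vs - 1}"
    using assms by (cases vs) (auto simp: lessThan_Suc_atMost)
  then have "push (map fst ws) t \<in> standard_simplex (length vs - 1)" if "t \<in> standard_simplex (length ws - 1)" for t
    using push_in_standard_simplex [of "map fst ws" _ t] assms that by simp
  moreover have "height (map (\<lambda>(i, e). (vs ! i, e)) ws) t = height ws t" for t
    by (simp add: height_def case_prod_unfold)
  moreover have "map ((!) vs) (map fst ws) = map fst (map (\<lambda>(i, e). (vs ! i, e)) ws)"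
    by (simp add: case_prod_unfold)
  then have "push vs (push (map fst ws) t) = push (map fst (map (\<lambda>(i, e). (vs ! i, e)) ws)) t" for t
    using push_push [of "map fst ws" vs t] assms by (simp only: set_map)
  ultimately show ?thesis
    using vs by (auto simp: subsimplex_eq prism_simplex_def)
qed

lemma prism_simplex_ends:
  assumes \<sigma>: "singular_simplex n X \<sigma>"
  shows "prism_simplex F (map (\<lambda>j. (j, False)) [0..<Suc n]) \<sigma> = simplex_map n (\<lambda>x. F (0, x)) \<sigma>"
    and "prism_simplex F (map (\<lambda>j. (j, True)) [0..<Suc n]) \<sigma> = simplex_map n (\<lambda>x. F (1, x)) \<sigma>"
proof -
  have "height (map (\<lambda>j. (j, False)) [0..<Suc n]) t = 0" for t
    unfolding height_def by (rule sum.neutral) (simp del: upt_Suc)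
  then show "prism_simplex F (map (\<lambda>j. (j, False)) [0..<Suc n]) \<sigma> = simplex_map n (\<lambda>x. F (0, x)) \<sigma>"
    by (auto simp: prism_simplex_def simplex_map_def push_upt o_def comp_def simp del: upt_Suc)
  have "height (map (\<lambda>j. (j, True)) [0..<Suc n]) t = 1" if "t \<in> standard_simplex n" for t
  proof -
    have "height (map (\<lambda>j. (j, True)) [0..<Suc n]) t = (\<Sum>j<Suc n. t j)"
      unfolding height_def by (rule sum.cong) (simp_all del: upt_Suc)
    then show ?thesis
      using that by (simp add: standard_simplex_def lessThan_Suc_atMost del: sum.lessThan_Suc)
  qed
  then show "prism_simplex F (map (\<lambda>j. (j, True)) [0..<Suc n]) \<sigma> = simplex_map n (\<lambda>x. F (1, x)) \<sigma>"
    by (auto simp: prism_simplex_def simplex_map_def push_upt o_def comp_def simp del: upt_Suc)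
qed

text \<open>The \<open>i\<close>-th simplex of the standard triangulation of the prism: it runs along the bottom from \<open>0\<close> to
  \<open>i\<close> and along the top from \<open>i\<close> to \<open>n\<close>.\<close>

definition prism_vertices :: "nat \<Rightarrow> nat \<Rightarrow> (nat \<times> bool) list" where
  "prism_vertices n i = map (\<lambda>j. if j \<le> i then (j, False) else (j - 1, True)) [0..<Suc (Suc n)]"

definition prism_face :: "nat \<Rightarrow> nat \<Rightarrow> nat \<Rightarrow> (nat \<times> bool) list" where
  "prism_face n i m = map ((!) (prism_vertices n i)) (omit (Suc n) m)"

lemma omit_nth: "j < n \<Longrightarrow> omit n m ! j = (if j < m then j else Suc j)"
  and length_omit [simp]: "length (omit n m) = n"
  by (simp_all add: omit_def)

lemma prism_vertices_nth:
  "j < Suc (Suc n) \<Longrightarrow> prism_vertices n i ! j = (if j \<le> i then (j, False) else (j - 1, True))"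
  by (simp add: prism_vertices_def del: upt_Suc)

lemma length_prism_vertices [simp]: "length (prism_vertices n i) = Suc (Suc n)"
  by (simp add: prism_vertices_def)

lemma prism_face_nth:
  "j < Suc n \<Longrightarrow> prism_face n i m ! j =
     (if (if j < m then j else Suc j) \<le> i then (if j < m then j else Suc j, False)
      else ((if j < m then j else Suc j) - 1, True))"
  by (simp add: prism_face_def omit_nth prism_vertices_nth)

lemma length_prism_face [simp]: "length (prism_face n i m) = Suc n"
  by (simp add: prism_face_def)

lemma prism_face_shared: "prism_face n i (Suc i) = prism_face n (Suc i) (Suc i)"
  by (rule nth_equalityI) (auto simp: prism_face_nth)

lemma prism_face_ends:
  "prism_face n 0 0 = map (\<lambda>j. (j, True)) [0..<Suc n]"
  "prism_face n n (Suc n) = map (\<lambda>j. (j, False)) [0..<Suc n]"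
  by (rule nth_equalityI; simp add: prism_face_nth del: upt_Suc)+

lemma prism_vertices_of_face:
  assumes "i \<le> k"
  shows "map (\<lambda>(v, e). (omit (Suc k) m ! v, e)) (prism_vertices k i) =
    (if m \<le> i then prism_face (Suc k) (Suc i) m else prism_face (Suc k) i (Suc m))"
  by (rule nth_equalityI) (use assms in \<open>auto simp: prism_face_nth prism_vertices_nth omit_nth\<close>)

definition alternate :: "nat \<Rightarrow> 'm::ab_group_add \<Rightarrow> 'm" where
  "alternate k x = (if even k then x else - x)"

lemma alternate_Suc: "alternate (Suc k) x = - alternate k x"
  by (simp add: alternate_def)

text \<open>The value \<open>x i m\<close> is that of a cochain on the \<open>m\<close>-th face of the \<open>i\<close>-th simplex of the prism. Two
  consecutive simplices share a face, so the terms with \<open>m = i\<close> or \<open>m = i + 1\<close> telescope, leaving the top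
  and the bottom; all other faces belong to the prism over the boundary.\<close>

lemma prism_sum:
  assumes "\<And>i. i < n \<Longrightarrow> x i (Suc i) = x (Suc i) (Suc i)"
  shows "(\<Sum>i\<le>n. \<Sum>m\<le>Suc n. alternate (i + m) (x i m)) = x 0 0 - x n (Suc n) -
    (\<Sum>m\<le>n. \<Sum>i<n. alternate (i + m) (if m \<le> i then x (Suc i) m else x i (Suc m)))"
  using assms
proof (induction n)
  case 0
  show ?case by (simp add: alternate_def One_nat_def)
next
  case (Suc n)
  let ?y = "\<lambda>m i. alternate (i + m) (if m \<le> i then x (Suc i) m else x i (Suc m))"
  have IH: "(\<Sum>i\<le>n. \<Sum>m\<le>Suc n. alternate (i + m) (x i m)) = x 0 0 - x n (Suc n) - (\<Sum>m\<le>n. \<Sum>i<n. ?y m i)"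
    using Suc by simp
  have "(\<Sum>i\<le>Suc n. \<Sum>m\<le>Suc (Suc n). alternate (i + m) (x i m)) =
      (\<Sum>i\<le>n. \<Sum>m\<le>Suc n. alternate (i + m) (x i m)) + (\<Sum>i\<le>n. alternate (i + Suc (Suc n)) (x i (Suc (Suc n))))
      + (\<Sum>m\<le>Suc (Suc n). alternate (Suc n + m) (x (Suc n) m))"
    by (simp add: sum.distrib)
  moreover have "(\<Sum>m\<le>Suc (Suc n). alternate (Suc n + m) (x (Suc n) m)) =
      - (\<Sum>m\<le>n. alternate (n + m) (x (Suc n) m)) + x (Suc n) (Suc n) - x (Suc n) (Suc (Suc n))"
    by (simp add: alternate_Suc sum_negf) (simp add: alternate_def)
  moreover have "(\<Sum>i\<le>n. alternate (i + Suc (Suc n)) (x i (Suc (Suc n)))) =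
      (\<Sum>i<n. alternate (i + n) (x i (Suc (Suc n)))) + x n (Suc (Suc n))"
    by (simp add: alternate_Suc lessThan_Suc_atMost [symmetric]) (simp add: alternate_def)
  moreover have "(\<Sum>m\<le>Suc n. \<Sum>i<Suc n. ?y m i) = (\<Sum>m\<le>n. \<Sum>i<n. ?y m i) + (\<Sum>m\<le>n. ?y m n) + (\<Sum>i<n. ?y (Suc n) i) +
    ?y (Suc n) n"
    by (simp add: sum.distrib)
  moreover have "(\<Sum>m\<le>n. ?y m n) = (\<Sum>m\<le>n. alternate (n + m) (x (Suc n) m))"
    by (rule sum.cong) auto
  moreover have "(\<Sum>i<n. ?y (Suc n) i) = - (\<Sum>i<n. alternate (i + n) (x i (Suc (Suc n))))"
    unfolding sum_negf [symmetric] by (rule sum.cong) (auto simp: alternate_Suc)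
  moreover have "?y (Suc n) n = - x n (Suc (Suc n))"
    by (simp add: alternate_def)
  moreover have "x n (Suc n) = x (Suc n) (Suc n)"
    using Suc.prems by simp
  ultimately show ?case
    using IH by simp
qed

lemma homotopic_pullbacks_cohomologous:
  fixes X :: "'a topology" and Y :: "'b topology" and z :: "('b, 'm::ab_group_add) cochain"
  assumes F: "continuous_map (prod_topology (top_of_set {0..1::real}) X) Y F" and z: "z \<in> cocycles (Suc k) Y"
  shows "\<exists>h \<in> carrier (cochains k X). pull_cochain (Suc k) X (\<lambda>x. F (1, x)) z =
     coboundary k X h +\<^bsub>Suc k,X\<^esub> pull_cochain (Suc k) X (\<lambda>x. F (0, x)) z"
proof -
  let ?n = "Suc k"
  define h where "h = (\<lambda>\<tau>\<in>singular_simplex_set k X. \<Sum>i\<le>k. alternate i (z (prism_simplex F (prism_vertices k i) \<tau>)))"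
  have "pull_cochain ?n X (\<lambda>x. F (1, x)) z = coboundary k X h +\<^bsub>?n,X\<^esub> pull_cochain ?n X (\<lambda>x. F (0, x)) z"
  proof (rule cochain_eqI [where k = ?n and X = X])
    fix \<sigma> assume \<sigma>: "singular_simplex ?n X \<sigma>"
    define x where "x i m = z (prism_simplex F (prism_face ?n i m) \<sigma>)" for i m
    have "(\<Sum>m\<le>Suc ?n. alternate (i + m) (x i m)) = 0" if i: "i \<le> ?n" for i
    proof -
      let ?\<rho> = "prism_simplex F (prism_vertices ?n i) \<sigma>"
      have "fst ` set (prism_vertices ?n i) \<subseteq> {..?n}"
        using i by (auto simp: prism_vertices_def simp del: upt_Suc)
      then have \<rho>: "singular_simplex (Suc ?n) Y ?\<rho>"
        by (intro singular_simplex_prism_simplex [OF \<sigma> _ _ F]) auto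
      have "singular_face (Suc ?n) m ?\<rho> = prism_simplex F (prism_face ?n i m) \<sigma>" if "m \<le> Suc ?n" for m
      proof -
        have "set (omit (Suc ?n) m) \<subseteq> {..<length (prism_vertices ?n i)}"
          by (auto simp: omit_def simp del: upt_Suc)
        moreover have "omit (Suc ?n) m \<noteq> []"
          by (simp add: omit_def)
        ultimately show ?thesis
          using that by (simp add: singular_face_eq_subsimplex subsimplex_prism_simplex prism_face_def)
      qed
      then have "coboundary ?n Y z ?\<rho> = (\<Sum>m\<le>Suc ?n. alternate m (x i m))"
        using \<rho> unfolding coboundary_def x_def alternate_def by (auto intro!: sum.cong simp del: sum.atMost_Suc)
      then have "(\<Sum>m\<le>Suc ?n. alternate m (x i m)) = 0"
        using z \<rho> by (simp add: cocycles_iff del: sum.atMost_Suc)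
      moreover have "(\<Sum>m\<le>Suc ?n. alternate (i + m) (x i m)) = alternate i (\<Sum>m\<le>Suc ?n. alternate m (x i m))"
        by (auto simp: alternate_def sum_negf [symmetric] simp del: sum.atMost_Suc intro!: sum.cong)
      ultimately show ?thesis
        by (simp add: alternate_def)
    qed
    then have "(\<Sum>i\<le>?n. \<Sum>m\<le>Suc ?n. alternate (i + m) (x i m)) = 0"
      by (intro sum.neutral) simp
    moreover have "x i (Suc i) = x (Suc i) (Suc i)" for i
      by (simp add: x_def prism_face_shared)
    ultimately have "x 0 0 - x ?n (Suc ?n) =
        (\<Sum>m\<le>?n. \<Sum>i<?n. alternate (i + m) (if m \<le> i then x (Suc i) m else x i (Suc m)))"
      using prism_sum [of ?n x] by simp
    also have "\<dots> = (\<Sum>m\<le>?n. alternate m (h (singular_face ?n m \<sigma>)))"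
    proof (rule sum.cong [OF refl])
      fix m assume "m \<in> {..?n}"
      then have m: "m \<le> ?n" by simp
      have face: "singular_simplex k X (singular_face ?n m \<sigma>)"
        using singular_simplex_singular_face [OF \<sigma> _ m] by (simp add: One_nat_def)
      have "prism_simplex F (prism_vertices k i) (singular_face ?n m \<sigma>) =
          prism_simplex F (if m \<le> i then prism_face ?n (Suc i) m else prism_face ?n i (Suc m)) \<sigma>" if "i \<le> k" for i
      proof -
        have "fst ` set (prism_vertices k i) \<subseteq> {..<length (omit ?n m)}"
          using that by (auto simp: prism_vertices_def simp del: upt_Suc)
        moreover have "prism_vertices k i \<noteq> []"
          by (simp add: prism_vertices_def)
        ultimately have "prism_simplex F (prism_vertices k i) (subsimplex (omit ?n m) \<sigma>) =
            prism_simplex F (map (\<lambda>(v, e). (omit ?n m ! v, e)) (prism_vertices k i)) \<sigma>"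
          by (rule prism_simplex_subsimplex)
        then show ?thesis
          by (simp only: singular_face_eq_subsimplex [OF m] prism_vertices_of_face [OF that])
      qed
      then have "h (singular_face ?n m \<sigma>) = (\<Sum>i\<le>k. alternate i (if m \<le> i then x (Suc i) m else x i (Suc m)))"
        using face by (auto simp: h_def x_def intro!: sum.cong)
      then have "alternate m (h (singular_face ?n m \<sigma>)) =
          (\<Sum>i\<le>k. alternate (i + m) (if m \<le> i then x (Suc i) m else x i (Suc m)))"
        by (auto simp: alternate_def sum_negf [symmetric] intro!: sum.cong)
      then show "(\<Sum>i<?n. alternate (i + m) (if m \<le> i then x (Suc i) m else x i (Suc m))) =
          alternate m (h (singular_face ?n m \<sigma>))"
        by (simp only: lessThan_Suc_atMost)
    qed
    also have "\<dots> = coboundary k X h \<sigma>"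
      using \<sigma> by (simp add: coboundary_def alternate_def del: sum.atMost_Suc)
    finally have "x 0 0 = coboundary k X h \<sigma> + x ?n (Suc ?n)"
      by (simp add: diff_eq_eq)
    then show "pull_cochain ?n X (\<lambda>x. F (1, x)) z \<sigma> = (coboundary k X h +\<^bsub>?n,X\<^esub> pull_cochain ?n X (\<lambda>x. F (0, x)) z) \<sigma>"
      using \<sigma> by (simp only: x_def prism_face_ends prism_simplex_ends [OF \<sigma>]) (simp add: pull_cochain_def)
  qed simp_all
  moreover have "h \<in> carrier (cochains k X)"
    by (simp add: h_def)
  ultimately show ?thesis by blast
qed

section \<open>Homotopy invariance of G\<close>

lemma bigD'_trivial:
  assumes "coboundary 1 X t = \<one>\<^bsub>cochains 2 X\<^esub>" "coboundary 0 X x = \<one>\<^bsub>cochains 1 X\<^esub>"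
  shows "bigD' X (t, x) = \<one>\<^bsub>bigC (X :: 'a topology)\<^esub>"
proof -
  have "change_coefficients half 3 X (cup 1 2 X t \<one>\<^bsub>cochains 2 X\<^esub>) = \<one>\<^bsub>cochains 3 X\<^esub>"
    by (rule cochain3_eqI [where X = X]) (simp_all add: on_face)
  then show ?thesis
    using assms by (simp add: bigD'_def bigC_one)
qed

text \<open>The element \<open>D'(0, x)\<close> with \<open>dx = a\<close> is killed by \<open>r\<^sup>*\<close>, since \<open>d(r\<^sup>*x) = r\<^sup>*a = 0\<close>; so it can be split
  off without destroying the hypothesis on \<open>c\<close>, and similarly \<open>D'(s, 0)\<close> with \<open>ds = p\<close>. There remains an
  element \<open>(w, 0, 0)\<close> in the kernel of \<open>D\<close>, which means \<open>dw = 0\<close>.\<close>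

lemma KerD_trivial_of_retraction:
  fixes W :: "'a topology"
  assumes r: "continuous_map W W r"
    and coh1: "\<And>a :: ('a, bit) cochain. a \<in> cocycles 1 W \<Longrightarrow>
      \<exists>x\<in>carrier (cochains 0 W). a = coboundary 0 W x +\<^bsub>1,W\<^esub> pull_cochain 1 W r a"
    and coh2: "\<And>p :: ('a, bit) cochain. p \<in> cocycles 2 W \<Longrightarrow>
      \<exists>t\<in>carrier (cochains 1 W). p = coboundary 1 W t +\<^bsub>2,W\<^esub> pull_cochain 2 W r p"
    and coh3: "\<And>z :: ('a, real_mod_int) cochain. z \<in> cocycles 3 W \<Longrightarrow>
      \<exists>h\<in>carrier (cochains 2 W). z = coboundary 2 W h +\<^bsub>3,W\<^esub> pull_cochain 3 W r z"
    and c: "c \<in> KerD W" and rc: "pull_triple W r c = \<one>\<^bsub>bigC W\<^esub>"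
  shows "c \<in> ImD' W"
proof -
  interpret C: group "bigC W" by (rule group_bigC)
  have r_one: "x +\<^bsub>k,W\<^esub> \<one>\<^bsub>cochains k W\<^esub> = x" "\<one>\<^bsub>cochains k W\<^esub> +\<^bsub>k,W\<^esub> x = x" if "x \<in> carrier (cochains k W)"
    for k and x :: "('a, 'm::ab_group_add) cochain"
    using that group.is_monoid [OF group_cochains] monoid.r_one monoid.l_one by metis+
  have hom: "pull_triple W r (c \<otimes>\<^bsub>bigC W\<^esub> d) = pull_triple W r c \<otimes>\<^bsub>bigC W\<^esub> pull_triple W r d"
    if "c \<in> carrier (bigC W)" "d \<in> carrier (bigC W)" for c d
    using hom_mult [OF pull_triple_hom [OF r]] that by blast
  \<comment> \<open>An element of the image of D' that is killed by the retraction can be split off.\<close>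
  have split: "\<exists>d. d \<in> KerD W \<and> pull_triple W r d = \<one>\<^bsub>bigC W\<^esub> \<and> c = n \<otimes>\<^bsub>bigC W\<^esub> d"
    if "c \<in> KerD W" "pull_triple W r c = \<one>\<^bsub>bigC W\<^esub>" "n \<in> ImD' W" "pull_triple W r n = \<one>\<^bsub>bigC W\<^esub>" for c n
  proof -
    have n: "n \<in> KerD W" and nC: "n \<in> carrier (bigC W)" and cC: "c \<in> carrier (bigC W)"
      using that ImD'_subset_KerD KerD_closed by blast+
    let ?d = "inv\<^bsub>bigC W\<^esub> n \<otimes>\<^bsub>bigC W\<^esub> c"
    have "?d \<in> KerD W"
      using subgroup.m_closed [OF subgroup_KerD] subgroup.m_inv_closed [OF subgroup_KerD] n that(1) by blast
    moreover have "c = n \<otimes>\<^bsub>bigC W\<^esub> ?d"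
      using nC cC by (simp add: C.m_assoc [symmetric])
    moreover from this have "pull_triple W r ?d = \<one>\<^bsub>bigC W\<^esub>"
      using hom [OF nC, of ?d] that(2,4) hom_in_carrier [OF pull_triple_hom [OF r], of ?d] nC cC by simp
    ultimately show ?thesis by blast
  qed
  obtain w p a where c_eq: "c = (cls3 W w, p, a)" and w: "w \<in> carrier (cochains 3 W)"
    and p: "p \<in> cocycles 2 W" and a: "a \<in> cocycles 1 W"
    using bigC_cases [OF KerD_closed [OF c]] by blast
  have ra: "pull_cochain 1 W r a = \<one>\<^bsub>cochains 1 W\<^esub>"
    using rc w by (simp add: c_eq pull_triple_eq [OF r] bigC_one)
  obtain x where x: "x \<in> carrier (cochains 0 W)" "a = coboundary 0 W x"
    using coh1 [OF a] by (auto simp: ra r_one)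
  define n1 where "n1 = bigD' W (\<one>\<^bsub>cochains 1 W\<^esub>, x)"
  have n1: "n1 \<in> ImD' W"
    using x by (auto simp: n1_def ImD'_def carrier_bigC')
  have d0: "coboundary 1 W (\<one>\<^bsub>cochains 1 W\<^esub> :: ('a, bit) cochain) = \<one>\<^bsub>cochains 2 W\<^esub>"
    "coboundary 0 W (\<one>\<^bsub>cochains 0 W\<^esub> :: ('a, bit) cochain) = \<one>\<^bsub>cochains 1 W\<^esub>"
    using zero_cocycles [of 1 W] zero_cocycles [of 0 W] by (simp_all add: cocycles_def kernel_def
      One_nat_def [symmetric])
  have rn1: "pull_triple W r n1 = \<one>\<^bsub>bigC W\<^esub>"
    unfolding n1_def pull_bigD' [OF r]
    using ra x by (intro bigD'_trivial) (simp_all add: pull_zero [OF r] d0 pull_coboundary(1) [OF r, symmetric])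
  obtain c1 where c1: "c1 \<in> KerD W" "pull_triple W r c1 = \<one>\<^bsub>bigC W\<^esub>" "c = n1 \<otimes>\<^bsub>bigC W\<^esub> c1"
    using split [OF c rc n1 rn1] by blast
  obtain w1 p1 a1 where c1_eq: "c1 = (cls3 W w1, p1, a1)" and w1: "w1 \<in> carrier (cochains 3 W)"
    and p1: "p1 \<in> cocycles 2 W" and a1: "a1 \<in> cocycles 1 W"
    using bigC_cases [OF KerD_closed [OF c1(1)]] by blast
  have "a = coboundary 0 W x +\<^bsub>1,W\<^esub> a1"
    using c1(3) w1 by (simp add: c_eq c1_eq n1_def bigD'_def bigC_mult)
  then have a1_zero: "a1 = \<one>\<^bsub>cochains 1 W\<^esub>"
    using group.l_cancel_one' [OF group_cochains, of a 1 W a1] a a1 x(2) by (simp add: cocycles_closed)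
  have rp1: "pull_cochain 2 W r p1 = \<one>\<^bsub>cochains 2 W\<^esub>"
    using c1(2) w1 by (simp add: c1_eq pull_triple_eq [OF r] bigC_one)
  obtain s where s: "s \<in> carrier (cochains 1 W)" "p1 = coboundary 1 W s"
    using coh2 [OF p1] by (auto simp: rp1 r_one)
  define n2 where "n2 = bigD' W (s, \<one>\<^bsub>cochains 0 W\<^esub>)"
  have n2: "n2 \<in> ImD' W"
    using s by (auto simp: n2_def ImD'_def carrier_bigC')
  have rn2: "pull_triple W r n2 = \<one>\<^bsub>bigC W\<^esub>"
    unfolding n2_def pull_bigD' [OF r]
    using rp1 s by (intro bigD'_trivial) (simp_all add: pull_zero [OF r] d0 pull_coboundary(2) [OF r, symmetric])
  obtain c2 where c2: "c2 \<in> KerD W" "pull_triple W r c2 = \<one>\<^bsub>bigC W\<^esub>" "c1 = n2 \<otimes>\<^bsub>bigC W\<^esub> c2"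
    using split [OF c1(1,2) n2 rn2] by blast
  obtain w2 p2 a2 where c2_eq: "c2 = (cls3 W w2, p2, a2)" and w2: "w2 \<in> carrier (cochains 3 W)"
    and p2: "p2 \<in> cocycles 2 W" and a2: "a2 \<in> cocycles 1 W"
    using bigC_cases [OF KerD_closed [OF c2(1)]] by blast
  have "a1 = coboundary 0 W \<one>\<^bsub>cochains 0 W\<^esub> +\<^bsub>1,W\<^esub> a2"
    and p1_eq: "p1 = coboundary 1 W s +\<^bsub>2,W\<^esub> p2 +\<^bsub>2,W\<^esub> cup 1 1 W (coboundary 0 W \<one>\<^bsub>cochains 0 W\<^esub>) a2"
    using c2(3) w2 by (simp_all add: c1_eq c2_eq n2_def bigD'_def bigC_mult)
  then have a2_zero: "a2 = \<one>\<^bsub>cochains 1 W\<^esub>"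
    using a1_zero a2 by (simp add: d0 r_one cocycles_closed)
  have "p2 = \<one>\<^bsub>cochains 2 W\<^esub>"
  proof (rule cochain2_eqI [where X = W])
    fix \<sigma> assume \<sigma>: "singular_simplex 2 W \<sigma>"
    have "p1 (subsimplex [0, 1, 2] \<sigma>) = p1 (subsimplex [0, 1, 2] \<sigma>) + p2 (subsimplex [0, 1, 2] \<sigma>)"
      using arg_cong [OF p1_eq, of "\<lambda>p. p (subsimplex [0, 1, 2] \<sigma>)"]
      by (simp add: add_on_face [OF \<sigma>] d0 cup_on_face [OF \<sigma>] zero_on_face [OF \<sigma>] flip: s(2))
    then show "p2 (subsimplex [0, 1, 2] \<sigma>) = \<one>\<^bsub>cochains 2 W\<^esub> (subsimplex [0, 1, 2] \<sigma>)"
      by (simp add: zero_on_face [OF \<sigma>])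
  qed (use p2 in \<open>simp_all add: cocycles_closed\<close>)
  note c2_eq = c2_eq [unfolded this a2_zero]
  have "change_coefficients half 4 W (cup 2 2 W \<one>\<^bsub>cochains 2 W\<^esub> \<one>\<^bsub>cochains 2 W\<^esub>) = \<one>\<^bsub>cochains 4 W\<^esub>"
    by (rule cochain4_eqI [where X = W]) (simp_all add: on_face)
  then have "coboundary 3 W w2 = \<one>\<^bsub>cochains 4 W\<^esub>"
    using c2(1) w2 by (simp add: c2_eq KerD_def kernel_def bigD_eq r_one)
  then have "w2 \<in> cocycles 3 W"
    using w2 by (simp add: cocycles_def kernel_def)
  then obtain h where h: "h \<in> carrier (cochains 2 W)" "w2 = coboundary 2 W h +\<^bsub>3,W\<^esub> pull_cochain 3 W r w2"
    using coh3 by blast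
  have "cls3 W w2 = cls3 W (pull_cochain 3 W r w2)"
    using h w2 by (subst cls3_eq_iff) auto
  also have "\<dots> = cls3 W \<one>\<^bsub>cochains 3 W\<^esub>"
    using c2(2) w2 by (simp add: c2_eq pull_triple_eq [OF r] bigC_one)
  finally have "c2 = \<one>\<^bsub>bigC W\<^esub>"
    by (simp add: c2_eq bigC_one)
  then have "c = n1 \<otimes>\<^bsub>bigC W\<^esub> n2"
    using c1(3) c2(3) subgroup.mem_carrier [OF subgroup_ImD' n2] by simp
  then show ?thesis
    using n1 n2 subgroup.m_closed [OF subgroup_ImD'] by blast
qed

text \<open>Apply the preceding lemma to \<open>c (r\<^sup>*c)\<^sup>-\<^sup>1\<close>, which is killed by \<open>r\<^sup>*\<close> because \<open>r\<close> is idempotent.\<close>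

lemma G_map_of_contraction:
  fixes W :: "'a topology"
  assumes F: "continuous_map (prod_topology (top_of_set {0..1::real}) W) W F"
    and r: "r = (\<lambda>x. F (0, x))" "\<And>x. F (1, x) = x" "\<And>x. r (r x) = r x"
    and \<xi>: "\<xi> \<in> carrier (G W)"
  shows "G_map W r \<xi> = \<xi>"
proof -
  interpret C: group "bigC W" by (rule group_bigC)
  have "continuous_map W (prod_topology (top_of_set {0..1::real}) W) (\<lambda>x. (0, x))"
    by (intro continuous_map_pairedI) simp_all
  from continuous_map_compose [OF this F] have cont: "continuous_map W W r"
    by (simp add: r(1) o_def)
  have "(\<lambda>x. F (1, x)) = id"
    using r(2) by auto
  then have cohomologous: "\<exists>h\<in>carrier (cochains k W). z = coboundary k W h +\<^bsub>Suc k,W\<^esub> pull_cochain (Suc k) W r z"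
    if "z \<in> cocycles (Suc k) W" for k and z :: "('a, 'm::ab_group_add) cochain"
    using homotopic_pullbacks_cohomologous [OF F that] pull_cochain_id [OF cocycles_closed [OF that]]
    by (simp add: r(1))
  obtain c where c: "c \<in> KerD W" "\<xi> = G_class W c"
    using \<xi> by (auto simp: carrier_G)
  let ?d = "pull_triple W r c"
  have d: "?d \<in> KerD W" and dC: "?d \<in> carrier (bigC W)" and cC: "c \<in> carrier (bigC W)"
    using pull_KerD [OF cont c(1)] c(1) KerD_closed by blast+
  have "r \<circ> r = r"
    using r(3) by auto
  then have rd: "pull_triple W r ?d = ?d"
    using pull_triple_compose [OF cont cont cC] by simp
  have inv_d: "inv\<^bsub>bigC W\<^esub> ?d \<in> KerD W"
    using subgroup.m_inv_closed [OF subgroup_KerD d] .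
  have "pull_triple W r (inv\<^bsub>bigC W\<^esub> ?d) = inv\<^bsub>bigC W\<^esub> ?d"
    using group_hom.hom_inv [of "bigC W" "bigC W" "pull_triple W r" ?d] dC rd
    by (simp add: group_hom_def group_hom_axioms_def group_bigC pull_triple_hom [OF cont])
  then have "pull_triple W r (c \<otimes>\<^bsub>bigC W\<^esub> inv\<^bsub>bigC W\<^esub> ?d) = \<one>\<^bsub>bigC W\<^esub>"
    using hom_mult [OF pull_triple_hom [OF cont] cC KerD_closed [OF inv_d]] dC by simp
  moreover have "c \<otimes>\<^bsub>bigC W\<^esub> inv\<^bsub>bigC W\<^esub> ?d \<in> KerD W"
    using subgroup.m_closed [OF subgroup_KerD c(1) inv_d] .
  ultimately have "c \<otimes>\<^bsub>bigC W\<^esub> inv\<^bsub>bigC W\<^esub> ?d \<in> ImD' W"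
    using cohomologous [of _ 0] cohomologous [of _ 1] cohomologous [of _ 2]
    by (intro KerD_trivial_of_retraction [OF cont]) (simp_all add: One_nat_def [symmetric])
  from G_class_eqI [OF dC this] have "G_class W c = G_class W ?d"
    using cC dC by (simp add: C.m_assoc)
  then show ?thesis
    using G_map_class [OF cont c(1)] c(2) by simp
qed

text \<open>Write \<open>f = h i\<^sub>0\<close> and \<open>g = h i\<^sub>1\<close> with the two ends \<open>i\<^sub>0, i\<^sub>1\<close> of the cylinder. Sliding the cylinder down
  to its bottom shows that \<open>r = i\<^sub>0 \<pi>\<close> acts as the identity, and \<open>r i\<^sub>1 = i\<^sub>0\<close>.\<close>

lemma G_map_homotopic:
  fixes X :: "'a topology" and Y :: "'b topology"
  assumes "homotopic_with (\<lambda>_. True) X Y f g" and \<xi>: "\<xi> \<in> carrier (G Y)"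
  shows "G_map X f \<xi> = G_map X g \<xi>"
proof -
  let ?I = "top_of_set {0..1::real}"
  let ?W = "prod_topology ?I X"
  obtain h where h: "continuous_map ?W Y h" and hfg: "\<And>x. h (0, x) = f x" "\<And>x. h (1, x) = g x"
    using assms(1) by (auto simp: homotopic_with_def)
  define F :: "real \<times> (real \<times> 'a) \<Rightarrow> real \<times> 'a" where "F = (\<lambda>(s, u, x). (s * u, x))"
  define r :: "real \<times> 'a \<Rightarrow> real \<times> 'a" where "r = (\<lambda>z. F (0, z))"
  have F: "continuous_map (prod_topology ?I ?W) ?W F"
  proof -
    have "continuous_map (prod_topology ?I ?W) ?I (fst \<circ> snd)" and x: "continuous_map (prod_topology ?I ?W)
      X (snd \<circ> snd)"
      by (rule continuous_map_compose [OF continuous_map_snd] continuous_map_fst continuous_map_snd)+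
    with continuous_map_fst [of ?I ?W] have "continuous_map (prod_topology ?I ?W) euclideanreal (\<lambda>z. fst z *
      fst (snd z))"
      by (intro continuous_map_real_mult) (simp_all add: continuous_map_in_subtopology o_def)
    then have "continuous_map (prod_topology ?I ?W) ?I (\<lambda>z. fst z * fst (snd z))"
      by (auto simp: continuous_map_in_subtopology mult_le_one)
    moreover have "continuous_map (prod_topology ?I ?W) X (\<lambda>z. snd (snd z))"
      using x by (simp add: o_def)
    ultimately show ?thesis
      unfolding F_def case_prod_unfold by (rule continuous_map_pairedI)
  qed
  have end_map: "continuous_map X ?W (\<lambda>x. (s, x))" if "s \<in> {0..1}" for s
    using that by (intro continuous_map_pairedI) simp_all
  have r: "continuous_map ?W ?W r"
  proof -
    have "continuous_map ?W (prod_topology ?I ?W) (\<lambda>z. (0, z))"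
      by (intro continuous_map_pairedI) simp_all
    from continuous_map_compose [OF this F] show ?thesis
      by (simp add: r_def o_def)
  qed
  have fg: "f = h \<circ> (\<lambda>x. (0, x))" "g = h \<circ> (\<lambda>x. (1, x))"
    using hfg by auto
  let ?\<eta> = "G_map ?W h \<xi>"
  have \<eta>: "?\<eta> \<in> carrier (G ?W)"
    using G_map_continuous_hom [OF h] \<xi> hom_in_carrier by (auto simp: continuous_hom_def)
  have "G_map X g \<xi> = G_map X (\<lambda>x. (1, x)) ?\<eta>"
    unfolding fg(2) by (rule G_map_compose [OF end_map h \<xi>]) simp
  also have "\<dots> = G_map X (\<lambda>x. (1, x)) (G_map ?W r ?\<eta>)"
    using G_map_of_contraction [OF F r_def _ _ \<eta>] by (simp add: F_def r_def case_prod_unfold)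
  also have "\<dots> = G_map X (r \<circ> (\<lambda>x. (1, x))) ?\<eta>"
    by (rule G_map_compose [OF end_map r \<eta>, symmetric]) simp
  also have "r \<circ> (\<lambda>x. (1, x)) = (\<lambda>x. (0, x))"
    by (auto simp: r_def F_def)
  also have "G_map X (\<lambda>x. (0, x)) ?\<eta> = G_map X f \<xi>"
    unfolding fg(1) by (rule G_map_compose [OF end_map h \<xi>, symmetric]) simp
  finally show ?thesis by simp
qed

section \<open>A space with non-abelian C(X)\<close>

text \<open>On the simplex in the line with vertices \<open>0, 1, 2\<close>, let \<open>a\<close> and \<open>b\<close> be the coboundaries of the indicator
  functions of \<open>0\<close> and \<open>2\<close>. Then \<open>ab\<close> takes the value \<open>1\<close> and \<open>ba\<close> the value \<open>0\<close>.\<close>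

lemma bigC_not_commutative:
  "\<exists>c \<in> carrier (bigC euclideanreal). \<exists>d \<in> carrier (bigC euclideanreal).
     c \<otimes>\<^bsub>bigC euclideanreal\<^esub> d \<noteq> d \<otimes>\<^bsub>bigC euclideanreal\<^esub> c"
proof -
  let ?W = "euclideanreal"
  define \<sigma> :: "(nat \<Rightarrow> real) \<Rightarrow> real" where "\<sigma> = (\<lambda>t\<in>standard_simplex 2. t 1 + 2 * t 2)"
  have "continuous_map (powertop_real UNIV) euclideanreal (\<lambda>t. t 1 + 2 * t (2::nat))"
    by (intro continuous_map_add continuous_map_real_mult_left) (auto intro: continuous_map_product_projection)
  then have "continuous_map (subtopology (powertop_real UNIV) (standard_simplex 2)) euclideanreal \<sigma>"
    by (intro continuous_map_eq [OF continuous_map_from_subtopology]) (auto simp: \<sigma>_def)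
  then have \<sigma>: "singular_simplex 2 ?W \<sigma>"
    by (simp add: singular_simplex_def \<sigma>_def)
  define pt :: "nat \<Rightarrow> real" where "pt = (\<lambda>j. if j = 0 then 1 else 0)"
  define ind :: "real \<Rightarrow> (real, bit) cochain" where
    "ind v = (\<lambda>\<tau>\<in>singular_simplex_set 0 ?W. if \<tau> pt = v then 1 else 0)" for v
  have "push [i] pt = (\<lambda>j. if j = i then 1 else 0)" for i
    by (auto simp: push_def pt_def One_nat_def)
  then have vertex: "subsimplex [i] \<sigma> pt = (if i = 1 then 1 else if i = 2 then 2 else 0)" if "i \<le> 2" for i
    using that by (simp add: subsimplex_eq standard_simplex_0 pt_def \<sigma>_def)
  have ind: "ind v (subsimplex [i] \<sigma>) = (if (if i = 1 then 1 else if i = 2 then 2 else 0) =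
    v then 1 else 0)" if "i \<le> 2" for i v
    using that by (simp add: ind_def vertex face [OF \<sigma>])
  let ?a = "coboundary 0 ?W (ind 0)" and ?b = "coboundary 0 ?W (ind 2)"
  let ?z = "cls3 ?W \<one>\<^bsub>cochains 3 ?W\<^esub>" and ?o = "\<one>\<^bsub>cochains 2 ?W\<^esub> :: (real, bit) cochain"
  have "(?o +\<^bsub>2,?W\<^esub> ?o +\<^bsub>2,?W\<^esub> cup 1 1 ?W ?a ?b) (subsimplex [0, 1, 2] \<sigma>) \<noteq>
      (?o +\<^bsub>2,?W\<^esub> ?o +\<^bsub>2,?W\<^esub> cup 1 1 ?W ?b ?a) (subsimplex [0, 1, 2] \<sigma>)"
    by (simp add: on_face [OF \<sigma>] ind)
  then have "?o +\<^bsub>2,?W\<^esub> ?o +\<^bsub>2,?W\<^esub> cup 1 1 ?W ?a ?b \<noteq> ?o +\<^bsub>2,?W\<^esub> ?o +\<^bsub>2,?W\<^esub> cup 1 1 ?W ?b ?a"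
    by metis
  then have "(?z, ?o, ?a) \<otimes>\<^bsub>bigC ?W\<^esub> (?z, ?o, ?b) \<noteq> (?z, ?o, ?b) \<otimes>\<^bsub>bigC ?W\<^esub> (?z, ?o, ?a)"
    by (simp add: bigC_mult)
  moreover have "(?z, ?o, ?a) \<in> carrier (bigC ?W)" "(?z, ?o, ?b) \<in> carrier (bigC ?W)"
    by simp_all
  ultimately show ?thesis by blast
qed

section \<open>The functor G\<close>

theorem theorem1p1:
  fixes X :: "'a topology" and Y :: "'b topology" and Z :: "'c topology"
  shows
   "\<comment> \<open>(1)\<close>
    compact_group (bigC X) (bigC_topology X) \<and>
    (\<exists>W :: real topology. \<exists>c \<in> carrier (bigC W). \<exists>c' \<in> carrier (bigC W).
       c \<otimes>\<^bsub>bigC W\<^esub> c' \<noteq> c' \<otimes>\<^bsub>bigC W\<^esub> c) \<and>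
    \<comment> \<open>(2), including that the formula for D does not depend on the representative of a class\<close>
    (\<forall>z \<in> carrier (cochains 3 X). \<forall>p \<in> cocycles 2 X. \<forall>a \<in> cocycles 1 X.
       bigD X (cls3 X z, p, a) =
         coboundary 3 X z +\<^bsub>4,X\<^esub> change_coefficients half 4 X (cup 2 2 X p p)) \<and>
    bigD X \<in> continuous_hom (bigC X) (bigC_topology X) (cochains 4 X) (cochain_topology 4 X) \<and>
    \<comment> \<open>(3)\<close>
    compact_group (bigC' X) (bigC'_topology X) \<and>
    bigD' X \<in> continuous_hom (bigC' X) (bigC'_topology X) (bigC X) (bigC_topology X) \<and>
    ImD' X \<lhd> bigC X \<and>
    derived (bigC X) (carrier (bigC X)) \<subseteq> ImD' X \<and>
    \<comment> \<open>(4)\<close>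
    (\<forall>c \<in> carrier (bigC' X). bigD X (bigD' X c) = \<one>\<^bsub>cochains 4 X\<^esub>) \<and>
    \<comment> \<open>G on objects\<close>
    compact_group (G X) (G_topology X) \<and> comm_group (G X) \<and>
    \<comment> \<open>G on morphisms, induced by pullback of cochains\<close>
    (\<forall>f. continuous_map X Y f \<longrightarrow>
       (\<forall>z \<in> carrier (cochains 3 Y). \<forall>p \<in> cocycles 2 Y. \<forall>a \<in> cocycles 1 Y.
          pull_triple X f (cls3 Y z, p, a) =
            (cls3 X (pull_cochain 3 X f z), pull_cochain 2 X f p, pull_cochain 1 X f a)) \<and>
       (\<forall>c \<in> KerD Y. pull_triple X f c \<in> KerD X \<and>
          G_map X f (G_class Y c) = G_class X (pull_triple X f c)) \<and>
       G_map X f \<in> continuous_hom (G Y) (G_topology Y) (G X) (G_topology X)) \<and>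
    \<comment> \<open>homotopy invariance and functoriality\<close>
    (\<forall>f g. homotopic_with (\<lambda>_. True) X Y f g \<longrightarrow>
       (\<forall>\<xi> \<in> carrier (G Y). G_map X f \<xi> = G_map X g \<xi>)) \<and>
    (\<forall>\<xi> \<in> carrier (G X). G_map X id \<xi> = \<xi>) \<and>
    (\<forall>f g. continuous_map X Y f \<longrightarrow> continuous_map Y Z g \<longrightarrow>
       (\<forall>\<xi> \<in> carrier (G Z). G_map X (g \<circ> f) \<xi> = G_map X f (G_map Y g \<xi>)))"
proof (intro conjI allI impI)
  show "compact_group (bigC X) (bigC_topology X)"
    by (rule compact_group_bigC)
  show "\<exists>W :: real topology. \<exists>c \<in> carrier (bigC W). \<exists>c' \<in> carrier (bigC W).
      c \<otimes>\<^bsub>bigC W\<^esub> c' \<noteq> c' \<otimes>\<^bsub>bigC W\<^esub> c"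
    using bigC_not_commutative by (rule exI)
  show "\<forall>z \<in> carrier (cochains 3 X). \<forall>p \<in> cocycles 2 X. \<forall>a \<in> cocycles 1 X.
      bigD X (cls3 X z, p, a) = coboundary 3 X z +\<^bsub>4,X\<^esub> change_coefficients half 4 X (cup 2 2 X p p)"
    by (simp add: bigD_eq)
  show "bigD X \<in> continuous_hom (bigC X) (bigC_topology X) (cochains 4 X) (cochain_topology 4 X)"
    by (simp add: continuous_hom_def bigD_hom continuous_map_bigD)
  show "compact_group (bigC' X) (bigC'_topology X)"
    by (rule compact_group_bigC')
  show "bigD' X \<in> continuous_hom (bigC' X) (bigC'_topology X) (bigC X) (bigC_topology X)"
    by (simp add: continuous_hom_def bigD'_hom continuous_map_bigD')
  show "ImD' X \<lhd> bigC X"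
    by (rule ImD'_normal)
  show "derived (bigC X) (carrier (bigC X)) \<subseteq> ImD' X"
    by (rule derived_bigC_subset)
  show "\<forall>c \<in> carrier (bigC' X). bigD X (bigD' X c) = \<one>\<^bsub>cochains 4 X\<^esub>"
    by (simp add: bigD_bigD')
  show "compact_group (G X) (G_topology X)" "comm_group (G X)"
    by (rule compact_group_G comm_group_G)+
next
  fix f assume f: "continuous_map X Y f"
  show "\<forall>z \<in> carrier (cochains 3 Y). \<forall>p \<in> cocycles 2 Y. \<forall>a \<in> cocycles 1 Y.
      pull_triple X f (cls3 Y z, p, a) = (cls3 X (pull_cochain 3 X f z), pull_cochain 2 X f p, pull_cochain 1 X f a)"
    by (simp add: pull_triple_eq [OF f])
  show "\<forall>c \<in> KerD Y. pull_triple X f c \<in> KerD X \<and> G_map X f (G_class Y c) = G_class X (pull_triple X f c)"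
    by (simp add: pull_KerD [OF f] G_map_class [OF f])
  show "G_map X f \<in> continuous_hom (G Y) (G_topology Y) (G X) (G_topology X)"
    by (rule G_map_continuous_hom [OF f])
next
  fix f g assume "homotopic_with (\<lambda>_. True) X Y f g"
  then show "\<forall>\<xi> \<in> carrier (G Y). G_map X f \<xi> = G_map X g \<xi>"
    using G_map_homotopic by blast
next
  show "\<forall>\<xi> \<in> carrier (G X). G_map X id \<xi> = \<xi>"
    by (simp add: G_map_id)
next
  fix f g assume "continuous_map X Y f" "continuous_map Y Z g"
  then show "\<forall>\<xi> \<in> carrier (G Z). G_map X (g \<circ> f) \<xi> = G_map X f (G_map Y g \<xi>)"
    by (simp add: G_map_compose)
qed

end
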